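(* Let $\mathcal K\in\{\mathbb N^*,\{2\},\{1,2\}\}$, let $\mathcal N$ and a flower type be fixed with flower generating function $F(z)$, and let $f$ be the generating function of one of the classes $\mathcal R,\mathcal S,\mathcal T$. Let $p(z)$ be the radicand in the closed form of $f$, namely: if $\mathcal K=\mathbb N^*$, $p=z^2F(z)^2-2(z+z^2)F(z)+(1-z)^2$ for $\mathcal R$ and $p=1-4zF(z)$ for $\mathcal S,\mathcal T$; if $\mathcal K=\{2\}$, $p=1-4z^2F(z)$ for $\mathcal R$ and $p=1-4z^2F(z)^2$ for $\mathcal S,\mathcal T$; if $\mathcal K=\{1,2\}$, $p=(1-z)^2-4z^2F(z)$ for $\mathcal R$ and $p=1-2zF(z)-3z^2F(z)^2$ for $\mathcal S,\mathcal T$. Let $\zeta$, the smallest positive root of $p$, be the real dominant singularity of $f$; suppose that $f$ can be analytically continued to a domain $\zeta\cdot\Delta_0$ where $\Delta_0$ is a $\Delta$-domain, and that $\zeta$ is a simple zero of $p$. Put $$\theta(n)=\frac{\sqrt{-\zeta p'(\zeta)}}{2\sqrt{\pi n^3}},\qquad \vartheta(n)=\frac1{\sqrt{-\zeta p'(\zeta)\pi n}}.$$ Let $\kappa$ be any parameter on the flowers of trees, with cumulative generating function $\Omega$, and write $F=F(\zeta)$, $F_u=F_u(\zeta)$, $p'=p'(\zeta)$. Then, as $n\to\infty$: 1. If $\mathcal K=\mathbb N^*$: $[z^n]f\sim\frac1{2\zeta}\theta(n)\zeta^{-n}$ for $\mathcal R$, $\sim\frac1{2\zeta F}\theta(n)\zeta^{-n}$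 for $\mathcal S$, $\sim\frac1{2\zeta}\theta(n)\zeta^{-n}$ for $\mathcal T$; $[z^n]\Omega\sim\frac{(1+\zeta-\zeta F)F_u}{2}\vartheta(n)\zeta^{-n}$ for $\mathcal R$, $\sim\frac{(1-2\zeta F)F_u}{2\zeta F^2}\vartheta(n)\zeta^{-n}$ for $\mathcal S$, $\sim F_u\vartheta(n)\zeta^{-n}$ for $\mathcal T$; hence $\mathbb E_{\mathcal R_n}(\kappa)\sim\frac{2(1+\zeta-\zeta F)F_u}{-p'}n$, $\mathbb E_{\mathcal S_n}(\kappa)\sim\frac{2(1-2\zeta F)F_u}{-\zeta Fp'}n$, $\mathbb E_{\mathcal T_n}(\kappa)\sim\frac{4F_u}{-p'}n$. 2. If $\mathcal K=\{2\}$: $[z^n]f\sim\frac1{2\zeta^2}\theta(n)\zeta^{-n}$ for $\mathcal R$, $\sim\frac1{2\zeta^2F^2}\theta(n)\zeta^{-n}$ for $\mathcal S$, $\sim\frac1{2\zeta^2F}\theta(n)\zeta^{-n}$ for $\mathcal T$; $[z^n]\Omega\sim F_u\vartheta(n)\zeta^{-n}$ for $\mathcal R$, $\sim\frac{(1-2\zeta^2F^2)F_u}{\zeta^2F^3}\vartheta(n)\zeta^{-n}$ for $\mathcal S$, $\sim\frac{F_u}{2\zeta^2F^2}\vartheta(n)\zeta^{-n}$ for $\mathcal T$; hence $\mathbb E_{\mathcal R_n}(\kappa)\sim\frac{4\zeta F_u}{-p'}n$, $\mathbb E_{\mathcal S_n}(\kappa)\sim\frac{4(1-2\zeta^2F^2)F_u}{-\zeta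 Fp'}n$, $\mathbb E_{\mathcal T_n}(\kappa)\sim\frac{2F_u}{-\zeta Fp'}n$. 3. If $\mathcal K=\{1,2\}$: $[z^n]f\sim\frac1{2\zeta^2}\theta(n)\zeta^{-n}$ for $\mathcal R$, $\sim\frac1{2\zeta^2F^2}\theta(n)\zeta^{-n}$ for $\mathcal S$, $\sim\frac1{2\zeta^2F}\theta(n)\zeta^{-n}$ for $\mathcal T$; $[z^n]\Omega\sim F_u\vartheta(n)\zeta^{-n}$ for $\mathcal R$, $\sim\frac{(2-3\zeta F-3\zeta^2F^2)F_u}{2\zeta^2F^3}\vartheta(n)\zeta^{-n}$ for $\mathcal S$, $\sim\frac{(1-\zeta F)F_u}{2\zeta^2F^2}\vartheta(n)\zeta^{-n}$ for $\mathcal T$; hence $\mathbb E_{\mathcal R_n}(\kappa)\sim\frac{4\zeta^2F_u}{-\zeta p'}n$, $\mathbb E_{\mathcal S_n}(\kappa)\sim\frac{2(2-3\zeta F-3\zeta^2F^2)F_u}{-\zeta Fp'}n$, $\mathbb E_{\mathcal T_n}(\kappa)\sim\frac{2(1-\zeta F)F_u}{-\zeta Fp'}n$. 4. For the classes $\mathcal R^*,\mathcal S^*,\mathcal T^*$ the same statements hold (for the same $\mathcal K$), with $F$ replaced by $F^*=F-1$ throughout (including in $p$), $F_u$ unchanged.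
   Context: A tree is a rooted plane tree; a $\mathcal K$-tree is one whose internal nodes have numbers of children in $\mathcal K\subseteq\mathbb N^*$; $K(w)=\sum_{k\in\mathcal K}w^k$. For nonempty $\mathcal N\subseteq\mathbb N^*$, a non-plane $\mathcal N$-flower is an integer partition with parts (petals) in $\mathcal N$ (generating function $\prod_{n\in\mathcal N}(1-z^n)^{-1}$), a rooted-plane $\mathcal N$-flower is an integer composition with parts in $\mathcal N$ (generating function $(1-N(z))^{-1}$, $N(z)=\sum_{n\in\mathcal N}z^n$); $F(z)$ is the generating function of the chosen flower class (size = sum of parts). Size of a tree with flowers = tree edges + total flower sizes. Generating functions: $R=F+K(zR)$ (flowers on leaves), $S=1+K(zFS)$ (flowers on every node but the root), $T=FS$ (flowers everywhere); $R^*,S^*,T^*$ are the same with $F$ replaced by $F^*=F-1$ (no empty flowers). A parameter on the flowers of trees is a parameter $\kappa$ whose bivariate generating function $f(z,u)$ is obtained from $f(z)$ by replacing $F(z)$ by a bivariate series $F(z,u)$ with $F(z,1)=F(z)$ (for $*$-classes $F^*$ is replaced by $F(z,u)-1$); e.g. number of petals ($F(z,u)=\prod_{n\in\mathcal N}(1-uz^n)^{-1}$ or $(1-uN(z))^{-1}$) or number of edges in petals ($F(z,u)=F(uz)$). $F_u(z)=\partial_uF(z,u)|_{u=1}$, $\Omega(z)=\partial_uf(z,u)|_{u=1}$, and $\mathbb E_{\Theta_n}(\kappa)=[z^n]\Omega(z)/[z^n]f(z)$ is the mean of $\kappa$ over the objects of size $n$ of the class $\Theta$ (uniform distribution). A $\Delta$-domain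 is a set $\{z:|z|<R,\ z\ne1,\ |\arg(z-1)|>\phi\}$ with $R>1$, $0<\phi<\pi/2$, and $\zeta\cdot\Delta_0$ is its image under $z\mapsto\zeta z$.
   Formalization: For the claims on Ω and the means, it is additionally assumed that ζ lies strictly inside the disc of convergence of F_u and that F_u(ζ) is nonzero unless F_u vanishes identically; without this F_u(ζ) can diverge, e.g. for a parameter adding 10^(size) for each flower. *)

theory Defs
  imports "HOL-Analysis.Analysis" "HOL-Library.Landau_Symbols"
begin

section \<open>Flowers\<close>

text \<open>
  A flower is the list of its petals. Integer partitions are represented by their
  weakly decreasing lists of parts, integer compositions by arbitrary lists of parts.
  Parts are meant to be positive: \<open>0 \<notin> N\<close> is an assumption wherever it matters.
\<close>

type_synonym flower = "nat list"

datatype flower_kind = Non_Plane | Rooted_Plane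

fun flowers :: "flower_kind \<Rightarrow> nat set \<Rightarrow> flower set" where
  "flowers Non_Plane N = {\<phi>. set \<phi> \<subseteq> N \<and> sorted_wrt (\<ge>) \<phi>}"
| "flowers Rooted_Plane N = {\<phi>. set \<phi> \<subseteq> N}"

definition flower_gf :: "flower_kind \<Rightarrow> nat set \<Rightarrow> real fps" where
  "flower_gf kind N = Abs_fps (\<lambda>n. real (card {\<phi> \<in> flowers kind N. sum_list \<phi> = n}))"


section \<open>Trees with flowers\<close>

text \<open>
  Every node stores a flower; a node that carries no flower stores \<open>[]\<close>.
\<close>

datatype ftree = Node flower "ftree list"

fun ftree_size :: "ftree \<Rightarrow> nat" where
  "ftree_size (Node \<phi> ts) = sum_list \<phi> + (\<Sum>t\<leftarrow>ts. Suc (ftree_size t))"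

text \<open>
  The classes \<open>\<R>\<close>, \<open>\<S>\<close>, \<open>\<T>\<close>: flowers on the leaves, on all nodes but the root, on all
  nodes. \<open>K\<close> is the set of admissible numbers of children of an internal node, and
  \<open>\<Phi>\<close> the set of flowers that may be attached. The starred classes are obtained by
  taking \<open>\<Phi>\<close> without the empty flower.
\<close>

datatype tree_class = Class_R | Class_S | Class_T

fun R_tree :: "nat set \<Rightarrow> flower set \<Rightarrow> ftree \<Rightarrow> bool" where
  "R_tree K \<Phi> (Node \<phi> ts) \<longleftrightarrow>
     (if ts = [] then \<phi> \<in> \<Phi>
      else \<phi> = [] \<and> length ts \<in> K \<and> (\<forall>t\<in>set ts. R_tree K \<Phi> t))"

fun T_tree :: "nat set \<Rightarrow> flower set \<Rightarrow> ftree \<Rightarrow> bool" where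
  "T_tree K \<Phi> (Node \<phi> ts) \<longleftrightarrow>
     \<phi> \<in> \<Phi> \<and> (ts = [] \<or> length ts \<in> K) \<and> (\<forall>t\<in>set ts. T_tree K \<Phi> t)"

fun S_tree :: "nat set \<Rightarrow> flower set \<Rightarrow> ftree \<Rightarrow> bool" where
  "S_tree K \<Phi> (Node \<phi> ts) \<longleftrightarrow>
     \<phi> = [] \<and> (ts = [] \<or> length ts \<in> K) \<and> (\<forall>t\<in>set ts. T_tree K \<Phi> t)"

fun class_tree :: "tree_class \<Rightarrow> nat set \<Rightarrow> flower set \<Rightarrow> ftree \<Rightarrow> bool" where
  "class_tree Class_R = R_tree"
| "class_tree Class_S = S_tree"
| "class_tree Class_T = T_tree"

definition objects ::
  "tree_class \<Rightarrow> bool \<Rightarrow> nat set \<Rightarrow> flower_kind \<Rightarrow> nat set \<Rightarrow> nat \<Rightarrow> ftree set" where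
  "objects cls star K kind N n =
     {t. class_tree cls K (if star then flowers kind N - {[]} else flowers kind N) t
         \<and> ftree_size t = n}"


section \<open>Generating functions and means\<close>

definition tree_gf ::
  "tree_class \<Rightarrow> bool \<Rightarrow> nat set \<Rightarrow> flower_kind \<Rightarrow> nat set \<Rightarrow> real fps" where
  "tree_gf cls star K kind N = Abs_fps (\<lambda>n. real (card (objects cls star K kind N n)))"

text \<open>
  Bivariate series are power series in \<open>z\<close> whose coefficients are polynomials in \<open>u\<close>.
\<close>

definition tree_bgf ::
  "tree_class \<Rightarrow> bool \<Rightarrow> nat set \<Rightarrow> flower_kind \<Rightarrow> nat set \<Rightarrow> (ftree \<Rightarrow> nat) \<Rightarrow> real poly fps" where
  "tree_bgf cls star K kind N \<kappa> =
     Abs_fps (\<lambda>n. \<Sum>t\<in>objects cls star K kind N n. monom 1 (\<kappa> t))"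

definition at_u1 :: "real poly fps \<Rightarrow> real fps" where
  "at_u1 B = Abs_fps (\<lambda>n. poly (fps_nth B n) 1)"

definition deriv_u1 :: "real poly fps \<Rightarrow> real fps" where
  "deriv_u1 B = Abs_fps (\<lambda>n. poly (pderiv (fps_nth B n)) 1)"

definition mean_on :: "'a set \<Rightarrow> ('a \<Rightarrow> nat) \<Rightarrow> real" where
  "mean_on A \<kappa> = (\<Sum>t\<in>A. real (\<kappa> t)) / real (card A)"

definition degree_series :: "nat set \<Rightarrow> 'a::comm_ring_1 fps" where
  "degree_series K = Abs_fps (\<lambda>k. if k \<in> K then 1 else 0)"

text \<open>
  \<open>f\<close> is the series of the given class when \<open>F\<close> is the series of the flowers.
\<close>

fun class_equation ::
  "tree_class \<Rightarrow> nat set \<Rightarrow> 'a::comm_ring_1 fps \<Rightarrow> 'a fps \<Rightarrow> bool" where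
  "class_equation Class_R K F f \<longleftrightarrow> f = F + (degree_series K oo (fps_X * f))"
| "class_equation Class_S K F f \<longleftrightarrow> f = 1 + (degree_series K oo (fps_X * F * f))"
| "class_equation Class_T K F f \<longleftrightarrow>
     (\<exists>S. S = 1 + (degree_series K oo (fps_X * F * S)) \<and> f = F * S)"

text \<open>
  \<open>\<kappa>\<close> is a parameter on the flowers, with \<open>B = F(z,u)\<close>.
\<close>

definition flower_parameter ::
  "tree_class \<Rightarrow> bool \<Rightarrow> nat set \<Rightarrow> flower_kind \<Rightarrow> nat set
     \<Rightarrow> (ftree \<Rightarrow> nat) \<Rightarrow> real poly fps \<Rightarrow> bool" where
  "flower_parameter cls star K kind N \<kappa> B \<longleftrightarrow>
     at_u1 B = flower_gf kind N \<and>
     class_equation cls K (if star then B - 1 else B) (tree_bgf cls star K kind N \<kappa>)"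


section \<open>Singularities\<close>

text \<open>
  The radicand in the closed form of the generating function, with \<open>y\<close> standing for \<open>F(z)\<close>.
  It is only meaningful for the three sets \<open>K\<close> distinguished here.
\<close>

definition radicand :: "nat set \<Rightarrow> tree_class \<Rightarrow> real \<Rightarrow> real \<Rightarrow> real" where
  "radicand K cls z y =
     (if K = {1..} then
        (if cls = Class_R then z^2 * y^2 - 2 * (z + z^2) * y + (1 - z)^2 else 1 - 4 * z * y)
      else if K = {2} then
        (if cls = Class_R then 1 - 4 * z^2 * y else 1 - 4 * z^2 * y^2)
      else
        (if cls = Class_R then (1 - z)^2 - 4 * z^2 * y else 1 - 2 * z * y - 3 * z^2 * y^2))"

definition delta_domain :: "real \<Rightarrow> real \<Rightarrow> complex set" where
  "delta_domain r \<phi> = {z. cmod z < r \<and> z \<noteq> 1 \<and> \<bar>Arg (z - 1)\<bar> > \<phi>}"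

end

theory Submission
  imports Defs "HOL-Complex_Analysis.Complex_Analysis"
begin

text \<open>
  In all nine cases \<open>f\<close> is a root of a quadratic \<open>a f\<^sup>2 - b f + c\<close> whose coefficients are polynomials in \<open>z\<close>
  and \<open>F(z)\<close>, so that \<open>h = b - 2 a f\<close> is a square root of the radicand \<open>p\<close>. Near \<open>\<zeta>\<close> this gives
  \<open>f = b / (2 a) - h / (2 a)\<close> with \<open>h\<close> an analytic function times \<open>(1 - z / \<zeta>)\<^sup>1\<^sup>/\<^sup>2\<close>. Differentiating the
  quadratic with respect to \<open>u\<close> gives \<open>h \<Omega> = M F\<^sub>u\<close> with \<open>M\<close> a polynomial in \<open>z\<close>, \<open>F\<close>, \<open>f\<close>. As
  \<open>1 - h\<close> has nonnegative coefficients, \<open>h\<close> has no zero other than \<open>\<zeta>\<close> in the closed disc of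
  convergence, hence \<open>\<Omega>\<close> continues like \<open>f\<close>, with an exponent \<open>-1/2\<close> at \<open>\<zeta>\<close>.

  For the transfer to coefficients no contour is needed: after subtraction of finitely many terms
  \<open>\<beta> (1 - z)\<^sup>\<alpha>\<close> the remainder has a bounded second derivative on the open disc, so that its
  coefficients are \<open>O(1/n\<^sup>2)\<close>.
\<close>

section \<open>Transfer from algebraic singularities to coefficients\<close>

text \<open>Continuation is assumed for f alone, so that of \<Omega> has to be earned: a zero of h
  on the circle |z| = \<zeta> away from \<zeta> could be a pole of \<Omega>. Excluding it takes both
  the signs of the coefficients of 1 - h, which come from the combinatorics, and the regularity of f
  at that point, which comes from the \<Delta>-domain; signs alone would permit h to be a series in
  a power of z, vanishing at rotated copies of \<zeta> as well. The equation h^2 = p fixes h only up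
  to sign; positivity on [0, \<zeta>), which follows from h(0) = 1 and the absence of smaller zeros
  of p, selects the branch. The order 2 of the derivative in the transfer is dictated by the targets
  n^(-3/2) and n^(-1/2): an error O(n^(-2)) is smaller than both. Since F is analytic beyond
  \<zeta>, the square root is the only source of singularity, and the value sqrt(-\<zeta>
  p'(\<zeta>)) of its analytic cofactor appears in both scales: as a numerator for f, with exponent
  1/2, and as a denominator for \<Omega>, with exponent -1/2.\<close>

text \<open>\<open>c\<close> is the expansion at \<open>0\<close> of a function that continues analytically across the unit circle
  everywhere but at \<open>1\<close>, where it has the form \<open>a + b (1 - z)\<^sup>\<alpha>\<close> with \<open>b 1 = \<beta>\<close>.\<close>

definition branch_at_1 :: "real \<Rightarrow> complex \<Rightarrow> complex fps \<Rightarrow> bool" where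
  "branch_at_1 \<alpha> \<beta> c \<longleftrightarrow>
     (\<exists>G V \<epsilon> a b. open V \<and> cball 0 1 - {1} \<subseteq> V \<and> G holomorphic_on V \<and> G has_fps_expansion c \<and>
        0 < \<epsilon> \<and> a holomorphic_on ball 1 \<epsilon> \<and> b holomorphic_on ball 1 \<epsilon> \<and> b 1 = \<beta> \<and>
        (\<forall>z\<in>ball 0 1 \<inter> ball 1 \<epsilon>. G z = a z + b z * (1 - z) powr of_real \<alpha>))"

lemma branch_at_1I:
  assumes "open V" "cball 0 1 - {1} \<subseteq> V" "G holomorphic_on V" "G has_fps_expansion c"
    "0 < \<epsilon>" "a holomorphic_on ball 1 \<epsilon>" "b holomorphic_on ball 1 \<epsilon>" "b 1 = \<beta>"
    "\<And>z. norm z < 1 \<Longrightarrow> dist 1 z < \<epsilon> \<Longrightarrow> G z = a z + b z * (1 - z) powr of_real \<alpha>"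
  shows "branch_at_1 \<alpha> \<beta> c"
  unfolding branch_at_1_def using assms
  by (intro exI[of _ G] exI[of _ V] exI[of _ \<epsilon>] exI[of _ a] exI[of _ b]) auto

lemma branch_at_1E:
  assumes "branch_at_1 \<alpha> \<beta> c"
  obtains G V \<epsilon> a b where "open V" "cball 0 1 - {1} \<subseteq> V" "G holomorphic_on V" "G has_fps_expansion c"
    "0 < \<epsilon>" "a holomorphic_on ball 1 \<epsilon>" "b holomorphic_on ball 1 \<epsilon>" "b 1 = \<beta>"
    "\<And>z. norm z < 1 \<Longrightarrow> dist 1 z < \<epsilon> \<Longrightarrow> G z = a z + b z * (1 - z) powr of_real \<alpha>"
  using assms unfolding branch_at_1_def by auto

lemma one_minus_notin_nonpos_Reals:
  fixes z :: complex
  assumes "z \<in> cball 0 1 - {1}"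
  shows "1 - z \<notin> \<real>\<^sub>\<le>\<^sub>0"
proof
  assume "1 - z \<in> \<real>\<^sub>\<le>\<^sub>0"
  then obtain x where x: "x \<le> 0" "1 - z = of_real x" by (auto simp: nonpos_Reals_def)
  hence z: "z = of_real (1 - x)" by (simp add: algebra_simps)
  have "norm z = \<bar>1 - x\<bar>" unfolding z by (rule norm_of_real)
  with assms x have "x = 0" by auto
  with z assms show False by auto
qed

lemma open_slit: "open {z :: complex. 1 - z \<notin> \<real>\<^sub>\<le>\<^sub>0}"
proof -
  have "open ((\<lambda>z::complex. 1 - z) -` (- \<real>\<^sub>\<le>\<^sub>0))"
    by (intro open_vimage continuous_intros) (auto intro: closed_nonpos_Reals_complex)
  also have "\<dots> = {z. 1 - z \<notin> \<real>\<^sub>\<le>\<^sub>0}" by auto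
  finally show ?thesis .
qed

text \<open>Product rule on the local form: \<open>b (1 - z) powr \<alpha>\<close> has derivative
  \<open>(b' (1 - z) - \<alpha> b) (1 - z) powr (\<alpha> - 1)\<close>, and at 1 only
  \<open>- \<alpha> b 1\<close> survives in the cofactor.\<close>

lemma branch_at_1_deriv:
  assumes "branch_at_1 \<alpha> \<beta> c"
  shows "branch_at_1 (\<alpha> - 1) (- of_real \<alpha> * \<beta>) (fps_deriv c)"
  using assms
proof (rule branch_at_1E)
  fix G V \<epsilon> a b
  assume *: "open V" "cball 0 1 - {1} \<subseteq> V" "G holomorphic_on V" "G has_fps_expansion c"
    "0 < \<epsilon>" "a holomorphic_on ball 1 \<epsilon>" "b holomorphic_on ball 1 \<epsilon>" "b 1 = \<beta>"
    "\<And>z. norm z < 1 \<Longrightarrow> dist 1 z < \<epsilon> \<Longrightarrow> G z = a z + b z * (1 - z) powr of_real \<alpha>"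
  show ?thesis
  proof (rule branch_at_1I)
    show "deriv G holomorphic_on V" using * by (intro holomorphic_deriv)
    show "deriv G has_fps_expansion fps_deriv c" using * by (intro has_fps_expansion_deriv)
    show "deriv a holomorphic_on ball 1 \<epsilon>" using * by (intro holomorphic_deriv) auto
    show "(\<lambda>z. deriv b z * (1 - z) - of_real \<alpha> * b z) holomorphic_on ball 1 \<epsilon>"
      using * by (intro holomorphic_intros holomorphic_deriv) auto
    show "deriv b 1 * (1 - 1) - of_real \<alpha> * b 1 = - of_real \<alpha> * \<beta>" using * by simp
    fix z :: complex assume z: "norm z < 1" "dist 1 z < \<epsilon>"
    have slit: "1 - z \<notin> \<real>\<^sub>\<le>\<^sub>0" using z by (intro one_minus_notin_nonpos_Reals) auto
    have nz: "1 - z \<noteq> 0" using slit by auto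
    have da: "(a has_field_derivative deriv a z) (at z)"
      using * z by (intro holomorphic_derivI[of _ "ball 1 \<epsilon>"]) auto
    have db: "(b has_field_derivative deriv b z) (at z)"
      using * z by (intro holomorphic_derivI[of _ "ball 1 \<epsilon>"]) auto
    have dp: "((\<lambda>z. (1 - z) powr of_real \<alpha>) has_field_derivative
        - (of_real \<alpha> * (1 - z) powr (of_real \<alpha> - 1))) (at z)"
      using slit by (auto intro!: derivative_eq_intros)
    have "((\<lambda>z. a z + b z * (1 - z) powr of_real \<alpha>) has_field_derivative
        deriv a z + (deriv b z * (1 - z) powr of_real \<alpha> +
          - (of_real \<alpha> * (1 - z) powr (of_real \<alpha> - 1)) * b z)) (at z)"
      by (intro DERIV_add DERIV_mult da db dp)
    moreover have "eventually (\<lambda>w. w \<in> ball 0 1 \<inter> ball 1 \<epsilon>) (nhds z)"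
      using z by (intro eventually_nhds_in_open) auto
    hence "eventually (\<lambda>w. G w = a w + b w * (1 - w) powr of_real \<alpha>) (nhds z)"
      by eventually_elim (use *(9) in auto)
    ultimately have "(G has_field_derivative
        deriv a z + (deriv b z * (1 - z) powr of_real \<alpha> +
          - (of_real \<alpha> * (1 - z) powr (of_real \<alpha> - 1)) * b z)) (at z)"
      by (subst DERIV_cong_ev[OF refl _ refl])
    hence "deriv G z = deriv a z + (deriv b z * (1 - z) powr of_real \<alpha> +
          - (of_real \<alpha> * (1 - z) powr (of_real \<alpha> - 1)) * b z)"
      by (rule DERIV_imp_deriv)
    moreover have "(1 - z) powr of_real \<alpha> = (1 - z) * (1 - z) powr (of_real \<alpha> - 1)"
      using nz by (simp add: powr_diff)
    ultimately show "deriv G z = deriv a z +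
        (deriv b z * (1 - z) - of_real \<alpha> * b z) * (1 - z) powr of_real (\<alpha> - 1)"
      by (simp add: algebra_simps)
  qed (use * in auto)
qed

text \<open>With a nonnegative exponent the continuation is bounded on the open unit disc: by the
  local form near 1, by compactness elsewhere. Cauchy's inequality on radius t bounds the n-th
  coefficient by M / t^n, and t tends to 1.\<close>

lemma branch_at_1_bounded:
  assumes "branch_at_1 \<alpha> \<beta> c" "0 \<le> \<alpha>"
  shows "\<exists>M. \<forall>n. norm (fps_nth c n) \<le> M"
  using assms(1)
proof (rule branch_at_1E)
  fix G V \<epsilon> a b
  assume *: "open V" "cball 0 1 - {1} \<subseteq> V" "G holomorphic_on V" "G has_fps_expansion c"
    "0 < \<epsilon>" "a holomorphic_on ball 1 \<epsilon>" "b holomorphic_on ball 1 \<epsilon>" "b 1 = \<beta>"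
    "\<And>z. norm z < 1 \<Longrightarrow> dist 1 z < \<epsilon> \<Longrightarrow> G z = a z + b z * (1 - z) powr of_real \<alpha>"
  have bdd: "\<exists>M\<ge>0. \<forall>z\<in>S. norm (h z) \<le> M" if "compact S" "continuous_on S h" for S and h :: "complex \<Rightarrow> complex"
  proof -
    have "bounded (h ` S)" using that by (intro compact_imp_bounded compact_continuous_image)
    then obtain M where "\<forall>z\<in>S. norm (h z) \<le> M" by (auto simp: bounded_iff)
    thus ?thesis by (intro exI[of _ "max M 0"]) auto
  qed
  \<comment> \<open>Half the radius, since \<open>a\<close> and \<open>b\<close> need not be bounded
    up to the boundary of \<open>ball 1 \<epsilon>\<close>.\<close>
  have sub: "cball 1 (\<epsilon> / 2) \<subseteq> ball 1 \<epsilon>" using *(5) by auto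
  obtain Ma where Ma: "Ma \<ge> 0" "\<And>z. z \<in> cball 1 (\<epsilon>/2) \<Longrightarrow> norm (a z) \<le> Ma"
    using bdd[of "cball 1 (\<epsilon>/2)" a] *(6) sub
    by (meson compact_cball continuous_on_subset holomorphic_on_imp_continuous_on)
  obtain Mb where Mb: "Mb \<ge> 0" "\<And>z. z \<in> cball 1 (\<epsilon>/2) \<Longrightarrow> norm (b z) \<le> Mb"
    using bdd[of "cball 1 (\<epsilon>/2)" b] *(7) sub
    by (meson compact_cball continuous_on_subset holomorphic_on_imp_continuous_on)
  have "compact (cball 0 1 - ball 1 (\<epsilon>/2) :: complex set)" by (intro compact_diff) auto
  moreover have "cball 0 1 - ball 1 (\<epsilon>/2) \<subseteq> V" using *(2,5) by auto
  ultimately obtain Mg where Mg: "Mg \<ge> 0" "\<And>z. z \<in> cball 0 1 - ball 1 (\<epsilon>/2) \<Longrightarrow> norm (G z) \<le> Mg"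
    using bdd[of "cball 0 1 - ball 1 (\<epsilon>/2)" G] *(3)
    by (meson continuous_on_subset holomorphic_on_imp_continuous_on)
  define M where "M = Mg + (Ma + Mb * 2 powr \<alpha>)"
  have M: "norm (G z) \<le> M" if z: "norm z < 1" for z
  proof (cases "z \<in> ball 1 (\<epsilon>/2)")
    case True
    have "norm (1 - z) \<le> norm (1::complex) + norm z" by (rule norm_triangle_ineq4)
    hence "norm ((1 - z) powr of_real \<alpha>) \<le> 2 powr \<alpha>"
      using z assms(2) by (subst norm_powr_real_powr') (auto intro!: powr_mono2)
    moreover have "norm (a z) \<le> Ma" "norm (b z) \<le> Mb" using True Ma Mb by auto
    moreover have "G z = a z + b z * (1 - z) powr of_real \<alpha>" using True z *(5,9) by auto
    ultimately have "norm (G z) \<le> Ma + Mb * 2 powr \<alpha>"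
      using Mb(1) by (metis (no_types) add_mono_thms_linordered_semiring(1) mult_mono' norm_ge_zero
          norm_mult norm_triangle_le)
    thus ?thesis using Mg(1) by (simp add: M_def)
  next
    case False
    hence "norm (G z) \<le> Mg" using z Mg by auto
    moreover have "0 \<le> Mb * 2 powr \<alpha>" using Mb by simp
    ultimately show ?thesis using Ma by (simp add: M_def)
  qed
  have "norm (fps_nth c n) \<le> M" for n
  proof -
    have *: "norm (fps_nth c n) * t ^ n \<le> M" if t: "0 < t" "t < 1" for t :: real
    proof -
      have "ball 0 1 \<subseteq> V" using *(2) by force
      hence cb: "cball 0 t \<subseteq> V" using t by (auto simp: subset_iff)
      have "norm ((deriv ^^ n) G 0) \<le> fact n * M / t ^ n"
      proof (rule Cauchy_inequality)
        show "G holomorphic_on ball 0 t" using cb ball_subset_cball *(3) holomorphic_on_subset by blast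
        show "continuous_on (cball 0 t) G"
          using cb *(3) continuous_on_subset holomorphic_on_imp_continuous_on by blast
      qed (use t M in auto)
      moreover have "fps_nth c n = (deriv ^^ n) G 0 / fact n" by (rule fps_nth_fps_expansion) (use *(4) in simp)
      ultimately have "norm (fps_nth c n) \<le> fact n * M / t ^ n / fact n"
        by (simp only: norm_divide norm_fact) (rule divide_right_mono, auto)
      thus ?thesis using t by (simp add: field_simps)
    qed
    have "((\<lambda>t. norm (fps_nth c n) * t ^ n) \<longlongrightarrow> norm (fps_nth c n) * 1 ^ n) (at_left (1::real))"
      by (intro tendsto_intros)
    moreover have "eventually (\<lambda>t::real. t \<in> {0<..<1}) (at_left 1)"
      by (rule eventually_at_left_real) simp
    hence "eventually (\<lambda>t::real. norm (fps_nth c n) * t ^ n \<le> M) (at_left 1)"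
      by eventually_elim (use * in auto)
    ultimately show ?thesis
      by (intro tendsto_upperbound[where F = "at_left 1" and a = M]) (auto simp: trivial_limit_at_left_real)
  qed
  thus ?thesis by blast
qed

definition one_minus_powr_fps :: "real \<Rightarrow> complex fps" where
  "one_minus_powr_fps \<alpha> = Abs_fps (\<lambda>n. (-1) ^ n * (of_real \<alpha> gchoose n))"

lemma has_fps_expansion_one_minus_powr:
  "(\<lambda>z. (1 - z) powr of_real \<alpha>) has_fps_expansion one_minus_powr_fps \<alpha>"
proof (rule has_fps_expansionI)
  have "eventually (\<lambda>z::complex. z \<in> ball 0 1) (nhds 0)"
    by (intro eventually_nhds_in_open) auto
  thus "\<forall>\<^sub>F z in nhds 0. (\<lambda>n. fps_nth (one_minus_powr_fps \<alpha>) n * z ^ n) sums (1 - z) powr of_real \<alpha>"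
  proof eventually_elim
    case (elim z)
    hence "(\<lambda>n. (of_real \<alpha> gchoose n) * (- z) ^ n) sums (1 + - z) powr of_real \<alpha>"
      by (intro gen_binomial_complex) auto
    thus ?case by (simp add: one_minus_powr_fps_def power_minus[of z] mult_ac)
  qed
qed

text \<open>\<open>b z - b 1\<close> vanishes at 1 and is therefore 1 - z times a holomorphic
  function, so removing the leading singular term raises the exponent by one.\<close>

lemma branch_at_1_subtract:
  assumes "branch_at_1 \<alpha> \<beta> c"
  obtains \<gamma> where "branch_at_1 (\<alpha> + 1) \<gamma> (c - fps_const \<beta> * one_minus_powr_fps \<alpha>)"
  using assms
proof (rule branch_at_1E)
  fix G V \<epsilon> a b
  assume *: "open V" "cball 0 1 - {1} \<subseteq> V" "G holomorphic_on V" "G has_fps_expansion c"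
    "0 < \<epsilon>" "a holomorphic_on ball 1 \<epsilon>" "b holomorphic_on ball 1 \<epsilon>" "b 1 = \<beta>"
    "\<And>z. norm z < 1 \<Longrightarrow> dist 1 z < \<epsilon> \<Longrightarrow> G z = a z + b z * (1 - z) powr of_real \<alpha>"
  define b' where "b' = (\<lambda>z. - (if z = 1 then deriv b 1 else (b z - b 1) / (z - 1)))"
  have "branch_at_1 (\<alpha> + 1) (b' 1) (c - fps_const \<beta> * one_minus_powr_fps \<alpha>)"
  proof (rule branch_at_1I)
    \<comment> \<open>The subtracted power is holomorphic only off the cut from 1 to infinity, which
      meets the closed disc in 1 alone.\<close>
    let ?V = "V \<inter> {z. 1 - z \<notin> \<real>\<^sub>\<le>\<^sub>0}"
    show "open ?V" using * open_slit by blast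
    show "cball 0 1 - {1} \<subseteq> ?V" using *(2) one_minus_notin_nonpos_Reals by blast
    show "(\<lambda>z. G z - \<beta> * (1 - z) powr of_real \<alpha>) holomorphic_on ?V"
      by (intro holomorphic_intros holomorphic_on_subset[OF *(3)]) auto
    show "(\<lambda>z. G z - \<beta> * (1 - z) powr of_real \<alpha>) has_fps_expansion
        (c - fps_const \<beta> * one_minus_powr_fps \<alpha>)"
      by (intro fps_expansion_intros has_fps_expansion_one_minus_powr *)
    show "a holomorphic_on ball 1 \<epsilon>" by fact
    show "b' holomorphic_on ball 1 \<epsilon>" unfolding b'_def
      by (intro holomorphic_on_minus pole_lemma_open *) auto
    fix z :: complex assume z: "norm z < 1" "dist 1 z < \<epsilon>"
    have nz: "1 - z \<noteq> 0" using z by auto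
    have 1: "b z = \<beta> + b' z * (1 - z)" using nz *(8) by (simp add: b'_def field_simps)
    have 2: "(1 - z) powr of_real (\<alpha> + 1) = (1 - z) * (1 - z) powr of_real \<alpha>"
      using nz by (simp add: powr_add)
    show "G z - \<beta> * (1 - z) powr of_real \<alpha> = a z + b' z * (1 - z) powr of_real (\<alpha> + 1)"
      unfolding *(9)[OF z] 1 2 by (simp add: algebra_simps)
  qed (use * in auto)
  thus thesis using that by blast
qed

text \<open>\<open>rGamma\<close> is total: for natural \<alpha> the binomial series terminates, and
  the limit is the value 0 of \<open>rGamma\<close> at a pole of Gamma.\<close>

lemma one_minus_powr_fps_asymptotics:
  "(\<lambda>n. fps_nth (one_minus_powr_fps \<alpha>) n * of_real (real n powr (\<alpha> + 1))) \<longlonglongrightarrow> of_real (rGamma (- \<alpha>))"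
proof -
  have "(\<lambda>n. (complex_of_real \<alpha> gchoose n) / ((-1)^n / exp ((of_real \<alpha>+1) * of_real (ln (real n)))))
      \<longlonglongrightarrow> inverse (Gamma (- of_real \<alpha>))"
    by (rule gbinomial_asymptotic)
  also have "inverse (Gamma (- complex_of_real \<alpha>)) = of_real (rGamma (- \<alpha>))"
    by (simp add: rGamma_inverse_Gamma[symmetric] rGamma_complex_of_real flip: of_real_minus)
  finally show ?thesis
  proof (rule Lim_transform_eventually)
    have "(complex_of_real \<alpha> gchoose n) / ((-1)^n / exp ((of_real \<alpha>+1) * of_real (ln (real n)))) =
        fps_nth (one_minus_powr_fps \<alpha>) n * of_real (real n powr (\<alpha> + 1))" if "n > 0" for n
    proof -
      have "exp ((complex_of_real \<alpha>+1) * of_real (ln (real n))) = of_real (real n powr (\<alpha> + 1))"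
        using that by (simp add: powr_def exp_of_real[symmetric])
      moreover have "x / ((-1)^n / y) = (-1)^n * x * y" for x y :: complex
        by (cases "even n") auto
      ultimately show ?thesis by (simp add: one_minus_powr_fps_def)
    qed
    thus "\<forall>\<^sub>F n in sequentially. (complex_of_real \<alpha> gchoose n) /
        ((-1)^n / exp ((of_real \<alpha>+1) * of_real (ln (real n)))) =
        fps_nth (one_minus_powr_fps \<alpha>) n * of_real (real n powr (\<alpha> + 1))"
      using eventually_gt_at_top[of 0] by (rule eventually_mono[rotated])
  qed
qed

lemma one_minus_powr_fps_bigo:
  "fps_nth (one_minus_powr_fps \<alpha>) \<in> O(\<lambda>n. of_real (real n powr (- (\<alpha> + 1))))"
proof -
  have "(\<lambda>n. fps_nth (one_minus_powr_fps \<alpha>) n / of_real (real n powr (-(\<alpha> + 1))))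
      \<longlonglongrightarrow> of_real (rGamma (- \<alpha>))"
    using one_minus_powr_fps_asymptotics[of \<alpha>]
    by (simp only: powr_minus of_real_inverse divide_inverse inverse_inverse_eq)
  thus ?thesis
    by (rule bigoI_tendsto) (auto intro!: eventually_mono[OF eventually_gt_at_top[of 0]])
qed

text \<open>Two differentiations leave a nonnegative exponent, hence bounded coefficients of the
  second derivative; these are of order n^2 times those of \<open>c\<close>.\<close>

lemma branch_at_1_bigo_2:
  assumes "branch_at_1 \<alpha> \<beta> c" "2 \<le> \<alpha>"
  shows "fps_nth c \<in> O(\<lambda>n. of_real (real n powr (-2)))"
proof -
  have "branch_at_1 (\<alpha> - 1 - 1) (- of_real (\<alpha> - 1) * (- of_real \<alpha> * \<beta>)) (fps_deriv (fps_deriv c))"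
    by (intro branch_at_1_deriv assms)
  from branch_at_1_bounded[OF this] assms(2)
  obtain M where M: "\<And>n. norm (fps_nth (fps_deriv (fps_deriv c)) n) \<le> M"
    by fastforce
  have "norm (fps_nth c n) \<le> (2 * M) * norm (complex_of_real (real n powr (-2)))" if n: "n \<ge> 2" for n
  proof -
    define k where "k = n - 2"
    have k: "n = Suc (Suc k)" using n by (simp add: k_def)
    have "fps_nth (fps_deriv (fps_deriv c)) k = of_nat (k + 1) * (of_nat (k + 2) * fps_nth c n)"
      by (simp add: k del: of_nat_Suc of_nat_add)
    hence "norm (fps_nth (fps_deriv (fps_deriv c)) k) = real (k + 1) * (real (k + 2) * norm (fps_nth c n))"
      by (simp only: norm_mult norm_of_nat)
    hence 1: "(real k + 1) * (real k + 2) * norm (fps_nth c n) \<le> M"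
      using M[of k] by (simp add: mult.assoc add.commute)
    \<comment> \<open>The factor 2 absorbs the index shift: n^2 \<le> 2 n (n - 1) for n \<ge>
      2.\<close>
    have "real n ^ 2 \<le> 2 * ((real k + 1) * (real k + 2))"
      unfolding k by (simp add: power2_eq_square algebra_simps)
    hence "real n ^ 2 * norm (fps_nth c n) \<le> 2 * ((real k + 1) * (real k + 2)) * norm (fps_nth c n)"
      by (rule mult_right_mono) simp
    also have "\<dots> \<le> 2 * M" using 1 by simp
    finally have "norm (fps_nth c n) \<le> 2 * M / real n ^ 2"
      using n by (subst pos_le_divide_eq) (auto simp: mult.commute)
    also have "\<dots> = (2 * M) * norm (complex_of_real (real n powr (-2)))"
      using n by (simp only: norm_of_real powr_minus) (simp add: divide_inverse)
    finally show ?thesis .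
  qed
  thus ?thesis by (intro bigoI[of _ "2 * M"] eventually_mono[OF eventually_ge_at_top[of 2]])
qed

lemma bigo_powr_mono:
  assumes "(s :: real) \<le> t"
  shows "(\<lambda>n. complex_of_real (real n powr s)) \<in> O(\<lambda>n. of_real (real n powr t))"
  by (rule bigoI[of _ 1], rule eventually_mono[OF eventually_ge_at_top[of 1]])
     (use assms in \<open>auto intro!: powr_mono\<close>)

text \<open>Induction on the number k of leading terms to strip until the exponent reaches 2. The
  bound is the order n^(-\<alpha>-1) of the first singular term or the cutoff n^(-2), whichever
  decays more slowly.\<close>

lemma branch_at_1_bigo:
  assumes "branch_at_1 \<alpha> \<beta> c" "2 \<le> \<alpha> + real k"
  shows "fps_nth c \<in> O(\<lambda>n. of_real (real n powr (- min (\<alpha> + 1) 2)))"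
  using assms
proof (induction k arbitrary: \<alpha> \<beta> c)
  case 0
  thus ?case using branch_at_1_bigo_2[of \<alpha> \<beta> c] by (simp add: min_def)
next
  case (Suc k)
  obtain \<gamma> where "branch_at_1 (\<alpha> + 1) \<gamma> (c - fps_const \<beta> * one_minus_powr_fps \<alpha>)"
    using Suc.prems(1) by (rule branch_at_1_subtract)
  hence 1: "fps_nth (c - fps_const \<beta> * one_minus_powr_fps \<alpha>) \<in>
      O(\<lambda>n. of_real (real n powr (- min (\<alpha> + 1 + 1) 2)))"
    using Suc.prems(2) by (intro Suc.IH) auto
  have 2: "fps_nth (c - fps_const \<beta> * one_minus_powr_fps \<alpha>) \<in>
      O(\<lambda>n. of_real (real n powr (- min (\<alpha> + 1) 2)))"
    by (rule landau_o.big.trans[OF 1 bigo_powr_mono]) auto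
  have 3: "(\<lambda>n. \<beta> * fps_nth (one_minus_powr_fps \<alpha>) n) \<in> O(\<lambda>n. of_real (real n powr (- min (\<alpha> + 1) 2)))"
  proof (rule landau_o.big.trans)
    show "(\<lambda>n. \<beta> * fps_nth (one_minus_powr_fps \<alpha>) n) \<in> O(\<lambda>n. of_real (real n powr (- (\<alpha> + 1))))"
      using one_minus_powr_fps_bigo[of \<alpha>] by (cases "\<beta> = 0") simp_all
  qed (rule bigo_powr_mono, simp)
  from sum_in_bigo(1)[OF 2 3] show ?case by simp
qed

text \<open>After one subtraction the remainder is of order n^(-min (\<alpha> + 2) 2); \<alpha> < 1
  makes this smaller than n^(-\<alpha>-1), so the binomial coefficients determine the limit.\<close>

theorem branch_at_1_transfer:
  assumes "branch_at_1 \<alpha> \<beta> c" "\<alpha> < 1"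
  shows "(\<lambda>n. fps_nth c n * of_real (real n powr (\<alpha> + 1))) \<longlonglongrightarrow> \<beta> * of_real (rGamma (- \<alpha>))"
proof -
  let ?p = "one_minus_powr_fps \<alpha>" and ?w = "\<lambda>n::nat. complex_of_real (real n powr (\<alpha> + 1))"
  obtain \<gamma> where \<gamma>: "branch_at_1 (\<alpha> + 1) \<gamma> (c - fps_const \<beta> * ?p)"
    using assms(1) by (rule branch_at_1_subtract)
  \<comment> \<open>Enough terms for \<open>\<alpha> + 1 + real k\<close> to reach 2.\<close>
  obtain k where "1 - \<alpha> \<le> real k" using real_arch_simple by blast
  hence "fps_nth (c - fps_const \<beta> * ?p) \<in> O(\<lambda>n. of_real (real n powr (- min (\<alpha> + 1 + 1) 2)))"
    by (intro branch_at_1_bigo[OF \<gamma>, of k]) auto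
  moreover have "(\<lambda>n. complex_of_real (real n powr (- min (\<alpha> + 1 + 1) 2))) \<in> o(\<lambda>n. 1 / ?w n)"
  proof (rule smalloI_tendsto)
    have "(\<lambda>n. real n powr (- min 1 (1 - \<alpha>))) \<longlonglongrightarrow> 0"
      using assms(2) by (intro tendsto_neg_powr filterlim_real_sequentially) auto
    hence "(\<lambda>n. complex_of_real (real n powr (- min 1 (1 - \<alpha>)))) \<longlonglongrightarrow> of_real 0"
      by (rule tendsto_of_real)
    moreover have "complex_of_real (real n powr (- min 1 (1 - \<alpha>))) =
        complex_of_real (real n powr (- min (\<alpha> + 1 + 1) 2)) / (1 / ?w n)" for n
    proof -
      have "- min 1 (1 - \<alpha>) = - min (\<alpha> + 1 + 1) 2 + (\<alpha> + 1)" by (simp add: min_def)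
      thus ?thesis by (simp only: powr_add of_real_mult) simp
    qed
    ultimately show "(\<lambda>n. complex_of_real (real n powr (- min (\<alpha> + 1 + 1) 2)) / (1 / ?w n)) \<longlonglongrightarrow> 0"
      by simp
  qed (auto intro!: eventually_mono[OF eventually_gt_at_top[of 0]])
  ultimately have "fps_nth (c - fps_const \<beta> * ?p) \<in> o(\<lambda>n. 1 / ?w n)"
    by (rule landau_o.big_small_trans)
  hence "(\<lambda>n. fps_nth (c - fps_const \<beta> * ?p) n / (1 / ?w n)) \<longlonglongrightarrow> 0"
    by (rule smalloD_tendsto)
  moreover have "(\<lambda>n. \<beta> * (fps_nth ?p n * ?w n)) \<longlonglongrightarrow> \<beta> * of_real (rGamma (- \<alpha>))"
    by (intro tendsto_intros one_minus_powr_fps_asymptotics)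
  ultimately have "(\<lambda>n. fps_nth (c - fps_const \<beta> * ?p) n / (1 / ?w n) + \<beta> * (fps_nth ?p n * ?w n))
      \<longlonglongrightarrow> 0 + \<beta> * of_real (rGamma (- \<alpha>))"
    by (rule tendsto_add)
  thus ?thesis by (simp add: algebra_simps)
qed

section \<open>Square-root singularities\<close>

lemma rGamma_half: "rGamma (1/2 :: real) = 1 / sqrt pi"
  unfolding rGamma_inverse_Gamma Gamma_one_half_real by (simp add: divide_inverse)

lemma rGamma_minus_half: "rGamma (- (1/2) :: real) = - (1 / (2 * sqrt pi))"
  using rGamma_plus1[of "- (1/2) :: real"] rGamma_half by simp

text \<open>Here \<open>A - D f\<close> plays the role of the square root of the radicand \<open>P\<close>, scaled such that the
  singularity is at \<open>1\<close>.\<close>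

locale sqrt_singularity =
  fixes A D P f :: "complex fps" and G :: "complex \<Rightarrow> complex" and V :: "complex set"
    and q \<rho> :: real and u :: "nat \<Rightarrow> real"
  assumes V: "open V" "cball 0 1 - {1} \<subseteq> V" and G: "G holomorphic_on V" "G has_fps_expansion f"
    and \<rho>: "1 < \<rho>" "ereal \<rho> \<le> fps_conv_radius A" "ereal \<rho> \<le> fps_conv_radius D" "ereal \<rho> \<le> fps_conv_radius P"
    and square: "(A - D * f)\<^sup>2 = P"
    and D1: "eval_fps D 1 \<noteq> 0"
    and P1: "eval_fps P 1 = 0" "eval_fps (fps_deriv P) 1 = - of_real (q\<^sup>2)" "0 < q"
    and u: "\<And>n. 0 \<le> u n" "1 - (A - D * f) = Abs_fps (\<lambda>n. of_real (u n))"
    and pos: "\<And>x. 0 \<le> x \<Longrightarrow> x < 1 \<Longrightarrow>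
      \<exists>y>0. eval_fps A (of_real x) - eval_fps D (of_real x) * G (of_real x) = of_real y"
begin

definition H :: "complex \<Rightarrow> complex" where
  "H z = eval_fps A z - eval_fps D z * G z"

text \<open>The cofactor in P = (1 - z) \<psi>. The value at 1 fills the removable singularity,
  which makes \<psi> holomorphic and equal to q^2 there.\<close>

definition \<psi> :: "complex \<Rightarrow> complex" where
  "\<psi> z = - (if z = 1 then deriv (eval_fps P) 1 else (eval_fps P z - eval_fps P 1) / (z - 1))"

lemma eval_holomorphic:
  "ereal \<rho> \<le> fps_conv_radius C \<Longrightarrow> S \<subseteq> ball 0 \<rho> \<Longrightarrow> eval_fps C holomorphic_on S"
  by (rule holomorphic_on_eval_fps) (use ball_eball_mono in blast)

lemma eval_expansion: "ereal \<rho> \<le> fps_conv_radius C \<Longrightarrow> eval_fps C has_fps_expansion C"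
  using \<rho>(1) by (intro eval_fps_has_fps_expansion) (auto intro: less_le_trans[of _ "ereal \<rho>"])

lemma ball_subset: "ball 0 1 \<subseteq> V \<inter> ball 0 \<rho>"
  using V(2) \<rho>(1) by force

lemma H_holomorphic: "S \<subseteq> V \<inter> ball 0 \<rho> \<Longrightarrow> H holomorphic_on S"
  unfolding H_def using \<rho> G(1)
  by (intro holomorphic_intros eval_holomorphic) (auto intro: holomorphic_on_subset)

lemma H_expansion: "H has_fps_expansion A - D * f"
  unfolding H_def by (intro fps_expansion_intros eval_expansion \<rho> G)

lemma H_square: "norm z < 1 \<Longrightarrow> (H z)\<^sup>2 = eval_fps P z"
proof -
  assume z: "norm z < 1"
  have "(\<lambda>z. (H z)\<^sup>2) has_fps_expansion P"
    unfolding square[symmetric] by (intro has_fps_expansion_power H_expansion)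
  hence "eval_fps P z = (H z)\<^sup>2"
    using z by (rule has_fps_expansion_imp_eval_fps_eq)
      (intro holomorphic_intros H_holomorphic ball_subset)
  thus ?thesis ..
qed

lemma u_sums: "norm z < 1 \<Longrightarrow> (\<lambda>n. of_real (u n) * z ^ n) sums (1 - H z)"
proof -
  assume z: "norm z < 1"
  have "(\<lambda>z. 1 - H z) has_fps_expansion Abs_fps (\<lambda>n. of_real (u n))"
    unfolding u(2)[symmetric] by (intro fps_expansion_intros H_expansion)
  hence "(\<lambda>n. fps_nth (Abs_fps (\<lambda>n. of_real (u n))) n * z ^ n) sums (1 - H z)"
  proof (rule has_fps_expansion_imp_sums_complex)
    show "(\<lambda>z. 1 - H z) holomorphic_on eball 0 (ereal 1)"
      unfolding eball_ereal by (intro holomorphic_intros H_holomorphic ball_subset)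
  qed (use z in simp)
  thus ?thesis by simp
qed

lemma H_real: "0 \<le> x \<Longrightarrow> x < 1 \<Longrightarrow> H (of_real x) = of_real (Re (H (of_real x))) \<and> 0 < Re (H (of_real x))"
proof -
  assume "0 \<le> x" "x < 1"
  then obtain y where "y > 0" "H (of_real x) = of_real y" using pos[of x] by (auto simp: H_def)
  thus ?thesis by simp
qed

lemma u_sums_real:
  assumes "0 \<le> x" "x < 1"
  shows "(\<lambda>n. u n * x ^ n) sums (1 - Re (H (of_real x)))"
  using sums_Re[OF u_sums[of "of_real x"]] assms by (simp flip: of_real_power of_real_mult)

lemma \<psi>_holomorphic: "S \<subseteq> ball 0 \<rho> \<Longrightarrow> \<psi> holomorphic_on S"
  unfolding \<psi>_def using \<rho>(4)
  by (rule_tac holomorphic_on_subset[of _ "ball 0 \<rho>"])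
     (intro holomorphic_on_minus pole_lemma_open eval_holomorphic, auto)

lemma eval_P_eq: "eval_fps P z = (1 - z) * \<psi> z"
  using P1(1) by (auto simp: \<psi>_def field_simps)

lemma \<psi>_1: "\<psi> 1 = of_real (q\<^sup>2)"
proof -
  have "norm (1::complex) < fps_conv_radius P"
    using \<rho>(1,4) by (auto intro: less_le_trans[of _ "ereal \<rho>"])
  thus ?thesis using P1(2) by (simp add: \<psi>_def eval_fps_deriv)
qed

lemma \<psi>_real:
  assumes "0 \<le> x" "x < 1"
  shows "\<exists>y>0. \<psi> (of_real x) = of_real y"
proof -
  obtain y where y: "y > 0" "H (of_real x) = of_real y" using pos[OF assms] by (auto simp: H_def)
  have "of_real (y\<^sup>2) = (1 - complex_of_real x) * \<psi> (of_real x)"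
    using H_square[of "of_real x"] eval_P_eq[of "of_real x"] y assms by simp
  moreover have "1 - complex_of_real x \<noteq> 0" using assms by simp
  ultimately have "\<psi> (of_real x) = of_real (y\<^sup>2) / (1 - of_real x)"
    by (metis nonzero_mult_div_cancel_left)
  also have "\<dots> = of_real (y\<^sup>2 / (1 - x))" by simp
  finally have "\<psi> (of_real x) = of_real (y\<^sup>2 / (1 - x))" .
  thus ?thesis using y assms by (intro exI[of _ "y\<^sup>2 / (1 - x)"]) auto
qed

text \<open>As \<psi> 1 = q^2 > 0, the principal root \<sigma> of \<psi> is holomorphic near 1.
  \<open>H\<close> and \<sigma> (1 - z)^(1/2) have equal nonzero squares on a connected lens, so
  their quotient is constantly 1 or constantly -1; positivity of both at one real point
  decides.\<close>

lemma local_form: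
  obtains \<epsilon> \<sigma> where "0 < \<epsilon>" "ball (1::complex) \<epsilon> \<subseteq> ball 0 \<rho>" "\<sigma> holomorphic_on ball 1 \<epsilon>" "\<sigma> 1 = of_real q"
    "\<And>z. z \<in> ball 1 \<epsilon> \<Longrightarrow> \<sigma> z \<noteq> 0" "\<And>z. z \<in> ball 1 \<epsilon> \<Longrightarrow> eval_fps D z \<noteq> 0"
    "\<And>z. norm z < 1 \<Longrightarrow> dist 1 z < \<epsilon> \<Longrightarrow> H z = \<sigma> z * (1 - z) powr of_real (1/2)"
proof -
  have sq: "w powr of_real (1/2) * w powr of_real (1/2) = w" if "w \<noteq> 0" for w :: complex
  proof -
    have "w powr of_real (1/2) * w powr of_real (1/2) = w powr (of_real (1/2) + of_real (1/2))"
      by (rule powr_add[symmetric])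
    also have "of_real (1/2) + of_real (1/2) = (1 :: complex)" by simp
    finally show ?thesis using that by simp
  qed
  have cont: "isCont \<psi> 1" "isCont (eval_fps D) 1"
    using \<psi>_holomorphic[of "ball 0 \<rho>"] eval_holomorphic[OF \<rho>(3), of "ball 0 \<rho>"] \<rho>(1)
    by (auto dest!: holomorphic_on_imp_continuous_on simp: continuous_on_eq_continuous_at)
  have "eventually (\<lambda>z. z \<in> ball 0 \<rho>) (nhds (1::complex))"
    using \<rho>(1) by (intro eventually_nhds_in_open) auto
  moreover have "eventually (\<lambda>w. w \<in> {w. 0 < Re w}) (nhds (\<psi> 1))"
    using P1(3) by (intro eventually_nhds_in_open open_halfspace_Re_gt) (simp add: \<psi>_1)
  hence "eventually (\<lambda>z. \<psi> z \<in> {w. 0 < Re w}) (nhds 1)"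
    using cont(1) unfolding isCont_def tendsto_at_iff_tendsto_nhds by (rule eventually_compose_filterlim)
  moreover have "eventually (\<lambda>z. eval_fps D z \<noteq> 0) (nhds 1)"
    using cont(2) D1 unfolding isCont_def tendsto_at_iff_tendsto_nhds
    by (rule tendsto_imp_eventually_ne)
  ultimately have "eventually (\<lambda>z. z \<in> ball 0 \<rho> \<and> 0 < Re (\<psi> z) \<and> eval_fps D z \<noteq> 0) (nhds 1)"
    by eventually_elim auto
  then obtain \<epsilon>' where \<epsilon>': "\<epsilon>' > 0"
      "\<And>z. dist z 1 < \<epsilon>' \<Longrightarrow> z \<in> ball 0 \<rho> \<and> 0 < Re (\<psi> z) \<and> eval_fps D z \<noteq> 0"
    unfolding eventually_nhds_metric by blast
  \<comment> \<open>The cap 1 keeps the real test point \<open>1 - \<epsilon> / 2\<close>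
    nonnegative.\<close>
  define \<epsilon> where "\<epsilon> = min \<epsilon>' 1"
  have \<epsilon>: "\<epsilon> > 0" "\<epsilon> \<le> 1" "\<And>z. z \<in> ball 1 \<epsilon> \<Longrightarrow> z \<in> ball 0 \<rho> \<and> 0 < Re (\<psi> z) \<and> eval_fps D z \<noteq> 0"
    using \<epsilon>' by (auto simp: \<epsilon>_def dist_commute)
  define \<sigma> where "\<sigma> z = \<psi> z powr of_real (1/2)" for z
  have slit: "\<psi> z \<notin> \<real>\<^sub>\<le>\<^sub>0" if "z \<in> ball 1 \<epsilon>" for z
    using \<epsilon>(3)[OF that] by (auto simp: nonpos_Reals_def)
  have nz: "\<sigma> z \<noteq> 0" if "z \<in> ball 1 \<epsilon>" for z
    using \<epsilon>(3)[OF that] by (auto simp: \<sigma>_def)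
  have hol: "\<sigma> holomorphic_on ball 1 \<epsilon>"
    unfolding \<sigma>_def
  proof (rule holomorphic_on_powr)
    show "\<psi> holomorphic_on ball 1 \<epsilon>" using \<epsilon>(3) by (intro \<psi>_holomorphic) blast
  qed (use slit in auto)
  define S where "S = ball 0 1 \<inter> ball (1::complex) \<epsilon>"
  define s where "s z = \<sigma> z * (1 - z) powr of_real (1/2)" for z
  have s: "(s z)\<^sup>2 = (H z)\<^sup>2 \<and> s z \<noteq> 0" if "z \<in> S" for z
  proof -
    have nz: "\<psi> z \<noteq> 0" "1 - z \<noteq> 0" using that \<epsilon>(3)[of z] by (auto simp: S_def)
    have "(s z)\<^sup>2 = (\<psi> z powr of_real (1/2) * \<psi> z powr of_real (1/2)) *
        ((1 - z) powr of_real (1/2) * (1 - z) powr of_real (1/2))"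
      by (simp only: s_def \<sigma>_def power2_eq_square mult_ac)
    hence *: "(s z)\<^sup>2 = \<psi> z * (1 - z)" by (simp only: sq[OF nz(1)] sq[OF nz(2)])
    with nz have "s z \<noteq> 0" by auto
    with * have "(s z)\<^sup>2 = \<psi> z * (1 - z)" "s z \<noteq> 0" by auto
    thus ?thesis using H_square[of z] eval_P_eq[of z] that by (simp add: S_def)
  qed
  have "(\<lambda>z. H z / s z) constant_on S"
  proof (rule continuous_finite_range_constant)
    show "connected S" unfolding S_def by (intro convex_connected convex_Int convex_ball)
    have "s holomorphic_on S" unfolding s_def
    proof (intro holomorphic_on_mult holomorphic_on_powr holomorphic_on_diff holomorphic_on_const
        holomorphic_on_ident)
      show "\<sigma> holomorphic_on S" using hol by (rule holomorphic_on_subset) (auto simp: S_def)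
      show "1 - z \<notin> \<real>\<^sub>\<le>\<^sub>0" if "z \<in> S" for z
        using that by (intro one_minus_notin_nonpos_Reals) (auto simp: S_def)
    qed
    moreover have "H holomorphic_on S"
      using ball_subset by (intro H_holomorphic) (auto simp: S_def)
    ultimately show "continuous_on S (\<lambda>z. H z / s z)"
      using s by (intro holomorphic_on_imp_continuous_on holomorphic_on_divide) auto
    have "H z / s z \<in> {1, -1}" if "z \<in> S" for z
    proof -
      have "s z = H z \<or> s z = - H z" using s[OF that] by (simp add: power2_eq_iff)
      thus ?thesis using s[OF that] by (metis divide_minus_right div_self insertCI minus_minus neg_equal_0_iff_equal)
    qed
    hence "(\<lambda>z. H z / s z) ` S \<subseteq> {1, -1}" by blast
    thus "finite ((\<lambda>z. H z / s z) ` S)" by (rule finite_subset) simp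
  qed
  then obtain k where k: "\<And>z. z \<in> S \<Longrightarrow> H z / s z = k" by (auto simp: constant_on_def)
  define x where "x = 1 - \<epsilon> / 2"
  have x: "0 \<le> x" "x < 1" "complex_of_real x \<in> S"
  proof -
    have "dist 1 (complex_of_real x) = norm (complex_of_real (1 - x))" by (simp add: dist_norm)
    also have "\<dots> = \<bar>1 - x\<bar>" by (rule norm_of_real)
    finally show "complex_of_real x \<in> S" "0 \<le> x" "x < 1"
      using \<epsilon>(1,2) by (auto simp: S_def x_def norm_of_real simp del: of_real_diff)
  qed
  have "k = 1"
  proof -
    obtain y where y: "y > 0" "\<psi> (of_real x) = of_real y" using \<psi>_real[OF x(1,2)] by auto
    have "complex_of_real y powr of_real (1/2) = of_real (y powr (1/2))"
      "complex_of_real (1 - x) powr of_real (1/2) = of_real ((1 - x) powr (1/2))"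
      using y x by (intro powr_of_real; simp)+
    hence "s (of_real x) = of_real (y powr (1/2) * (1 - x) powr (1/2))"
      by (simp only: s_def \<sigma>_def y(2) of_real_mult of_real_diff of_real_1)
    moreover obtain v where v: "v > 0" "H (of_real x) = of_real v" using pos[OF x(1,2)] by (auto simp: H_def)
    ultimately have kk: "k = of_real (v / (y powr (1/2) * (1 - x) powr (1/2)))" (is "k = of_real ?r")
      using k[OF x(3)] by simp
    have "?r > 0" using y x v by simp
    moreover have "k\<^sup>2 = (H (of_real x))\<^sup>2 / (s (of_real x))\<^sup>2"
      unfolding k[OF x(3), symmetric] by (rule power_divide)
    hence "k\<^sup>2 = 1" using s[OF x(3)] by (metis div_self power_not_zero)
    hence "of_real (?r\<^sup>2) = (of_real 1 :: complex)" unfolding kk by (simp only: of_real_power of_real_1)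
    hence "?r = 1 \<or> ?r = - 1" by (simp only: of_real_eq_iff power2_eq_1_iff)
    ultimately have "?r = 1" by linarith
    thus "k = 1" unfolding kk by (simp only: of_real_1)
  qed
  show thesis
  proof (rule that)
    show "ball (1::complex) \<epsilon> \<subseteq> ball 0 \<rho>" using \<epsilon>(3) by blast
    have "complex_of_real (q\<^sup>2) powr of_real (1/2) = of_real ((q\<^sup>2) powr (1/2))"
      by (rule powr_of_real) auto
    also have "(q\<^sup>2) powr (1/2) = q"
      using P1(3) powr_half_sqrt[of "q\<^sup>2"] by simp
    finally show "\<sigma> 1 = of_real q" by (simp only: \<sigma>_def \<psi>_1)
    fix z :: complex assume "norm z < 1" "dist 1 z < \<epsilon>"
    hence "z \<in> S" by (auto simp: S_def)
    with k[of z] s[of z] \<open>k = 1\<close> show "H z = \<sigma> z * (1 - z) powr of_real (1/2)" by (simp add: s_def)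
  qed (use \<epsilon> nz hol in auto)
qed

text \<open>A zero at z would make the sum of u_n z^n equal to 1, whereas its modulus is at most the
  sum 1 - H(|z|) < 1 of the moduli.\<close>

lemma H_nonzero_inside: "norm z < 1 \<Longrightarrow> H z \<noteq> 0"
proof
  assume z: "norm z < 1" and "H z = 0"
  from u_sums[OF z] this have "(\<lambda>n. of_real (u n) * z ^ n) sums 1" by simp
  moreover have "(\<lambda>n. u n * norm z ^ n) sums (1 - Re (H (of_real (norm z))))"
    using z by (intro u_sums_real) auto
  ultimately have "norm (1::complex) \<le> 1 - Re (H (of_real (norm z)))"
    using u(1) by (rule_tac norm_sums_le) (auto simp: norm_mult norm_power)
  with H_real[of "norm z"] z show False by auto
qed

text \<open>A zero on the unit circle forces equality in the triangle inequality for \<open>\<Sum>u\<^sub>n z\<^sup>n\<close>.\<close>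

lemma H_aligned:
  assumes z: "norm z = 1" "z \<noteq> 1" "H z = 0"
  shows "u n = 0 \<or> z ^ n = 1"
proof -
  have re: "Re (z ^ m) \<le> 1" for m
    using complex_Re_le_cmod[of "z ^ m"] z(1) by (simp add: norm_power)
  \<comment> \<open>Re H(t z) - H(t) is the sum of the nonnegative terms u_m t^m (1 - Re z^m) and
    dominates each of them. As H(t) > 0, so does Re H(t z), which tends to 0 as t tends to
    1.\<close>
  have le: "u n * t ^ n * (1 - Re (z ^ n)) \<le> Re (H (of_real t * z))" if t: "0 \<le> t" "t < 1" for t
  proof -
    have "(\<lambda>m. of_real (u m) * (of_real t * z) ^ m) sums (1 - H (of_real t * z))"
      using t z by (intro u_sums) (auto simp: norm_mult)
    from sums_Re[OF this] have "(\<lambda>m. u m * t ^ m * Re (z ^ m)) sums (1 - Re (H (of_real t * z)))"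
      by (simp add: power_mult_distrib mult.assoc flip: of_real_power)
    from sums_diff[OF u_sums_real[OF t] this]
    have "(\<lambda>m. u m * t ^ m * (1 - Re (z ^ m))) sums (Re (H (of_real t * z)) - Re (H (of_real t)))"
      by (simp add: algebra_simps)
    moreover have "0 \<le> u m * t ^ m * (1 - Re (z ^ m))" for m
      using re[of m] u(1)[of m] t by (intro mult_nonneg_nonneg) auto
    ultimately have "u n * t ^ n * (1 - Re (z ^ n)) \<le> Re (H (of_real t * z)) - Re (H (of_real t))"
      using sum_le_suminf[of "\<lambda>m. u m * t ^ m * (1 - Re (z ^ m))" "{n}"] by (auto simp: sums_iff)
    thus ?thesis using H_real[OF t] by auto
  qed
  have zV: "z \<in> V \<inter> ball 0 \<rho>" using V(2) z \<rho>(1) by auto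
  have "isCont H z"
    using zV V(1) H_holomorphic[OF order_refl] holomorphic_on_imp_continuous_on
      continuous_on_eq_continuous_at[of "V \<inter> ball 0 \<rho>" H] by blast
  hence cH: "(H \<longlongrightarrow> H z) (nhds z)" by (simp add: isCont_def tendsto_at_iff_tendsto_nhds)
  have "((\<lambda>t. of_real t * z) \<longlongrightarrow> of_real 1 * z) (at_left (1::real))"
    by (intro tendsto_intros)
  hence "filterlim (\<lambda>t. of_real t * z) (nhds z) (at_left (1::real))" by simp
  from filterlim_compose[OF cH this]
  have "((\<lambda>t. Re (H (of_real t * z))) \<longlongrightarrow> Re (H z)) (at_left (1::real))"
    by (rule tendsto_Re)
  moreover have "((\<lambda>t. u n * t ^ n * (1 - Re (z ^ n))) \<longlongrightarrow> u n * 1 ^ n * (1 - Re (z ^ n))) (at_left (1::real))"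
    by (intro tendsto_intros)
  moreover have "eventually (\<lambda>t::real. t \<in> {0<..<1}) (at_left 1)"
    by (rule eventually_at_left_real) simp
  hence "eventually (\<lambda>t. u n * t ^ n * (1 - Re (z ^ n)) \<le> Re (H (of_real t * z))) (at_left (1::real))"
    by eventually_elim (use le in auto)
  ultimately have "u n * 1 ^ n * (1 - Re (z ^ n)) \<le> Re (H z)"
    by (rule_tac tendsto_le) (auto simp: trivial_limit_at_left_real)
  hence "u n * (1 - Re (z ^ n)) \<le> 0" using z(3) by simp
  hence "u n = 0 \<or> Re (z ^ n) = 1" using u(1)[of n] re[of n]
    by (auto simp: mult_le_0_iff)
  moreover have "z ^ n = 1" if "Re (z ^ n) = 1"
  proof -
    have "(Re (z ^ n))\<^sup>2 + (Im (z ^ n))\<^sup>2 = 1" using z(1) by (simp add: norm_power flip: cmod_power2)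
    with that show ?thesis by (simp add: complex_eq_iff)
  qed
  ultimately show ?thesis by blast
qed

text \<open>By alignment, \<open>H (t z) = H t\<close> for \<open>t < 1\<close>; but at \<open>t = 1\<close> the left side is differentiable while
  the right side behaves like \<open>(1 - t)\<^sup>1\<^sup>/\<^sup>2\<close>.\<close>

lemma H_nonzero:
  assumes "z \<in> cball 0 1 - {1}"
  shows "H z \<noteq> 0"
proof
  assume 0: "H z = 0"
  have z: "norm z = 1" "z \<noteq> 1" using H_nonzero_inside[of z] 0 assms by force+
  have eq: "H (of_real t * z) = H (of_real t)" if t: "0 \<le> t" "t < 1" for t
  proof -
    have "(\<lambda>n. of_real (u n) * (of_real t * z) ^ n) sums (1 - H (of_real t * z))"
      using t z by (intro u_sums) (auto simp: norm_mult)
    also have "(\<lambda>n. of_real (u n) * (of_real t * z) ^ n) = (\<lambda>n. of_real (u n) * of_real t ^ n)"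
      using H_aligned[OF z 0] by (intro ext) (auto simp: power_mult_distrib)
    finally have "1 - H (of_real t * z) = 1 - H (of_real t)"
      using sums_unique2[OF _ u_sums[of "of_real t"]] t by simp
    thus ?thesis by simp
  qed
  have zV: "z \<in> V \<inter> ball 0 \<rho>" using V(2) z \<rho>(1) by auto
  have "(H has_field_derivative deriv H z) (at z)"
    using zV V(1) by (intro holomorphic_derivI[OF H_holomorphic[OF order_refl]]) auto
  hence "(H has_field_derivative deriv H z) (at (1 * z))" by simp
  moreover have "((\<lambda>w. w * z) has_field_derivative z) (at 1)"
    by (auto intro!: derivative_eq_intros)
  ultimately have "((\<lambda>w. H (w * z)) has_field_derivative deriv H z * z) (at 1)"
    by (rule DERIV_chain2)
  hence "((\<lambda>w. (H (w * z) - H (1 * z)) / (w - 1)) \<longlongrightarrow> deriv H z * z) (at 1)"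
    by (simp add: has_field_derivative_iff)
  moreover have "filterlim complex_of_real (at 1) (at_left 1)"
    using tendsto_of_real[OF tendsto_ident_at, of 1 "{..<1}", where 'a = complex]
    by (auto simp: filterlim_at eventually_at_filter)
  ultimately have "((\<lambda>t. (H (of_real t * z) - H (1 * z)) / (of_real t - 1)) \<longlongrightarrow> deriv H z * z) (at_left (1::real))"
    by (rule filterlim_compose)
  \<comment> \<open>Squaring removes the root: by \<open>eq\<close> and H z = 0 the expression
    equals P(t) / (1 - t) = \<psi>(t), which tends to q^2 > 0, whereas differentiability at z makes
    it tend to 0.\<close>
  hence "((\<lambda>t. (1 - of_real t) * ((H (of_real t * z) - H (1 * z)) / (of_real t - 1))\<^sup>2)
      \<longlongrightarrow> (1 - of_real 1) * (deriv H z * z)\<^sup>2) (at_left (1::real))"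
    by (intro tendsto_intros)
  moreover have "eventually (\<lambda>t::real. t \<in> {0<..<1}) (at_left 1)"
    by (rule eventually_at_left_real) simp
  hence "eventually (\<lambda>t. (1 - of_real t) * ((H (of_real t * z) - H (1 * z)) / (of_real t - 1))\<^sup>2 =
      \<psi> (of_real t)) (at_left (1::real))"
  proof eventually_elim
    case (elim t)
    hence t: "0 \<le> t" "t < 1" by auto
    define w where "w = complex_of_real t - 1"
    have w: "w \<noteq> 0" using t by (simp add: w_def)
    have X: "(H (of_real t * z) - H (1 * z))\<^sup>2 = - w * \<psi> (of_real t)"
      using eq[OF t] 0 H_square[of "of_real t"] eval_P_eq[of "of_real t"] t by (simp add: w_def)
    have "(1 - of_real t) * ((H (of_real t * z) - H (1 * z)) / w)\<^sup>2 = (- w) * ((- w * \<psi> (of_real t)) / w\<^sup>2)"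
      by (simp only: power_divide X) (simp add: w_def)
    also have "\<dots> = \<psi> (of_real t)" using w by (simp add: power2_eq_square)
    finally show ?case by (simp only: w_def)
  qed
  ultimately have "((\<lambda>t. \<psi> (of_real t)) \<longlongrightarrow> (1 - of_real 1) * (deriv H z * z)\<^sup>2) (at_left (1::real))"
    by (rule Lim_transform_eventually)
  moreover have "isCont \<psi> 1"
    using \<psi>_holomorphic[of "ball 0 \<rho>"] \<rho>(1)
    by (auto dest!: holomorphic_on_imp_continuous_on simp: continuous_on_eq_continuous_at)
  hence "(\<psi> \<longlongrightarrow> \<psi> 1) (nhds 1)" by (simp add: isCont_def tendsto_at_iff_tendsto_nhds)
  from filterlim_compose[OF this]
  have "((\<lambda>t. \<psi> (of_real t)) \<longlongrightarrow> \<psi> 1) (at_left (1::real))"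
    using tendsto_of_real[OF tendsto_ident_at, of 1 "{..<1}", where 'a = complex] by simp
  ultimately have "\<psi> 1 = (1 - of_real 1) * (deriv H z * z)\<^sup>2"
    by (intro tendsto_unique) (auto simp: trivial_limit_at_left_real)
  thus False using \<psi>_1 P1(3) by simp
qed

text \<open>Dividing \<open>H = A - D G\<close> by \<open>D\<close>, which is nonzero near 1,
  isolates G; \<sigma> 1 = q yields the constant.\<close>

theorem f_branch: "branch_at_1 (1/2) (- of_real q / eval_fps D 1) f"
proof (rule local_form)
  fix \<epsilon> \<sigma>
  assume *: "0 < \<epsilon>" "ball (1::complex) \<epsilon> \<subseteq> ball 0 \<rho>" "\<sigma> holomorphic_on ball 1 \<epsilon>" "\<sigma> 1 = of_real q"
    "\<And>z. z \<in> ball 1 \<epsilon> \<Longrightarrow> \<sigma> z \<noteq> 0" "\<And>z. z \<in> ball 1 \<epsilon> \<Longrightarrow> eval_fps D z \<noteq> 0"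
    "\<And>z. norm z < 1 \<Longrightarrow> dist 1 z < \<epsilon> \<Longrightarrow> H z = \<sigma> z * (1 - z) powr of_real (1/2)"
  have eh: "eval_fps C holomorphic_on ball 1 \<epsilon>" if "ereal \<rho> \<le> fps_conv_radius C" for C
    using that *(2) by (rule eval_holomorphic)
  show ?thesis
  proof (rule branch_at_1I)
    show "G holomorphic_on V" by (fact G(1))
    show "(\<lambda>z. eval_fps A z / eval_fps D z) holomorphic_on ball 1 \<epsilon>"
      using * by (intro holomorphic_on_divide eh \<rho>) auto
    show "(\<lambda>z. - \<sigma> z / eval_fps D z) holomorphic_on ball 1 \<epsilon>"
      using * by (intro holomorphic_on_divide holomorphic_on_minus eh \<rho>) auto
    fix z :: complex assume z: "norm z < 1" "dist 1 z < \<epsilon>"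
    have "eval_fps D z * G z = eval_fps A z - \<sigma> z * (1 - z) powr of_real (1/2)"
      using *(7)[OF z] unfolding H_def by (simp only: algebra_simps)
    moreover have "eval_fps D z \<noteq> 0" using z *(6) by simp
    ultimately show "G z = eval_fps A z / eval_fps D z + - \<sigma> z / eval_fps D z * (1 - z) powr of_real (1/2)"
      by (simp add: divide_simps) (simp add: algebra_simps)
  qed (use V G * in auto)
qed

text \<open>W continues as Q / H with Q a quadratic polynomial in G, since H has no zero on the
  closed disc without 1. In terms of s = (1 - z)^(1/2), Q = n0 + n1 s and H = \<sigma> s, so
  \<open>n0\<close> carries the exponent -1/2 and \<open>n1\<close> goes into the regular part. As z
  tends to 1, s vanishes, G tends to A / D, and Q tends to \<open>m\<close>.\<close>

theorem quotient_branch: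
  assumes M: "ereal \<rho> \<le> fps_conv_radius M0" "ereal \<rho> \<le> fps_conv_radius M1" "ereal \<rho> \<le> fps_conv_radius M2"
    and W: "(A - D * f) * W = M0 + M1 * f + M2 * f\<^sup>2"
  defines "m \<equiv> eval_fps M0 1 + eval_fps M1 1 * (eval_fps A 1 / eval_fps D 1) +
    eval_fps M2 1 * (eval_fps A 1 / eval_fps D 1)\<^sup>2"
  shows "branch_at_1 (-1/2) (m / of_real q) W"
proof (rule local_form)
  fix \<epsilon> \<sigma>
  assume *: "0 < \<epsilon>" "ball (1::complex) \<epsilon> \<subseteq> ball 0 \<rho>" "\<sigma> holomorphic_on ball 1 \<epsilon>" "\<sigma> 1 = of_real q"
    "\<And>z. z \<in> ball 1 \<epsilon> \<Longrightarrow> \<sigma> z \<noteq> 0" "\<And>z. z \<in> ball 1 \<epsilon> \<Longrightarrow> eval_fps D z \<noteq> 0"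
    "\<And>z. norm z < 1 \<Longrightarrow> dist 1 z < \<epsilon> \<Longrightarrow> H z = \<sigma> z * (1 - z) powr of_real (1/2)"
  have eh: "eval_fps C holomorphic_on ball 1 \<epsilon>" if "ereal \<rho> \<le> fps_conv_radius C" for C
    using that *(2) by (rule eval_holomorphic)
  define Q where "Q z = eval_fps M0 z + eval_fps M1 z * G z + eval_fps M2 z * (G z)\<^sup>2" for z
  let ?V = "(V \<inter> ball 0 \<rho>) \<inter> H -` (- {0})"
  define a b where "a z = eval_fps A z / eval_fps D z" and "b z = \<sigma> z / eval_fps D z" for z
  define n0 n1 where
    "n0 z = eval_fps M0 z + eval_fps M1 z * a z + eval_fps M2 z * ((a z)\<^sup>2 + (b z)\<^sup>2 * (1 - z))" and
    "n1 z = - eval_fps M1 z * b z - 2 * eval_fps M2 z * a z * b z" for z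
  have hab: "a holomorphic_on ball 1 \<epsilon>" "b holomorphic_on ball 1 \<epsilon>"
    unfolding a_def b_def using * by (auto intro!: holomorphic_on_divide eh \<rho>)
  have hn: "n0 holomorphic_on ball 1 \<epsilon>" "n1 holomorphic_on ball 1 \<epsilon>"
    unfolding n0_def n1_def by (intro holomorphic_intros hab eh M)+
  have h0: "fps_nth (A - D * f) 0 \<noteq> 0"
  proof -
    have "H 0 = fps_nth (A - D * f) 0"
      using H_expansion by (rule has_fps_expansion_imp_0_eq_fps_nth_0)
    thus ?thesis using H_nonzero_inside[of 0] by simp
  qed
  show ?thesis
  proof (rule branch_at_1I)
    show "open ?V"
      using V(1) by (intro continuous_open_preimage holomorphic_on_imp_continuous_on H_holomorphic) auto
    show "cball 0 1 - {1} \<subseteq> ?V" using V(2) H_nonzero \<rho>(1) by auto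
    show "(\<lambda>z. Q z / H z) holomorphic_on ?V" unfolding Q_def
      by (intro holomorphic_intros H_holomorphic eval_holomorphic M holomorphic_on_subset[OF G(1)]) auto
    have "(\<lambda>z. Q z / H z) has_fps_expansion (M0 + M1 * f + M2 * f\<^sup>2) / (A - D * f)" unfolding Q_def
      by (intro has_fps_expansion_divide' H_expansion h0 has_fps_expansion_add has_fps_expansion_mult
          has_fps_expansion_power eval_expansion M G)
    also have "(M0 + M1 * f + M2 * f\<^sup>2) / (A - D * f) = W"
      unfolding W[symmetric] using h0 by (metis fps_zero_nth nonzero_mult_div_cancel_left)
    finally show "(\<lambda>z. Q z / H z) has_fps_expansion W" .
    show "(\<lambda>z. n1 z / \<sigma> z) holomorphic_on ball 1 \<epsilon>" "(\<lambda>z. n0 z / \<sigma> z) holomorphic_on ball 1 \<epsilon>"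
      using * by (auto intro!: holomorphic_on_divide hn)
    show "n0 1 / \<sigma> 1 = m / of_real q" by (simp add: n0_def a_def m_def *(4))
    fix z :: complex assume z: "norm z < 1" "dist 1 z < \<epsilon>"
    define s where "s = (1 - z) powr of_real (1/2)"
    have nz: "1 - z \<noteq> 0" using z(1) by auto
    have "s * s = (1 - z) powr (of_real (1/2) + of_real (1/2))" unfolding s_def
      by (rule powr_add[symmetric])
    also have "of_real (1/2) + of_real (1/2) = (1 :: complex)" by simp
    finally have s2: "s * s = 1 - z" using nz by simp
    hence s0: "s \<noteq> 0" using nz by auto
    have si: "(1 - z) powr of_real (-1/2) = inverse s" unfolding s_def
      by (simp add: powr_minus)
    have nzD: "eval_fps D z \<noteq> 0" and nzS: "\<sigma> z \<noteq> 0" using z *(5,6) by auto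
    have "eval_fps D z * G z = eval_fps A z - \<sigma> z * s"
      using *(7)[OF z] unfolding H_def s_def by (simp only: algebra_simps)
    hence "G z = a z - b z * s" using nzD by (simp add: a_def b_def field_simps)
    hence "Q z = eval_fps M0 z + eval_fps M1 z * (a z - b z * s) + eval_fps M2 z * (a z - b z * s)\<^sup>2"
      by (simp only: Q_def)
    also have "\<dots> = eval_fps M0 z + eval_fps M1 z * a z + eval_fps M2 z * ((a z)\<^sup>2 + (b z)\<^sup>2 * (s * s)) + n1 z * s"
      by (simp add: n1_def algebra_simps power2_eq_square)
    finally have "Q z = n0 z + n1 z * s" by (simp only: s2 n0_def)
    moreover have "H z = \<sigma> z * s" using *(7)[OF z] by (simp only: s_def)
    ultimately show "Q z / H z = n1 z / \<sigma> z + n0 z / \<sigma> z * (1 - z) powr of_real (-1/2)"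
      using s0 nzS unfolding si by (simp add: field_simps)
  qed (use * in auto)
qed

corollary f_asymptotics:
  "(\<lambda>n. fps_nth f n * of_real (real n powr (3/2))) \<longlonglongrightarrow> of_real (q / (2 * sqrt pi)) / eval_fps D 1"
proof -
  have "(\<lambda>n. fps_nth f n * of_real (real n powr (1/2 + 1)))
      \<longlonglongrightarrow> - of_real q / eval_fps D 1 * of_real (rGamma (- (1/2)))"
    by (rule branch_at_1_transfer[OF f_branch]) simp
  also have "- of_real q / eval_fps D 1 * of_real (rGamma (- (1/2))) = of_real (q / (2 * sqrt pi)) / eval_fps D 1"
    by (simp add: rGamma_minus_half field_simps)
  finally show ?thesis by simp
qed

corollary quotient_asymptotics:
  assumes M: "ereal \<rho> \<le> fps_conv_radius M0" "ereal \<rho> \<le> fps_conv_radius M1" "ereal \<rho> \<le> fps_conv_radius M2"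
    and W: "(A - D * f) * W = M0 + M1 * f + M2 * f\<^sup>2"
  shows "(\<lambda>n. fps_nth W n * of_real (real n powr (1/2))) \<longlonglongrightarrow>
    (eval_fps M0 1 + eval_fps M1 1 * (eval_fps A 1 / eval_fps D 1) +
      eval_fps M2 1 * (eval_fps A 1 / eval_fps D 1)\<^sup>2) / of_real (q * sqrt pi)" (is "_ \<longlonglongrightarrow> ?m / _")
proof -
  have "(\<lambda>n. fps_nth W n * of_real (real n powr (-1/2 + 1)))
      \<longlonglongrightarrow> ?m / of_real q * of_real (rGamma (- (-1/2)))"
    by (rule branch_at_1_transfer[OF quotient_branch[OF M W]]) simp
  also have "?m / of_real q * of_real (rGamma (- (-1/2))) = ?m / of_real (q * sqrt pi)"
    by (simp add: rGamma_half)
  finally show ?thesis by simp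
qed

end

text \<open>Cosine decreases on [0, pi], so the condition on \<open>Arg\<close> becomes a strict
  inequality between continuous functions, although \<open>Arg\<close> itself jumps across the
  negative axis. At z = 1 the inequality reads 0 < 0, which excludes that point.\<close>

lemma delta_domain_eq:
  assumes "0 < \<phi>" "\<phi> < pi / 2"
  shows "delta_domain r \<phi> = {z. cmod z < r \<and> Re (z - 1) < cmod (z - 1) * cos \<phi>}"
proof -
  have "\<bar>Arg w\<bar> > \<phi> \<longleftrightarrow> Re w < cmod w * cos \<phi>" if "w \<noteq> 0" for w
  proof -
    have "\<bar>Arg w\<bar> > \<phi> \<longleftrightarrow> cos \<bar>Arg w\<bar> < cos \<phi>"
      using assms Arg_bounded[of w] by (intro cos_mono_less_eq[symmetric]) auto
    also have "cos \<bar>Arg w\<bar> = Re w / cmod w" using that by (simp add: cos_Arg abs_if)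
    also have "\<dots> < cos \<phi> \<longleftrightarrow> Re w < cmod w * cos \<phi>" using that by (simp add: field_simps)
    finally show ?thesis .
  qed
  moreover have "w \<noteq> 0 \<and> Re w < cmod w * cos \<phi> \<longleftrightarrow> Re w < cmod w * cos \<phi>" for w by auto
  ultimately show ?thesis unfolding delta_domain_def
    by (intro Collect_cong) (metis right_minus_eq)
qed

lemma open_delta_domain:
  assumes "0 < \<phi>" "\<phi> < pi / 2"
  shows "open (delta_domain r \<phi>)"
  unfolding delta_domain_eq[OF assms] by (intro open_Collect_conj open_Collect_less continuous_intros)

text \<open>The removed sector lies in the half plane Re (z - 1) > 0, apart from its tip 1, and the
  closed disc in the complementary one.\<close>

lemma cball_subset_delta_domain:
  assumes "1 < r" "0 < \<phi>" "\<phi> < pi / 2"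
  shows "cball 0 1 - {1} \<subseteq> delta_domain r \<phi>"
proof
  fix z :: complex assume z: "z \<in> cball 0 1 - {1}"
  have "0 < cos \<phi>" using assms by (intro cos_gt_zero) auto
  hence "0 < cmod (z - 1) * cos \<phi>" using z by auto
  moreover have "Re (z - 1) \<le> 0" using complex_Re_le_cmod[of z] z by simp
  ultimately show "z \<in> delta_domain r \<phi>" using assms z by (auto simp: delta_domain_eq)
qed

section \<open>Rescaling from a singularity at \<zeta> to one at 1\<close>

definition fps_scale :: "real \<Rightarrow> real fps \<Rightarrow> complex fps" where
  "fps_scale \<zeta> C = Abs_fps (\<lambda>n. of_real (fps_nth C n * \<zeta> ^ n))"

lemma fps_scale_simps:
  "fps_scale \<zeta> 1 = 1"
  "fps_scale \<zeta> (B + C) = fps_scale \<zeta> B + fps_scale \<zeta> C"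
  "fps_scale \<zeta> (B - C) = fps_scale \<zeta> B - fps_scale \<zeta> C"
  by (simp_all add: fps_scale_def fps_eq_iff algebra_simps)

lemma fps_scale_mult: "fps_scale \<zeta> (B * C) = fps_scale \<zeta> B * fps_scale \<zeta> C"
proof (rule fps_ext)
  fix n
  have "(\<Sum>i=0..n. fps_nth B i * fps_nth C (n - i)) * \<zeta> ^ n =
      (\<Sum>i=0..n. (fps_nth B i * \<zeta> ^ i) * (fps_nth C (n - i) * \<zeta> ^ (n - i)))"
    unfolding sum_distrib_right
  proof (rule sum.cong)
    fix i assume "i \<in> {0..n}"
    hence "\<zeta> ^ n = \<zeta> ^ i * \<zeta> ^ (n - i)" by (simp flip: power_add)
    thus "fps_nth B i * fps_nth C (n - i) * \<zeta> ^ n = (fps_nth B i * \<zeta> ^ i) * (fps_nth C (n - i) * \<zeta> ^ (n - i))"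
      by (simp only: mult_ac)
  qed simp
  hence "complex_of_real ((\<Sum>i=0..n. fps_nth B i * fps_nth C (n - i)) * \<zeta> ^ n) =
      of_real (\<Sum>i=0..n. (fps_nth B i * \<zeta> ^ i) * (fps_nth C (n - i) * \<zeta> ^ (n - i)))"
    by (simp only:)
  thus "fps_nth (fps_scale \<zeta> (B * C)) n = fps_nth (fps_scale \<zeta> B * fps_scale \<zeta> C) n"
    by (simp only: fps_scale_def fps_nth_Abs_fps fps_mult_nth of_real_sum of_real_mult)
qed

lemma fps_scale_power2: "fps_scale \<zeta> (B\<^sup>2) = (fps_scale \<zeta> B)\<^sup>2"
  by (simp add: power2_eq_square fps_scale_mult)

lemma fps_conv_radius_scale:
  assumes "ereal (\<zeta> * \<rho>) < fps_conv_radius C" "0 < \<zeta>" "0 \<le> \<rho>"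
  shows "ereal \<rho> \<le> fps_conv_radius (fps_scale \<zeta> C)"
proof -
  have "summable (\<lambda>n. fps_nth C n * (\<zeta> * \<rho>) ^ n)"
    using assms by (intro summable_fps) (simp add: abs_mult)
  hence "summable (\<lambda>n. complex_of_real (fps_nth C n * (\<zeta> * \<rho>) ^ n))"
    by (rule summable_of_real)
  hence "summable (\<lambda>n. fps_nth (fps_scale \<zeta> C) n * of_real \<rho> ^ n)"
    by (simp add: fps_scale_def power_mult_distrib mult_ac)
  hence "norm (complex_of_real \<rho>) \<le> fps_conv_radius (fps_scale \<zeta> C)"
    unfolding fps_conv_radius_def by (rule conv_radius_geI)
  thus ?thesis using assms(3) by simp
qed

lemma eval_fps_scale:
  assumes "ereal \<bar>\<zeta> * x\<bar> < fps_conv_radius C"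
  shows "eval_fps (fps_scale \<zeta> C) (of_real x) = of_real (eval_fps C (\<zeta> * x))"
proof -
  have "summable (\<lambda>n. fps_nth C n * (\<zeta> * x) ^ n)" using assms by (intro summable_fps) simp
  hence "(\<lambda>n. complex_of_real (fps_nth C n * (\<zeta> * x) ^ n)) sums of_real (eval_fps C (\<zeta> * x))"
    unfolding eval_fps_def by (intro sums_of_real summable_sums)
  thus ?thesis
    by (simp add: eval_fps_def fps_scale_def power_mult_distrib mult_ac sums_iff)
qed

lemma fps_deriv_scale: "fps_deriv (fps_scale \<zeta> C) = fps_const (of_real \<zeta>) * fps_scale \<zeta> (fps_deriv C)"
  by (simp add: fps_eq_iff fps_scale_def mult_ac del: of_nat_Suc)

lemma has_fps_expansion_scale:
  assumes "g has_fps_expansion Abs_fps (\<lambda>n. complex_of_real (fps_nth f n))"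
  shows "(\<lambda>z. g (of_real \<zeta> * z)) has_fps_expansion fps_scale \<zeta> f"
proof -
  have "(\<lambda>z::complex. of_real \<zeta> * z) has_fps_expansion fps_const (of_real \<zeta>) * fps_X"
    by (intro has_fps_expansion_cmult_left has_fps_expansion_fps_X)
  from has_fps_expansion_compose[OF assms this]
  show ?thesis
    unfolding o_def fps_compose_linear by (simp add: fps_scale_def mult.commute)
qed

text \<open>The same situation with the singularity at \<zeta> and real series, in the terms that
  the tree classes supply. About the zeros of P it asks only that \<zeta> be the first positive one
  and simple; positivity of \<open>A - D f\<close> below \<zeta> and the sign of P' at \<zeta> are
  consequences.\<close>

locale real_sqrt_singularity =
  fixes A D P f :: "real fps" and g :: "complex \<Rightarrow> complex" and \<zeta> r \<phi> :: real
  assumes delta: "1 < r" "0 < \<phi>" "\<phi> < pi / 2"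
    and g: "g holomorphic_on ((\<lambda>z. complex_of_real \<zeta> * z) ` delta_domain r \<phi>)"
      "g has_fps_expansion Abs_fps (\<lambda>n. complex_of_real (fps_nth f n))"
    and \<zeta>: "0 < \<zeta>" "ereal \<zeta> < fps_conv_radius A" "ereal \<zeta> < fps_conv_radius D"
      "ereal \<zeta> < fps_conv_radius P" "ereal \<zeta> \<le> fps_conv_radius f"
    and square: "(A - D * f)\<^sup>2 = P" and zero: "fps_nth (A - D * f) 0 = 1"
    and nonneg: "\<And>n. 0 \<le> fps_nth (1 - (A - D * f)) n"
    and D\<zeta>: "eval_fps D \<zeta> \<noteq> 0"
    and P\<zeta>: "eval_fps P \<zeta> = 0" "eval_fps (fps_deriv P) \<zeta> \<noteq> 0"
      "\<And>x. 0 < x \<Longrightarrow> x < \<zeta> \<Longrightarrow> eval_fps P x \<noteq> 0"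
begin

definition h :: "real \<Rightarrow> real" where "h x = eval_fps A x - eval_fps D x * eval_fps f x"

lemma radius: "\<bar>x\<bar> < \<zeta> \<Longrightarrow> ereal \<bar>x\<bar> < fps_conv_radius A" "\<bar>x\<bar> < \<zeta> \<Longrightarrow> ereal \<bar>x\<bar> < fps_conv_radius D"
   "\<bar>x\<bar> < \<zeta> \<Longrightarrow> ereal \<bar>x\<bar> < fps_conv_radius P" "\<bar>x\<bar> < \<zeta> \<Longrightarrow> ereal \<bar>x\<bar> < fps_conv_radius f"
  using \<zeta> by (auto intro: less_le_trans[of "ereal \<bar>x\<bar>" "ereal \<zeta>"])

lemma h_eval: "\<bar>x\<bar> < \<zeta> \<Longrightarrow> eval_fps (A - D * f) x = h x"
  and h_radius: "\<bar>x\<bar> < \<zeta> \<Longrightarrow> ereal \<bar>x\<bar> < fps_conv_radius (A - D * f)"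
proof -
  assume x: "\<bar>x\<bar> < \<zeta>"
  have 1: "ereal \<bar>x\<bar> < fps_conv_radius (D * f)"
    using radius[OF x] fps_conv_radius_mult[of D f] by (auto intro: less_le_trans[rotated])
  thus "ereal \<bar>x\<bar> < fps_conv_radius (A - D * f)"
    using radius[OF x] fps_conv_radius_diff[of A "D * f"] by (auto intro: less_le_trans[rotated])
  show "eval_fps (A - D * f) x = h x"
    using radius[OF x] 1 by (simp add: h_def eval_fps_diff eval_fps_mult)
qed

lemma h_square: "\<bar>x\<bar> < \<zeta> \<Longrightarrow> (h x)\<^sup>2 = eval_fps P x"
  using h_eval[of x] h_radius[of x] unfolding square[symmetric] by (simp add: eval_fps_power)

text \<open>A nonpositive value would, by continuity and h(0) = 1, force a zero of h, hence of P =
  h^2, strictly between 0 and \<zeta>.\<close>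

lemma h_pos:
  assumes "0 \<le> x" "x < \<zeta>"
  shows "0 < h x"
proof (rule ccontr)
  assume "\<not> 0 < h x"
  hence le: "h x \<le> 0" by simp
  have h0: "h 0 = 1" using h_eval[of 0] \<zeta>(1) zero by (simp add: eval_fps_at_0)
  have "continuous_on {0..x} h"
  proof (intro continuous_at_imp_continuous_on ballI)
    fix y assume "y \<in> {0..x}"
    hence "\<bar>y\<bar> < \<zeta>" using assms by auto
    from radius[OF this] show "isCont h y" unfolding h_def
      by (intro continuous_diff continuous_mult continuous_eval_fps) simp_all
  qed
  then obtain y where y: "0 \<le> y" "y \<le> x" "h y = 0"
    using IVT2'[of h x 0 0] le h0 assms by auto
  with h0 have "y > 0" by (cases "y = 0") auto
  with P\<zeta>(3)[of y] h_square[of y] y assms show False by auto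
qed

lemma P_pos: "0 < x \<Longrightarrow> x < \<zeta> \<Longrightarrow> 0 < eval_fps P x"
  using h_pos[of x] h_square[of x] zero_less_power[of "h x" 2] by simp

text \<open>P is positive below \<zeta> and 0 at \<zeta>, so its derivative there is not positive;
  simplicity of the zero excludes 0.\<close>

lemma P_deriv_neg: "eval_fps (fps_deriv P) \<zeta> < 0"
proof (rule ccontr)
  assume "\<not> ?thesis"
  hence "eval_fps (fps_deriv P) \<zeta> > 0" using P\<zeta>(2) by simp
  moreover have "(eval_fps P has_real_derivative eval_fps (fps_deriv P) \<zeta>) (at \<zeta>)"
    using \<zeta> by (intro has_field_derivative_eval_fps) auto
  ultimately obtain d where d: "d > 0" "\<And>h. 0 < h \<Longrightarrow> h < d \<Longrightarrow> eval_fps P (\<zeta> - h) < eval_fps P \<zeta>"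
    using DERIV_pos_inc_left by blast
  define y where "y = min d \<zeta> / 2"
  have y: "0 < y" "y < d" "y < \<zeta>" using d(1) \<zeta>(1) by (auto simp: y_def)
  from d(2)[OF y(1,2)] P_pos[of "\<zeta> - y"] y P\<zeta>(1) show False by simp
qed

definition q :: real where "q = sqrt (- \<zeta> * eval_fps (fps_deriv P) \<zeta>)"

text \<open>\<open>sqrt_singularity\<close> demands one radius beyond 1 for all coefficient series;
  it exists because they are finitely many and each converges strictly beyond \<zeta>.\<close>

lemma larger_radius:
  assumes "finite \<C>" "\<And>C. C \<in> \<C> \<Longrightarrow> ereal \<zeta> < fps_conv_radius C"
  shows "\<exists>\<rho>>1. \<forall>C\<in>\<C>. ereal \<rho> \<le> fps_conv_radius (fps_scale \<zeta> C)"
  using assms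
proof (induction \<C> rule: finite_induct)
  case empty
  show ?case by (auto intro: gt_ex)
next
  case (insert C \<C>)
  then obtain \<rho> where \<rho>: "\<rho> > 1" "\<forall>C\<in>\<C>. ereal \<rho> \<le> fps_conv_radius (fps_scale \<zeta> C)" by auto
  obtain t where t: "ereal \<zeta> < ereal t" "ereal t < fps_conv_radius C"
    using insert.prems[of C] ereal_dense2 by blast
  have "ereal (t / \<zeta>) \<le> fps_conv_radius (fps_scale \<zeta> C)"
    using t \<zeta>(1) by (intro fps_conv_radius_scale) auto
  moreover have "t / \<zeta> > 1" using t \<zeta>(1) by simp
  ultimately show ?case using \<rho>
    by (intro exI[of _ "min \<rho> (t / \<zeta>)"]) (auto simp: min_def intro: order_trans[rotated])
qed

lemma scaled:
  assumes \<rho>: "1 < \<rho>" "ereal \<rho> \<le> fps_conv_radius (fps_scale \<zeta> A)"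
    "ereal \<rho> \<le> fps_conv_radius (fps_scale \<zeta> D)" "ereal \<rho> \<le> fps_conv_radius (fps_scale \<zeta> P)"
  shows "sqrt_singularity (fps_scale \<zeta> A) (fps_scale \<zeta> D) (fps_scale \<zeta> P) (fps_scale \<zeta> f)
    (\<lambda>z. g (of_real \<zeta> * z)) (delta_domain r \<phi>) q \<rho> (\<lambda>n. fps_nth (1 - (A - D * f)) n * \<zeta> ^ n)"
proof
  let ?G = "\<lambda>z. g (of_real \<zeta> * z)"
  show "open (delta_domain r \<phi>)" using delta by (intro open_delta_domain)
  show sub: "cball 0 1 - {1} \<subseteq> delta_domain r \<phi>" using delta by (intro cball_subset_delta_domain)
  have "(g \<circ> (\<lambda>z. of_real \<zeta> * z)) holomorphic_on delta_domain r \<phi>"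
    by (intro holomorphic_on_compose holomorphic_intros g(1))
  thus hol: "?G holomorphic_on delta_domain r \<phi>" by (simp add: o_def)
  show exp: "?G has_fps_expansion fps_scale \<zeta> f" using g(2) by (rule has_fps_expansion_scale)
  show "(fps_scale \<zeta> A - fps_scale \<zeta> D * fps_scale \<zeta> f)\<^sup>2 = fps_scale \<zeta> P"
    unfolding square[symmetric] by (simp add: fps_scale_simps fps_scale_mult fps_scale_power2)
  show "eval_fps (fps_scale \<zeta> D) 1 \<noteq> 0"
    using eval_fps_scale[of \<zeta> 1 D] \<zeta> D\<zeta> by simp
  show "eval_fps (fps_scale \<zeta> P) 1 = 0"
    using eval_fps_scale[of \<zeta> 1 P] \<zeta> P\<zeta> by simp
  have rd: "ereal \<zeta> < fps_conv_radius (fps_deriv P)"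
    using \<zeta>(4) fps_conv_radius_deriv[of P] by (rule less_le_trans)
  have "ereal 1 < fps_conv_radius (fps_scale \<zeta> (fps_deriv P))"
  proof -
    obtain t where t: "ereal \<zeta> < ereal t" "ereal t < fps_conv_radius (fps_deriv P)"
      using rd ereal_dense2 by blast
    have "ereal (t / \<zeta>) \<le> fps_conv_radius (fps_scale \<zeta> (fps_deriv P))"
      using t \<zeta>(1) by (intro fps_conv_radius_scale) auto
    moreover have "ereal 1 < ereal (t / \<zeta>)" using t \<zeta>(1) by simp
    ultimately show ?thesis by (rule less_le_trans[rotated])
  qed
  hence "eval_fps (fps_deriv (fps_scale \<zeta> P)) 1 = of_real \<zeta> * eval_fps (fps_scale \<zeta> (fps_deriv P)) 1"
    unfolding fps_deriv_scale by (subst eval_fps_mult) (auto simp: one_ereal_def)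
  also have "eval_fps (fps_scale \<zeta> (fps_deriv P)) 1 = of_real (eval_fps (fps_deriv P) \<zeta>)"
    using eval_fps_scale[of \<zeta> 1 "fps_deriv P"] \<zeta>(1) rd by simp
  also have "of_real \<zeta> * complex_of_real (eval_fps (fps_deriv P) \<zeta>) = - of_real (q\<^sup>2)"
    using P_deriv_neg \<zeta>(1) by (simp add: q_def mult_nonneg_nonpos)
  finally show "eval_fps (fps_deriv (fps_scale \<zeta> P)) 1 = - of_real (q\<^sup>2)" .
  show "0 < q" using P_deriv_neg \<zeta>(1) by (simp add: q_def mult_pos_neg)
  show "0 \<le> fps_nth (1 - (A - D * f)) n * \<zeta> ^ n" for n using nonneg[of n] \<zeta>(1) by simp
  have "1 - (fps_scale \<zeta> A - fps_scale \<zeta> D * fps_scale \<zeta> f) = fps_scale \<zeta> (1 - (A - D * f))"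
    by (simp add: fps_scale_simps fps_scale_mult)
  also have "\<dots> = Abs_fps (\<lambda>n. of_real (fps_nth (1 - (A - D * f)) n * \<zeta> ^ n))"
    by (simp add: fps_scale_def)
  finally show "1 - (fps_scale \<zeta> A - fps_scale \<zeta> D * fps_scale \<zeta> f) =
      Abs_fps (\<lambda>n. of_real (fps_nth (1 - (A - D * f)) n * \<zeta> ^ n))" .
  \<comment> \<open>On [0, 1) the continuation is the sum of the series, so the positivity of
    \<open>h\<close> below \<zeta> carries over.\<close>
  show "\<exists>y>0. eval_fps (fps_scale \<zeta> A) (of_real x) -
      eval_fps (fps_scale \<zeta> D) (of_real x) * ?G (of_real x) = of_real y" if x: "0 \<le> x" "x < 1" for x
  proof -
    have x': "0 \<le> \<zeta> * x" "\<zeta> * x < \<zeta>" using x \<zeta>(1) by auto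
    hence ab: "\<bar>\<zeta> * x\<bar> < \<zeta>" by simp
    have "eval_fps (fps_scale \<zeta> f) (of_real x) = ?G (of_real x)"
    proof (rule has_fps_expansion_imp_eval_fps_eq[OF exp])
      show "?G holomorphic_on ball 0 1"
        using sub by (intro holomorphic_on_subset[OF hol]) auto
    qed (use x in auto)
    hence "?G (of_real x) = of_real (eval_fps f (\<zeta> * x))"
      using eval_fps_scale[OF radius(4)[OF ab]] by simp
    moreover have "eval_fps (fps_scale \<zeta> A) (of_real x) = of_real (eval_fps A (\<zeta> * x))"
      "eval_fps (fps_scale \<zeta> D) (of_real x) = of_real (eval_fps D (\<zeta> * x))"
      using radius[OF ab] by (intro eval_fps_scale; simp)+
    ultimately show ?thesis
      using h_pos[OF x'] by (intro exI[of _ "h (\<zeta> * x)"]) (simp add: h_def)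
  qed
qed (use \<rho> in auto)

lemma tendsto_Re_of_real:
  "(\<lambda>n. complex_of_real (c n)) \<longlonglongrightarrow> of_real l \<Longrightarrow> c \<longlonglongrightarrow> l"
  by (drule tendsto_Re) simp

theorem f_limit:
  "(\<lambda>n. fps_nth f n * \<zeta> ^ n * real n powr (3/2)) \<longlonglongrightarrow> q / (2 * sqrt pi) / eval_fps D \<zeta>"
proof -
  have "\<exists>\<rho>>1. \<forall>C\<in>{A, D, P}. ereal \<rho> \<le> fps_conv_radius (fps_scale \<zeta> C)"
    using \<zeta> by (intro larger_radius) auto
  then obtain \<rho> where "1 < \<rho>" "ereal \<rho> \<le> fps_conv_radius (fps_scale \<zeta> A)"
    "ereal \<rho> \<le> fps_conv_radius (fps_scale \<zeta> D)" "ereal \<rho> \<le> fps_conv_radius (fps_scale \<zeta> P)" by auto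
  from sqrt_singularity.f_asymptotics[OF scaled[OF this]]
  have "(\<lambda>n. complex_of_real (fps_nth f n * \<zeta> ^ n * real n powr (3/2))) \<longlonglongrightarrow>
      of_real (q / (2 * sqrt pi)) / eval_fps (fps_scale \<zeta> D) 1"
    by (simp add: fps_scale_def)
  also have "eval_fps (fps_scale \<zeta> D) 1 = of_real (eval_fps D \<zeta>)"
    using eval_fps_scale[of \<zeta> 1 D] \<zeta> by simp
  finally show ?thesis by (intro tendsto_Re_of_real) simp
qed

theorem quotient_limit:
  assumes M: "ereal \<zeta> < fps_conv_radius M0" "ereal \<zeta> < fps_conv_radius M1" "ereal \<zeta> < fps_conv_radius M2"
    and W: "(A - D * f) * W = M0 + M1 * f + M2 * f\<^sup>2"
  defines "y \<equiv> eval_fps A \<zeta> / eval_fps D \<zeta>"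
  shows "(\<lambda>n. fps_nth W n * \<zeta> ^ n * real n powr (1/2)) \<longlonglongrightarrow>
    (eval_fps M0 \<zeta> + eval_fps M1 \<zeta> * y + eval_fps M2 \<zeta> * y\<^sup>2) / (q * sqrt pi)"
proof -
  have "\<exists>\<rho>>1. \<forall>C\<in>{A, D, P, M0, M1, M2}. ereal \<rho> \<le> fps_conv_radius (fps_scale \<zeta> C)"
    using \<zeta> M by (intro larger_radius) auto
  then obtain \<rho> where \<rho>: "1 < \<rho>" "ereal \<rho> \<le> fps_conv_radius (fps_scale \<zeta> A)"
    "ereal \<rho> \<le> fps_conv_radius (fps_scale \<zeta> D)" "ereal \<rho> \<le> fps_conv_radius (fps_scale \<zeta> P)" and
    \<rho>': "ereal \<rho> \<le> fps_conv_radius (fps_scale \<zeta> M0)" "ereal \<rho> \<le> fps_conv_radius (fps_scale \<zeta> M1)"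
    "ereal \<rho> \<le> fps_conv_radius (fps_scale \<zeta> M2)" by auto
  have ev: "eval_fps (fps_scale \<zeta> C) 1 = of_real (eval_fps C \<zeta>)" if "ereal \<zeta> < fps_conv_radius C" for C
    using eval_fps_scale[of \<zeta> 1 C] \<zeta>(1) that by simp
  have "fps_scale \<zeta> ((A - D * f) * W) = fps_scale \<zeta> (M0 + M1 * f + M2 * f\<^sup>2)" by (simp only: W)
  hence "(fps_scale \<zeta> A - fps_scale \<zeta> D * fps_scale \<zeta> f) * fps_scale \<zeta> W =
      fps_scale \<zeta> M0 + fps_scale \<zeta> M1 * fps_scale \<zeta> f + fps_scale \<zeta> M2 * (fps_scale \<zeta> f)\<^sup>2"
    by (simp only: fps_scale_mult fps_scale_simps fps_scale_power2)
  from sqrt_singularity.quotient_asymptotics[OF scaled[OF \<rho>] \<rho>' this]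
  have "(\<lambda>n. fps_nth (fps_scale \<zeta> W) n * of_real (real n powr (1/2))) \<longlonglongrightarrow>
      of_real ((eval_fps M0 \<zeta> + eval_fps M1 \<zeta> * y + eval_fps M2 \<zeta> * y\<^sup>2) / (q * sqrt pi))"
    by (simp only: ev M \<zeta> y_def of_real_divide of_real_add of_real_mult of_real_power)
  thus ?thesis by (intro tendsto_Re_of_real) (simp add: fps_scale_def)
qed

end

section \<open>Decomposition of the tree classes\<close>

definition weight_gf :: "'a set \<Rightarrow> ('a \<Rightarrow> nat) \<Rightarrow> real fps" where
  "weight_gf S w = Abs_fps (\<lambda>n. real (card {x \<in> S. w x = n}))"

text \<open>\<open>card\<close> is 0 on infinite sets, so the passage from unions and products of
  classes to sums and products of series relies on each size being attained finitely often.\<close>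

definition finite_fibres :: "'a set \<Rightarrow> ('a \<Rightarrow> nat) \<Rightarrow> bool" where
  "finite_fibres S w \<longleftrightarrow> (\<forall>n. finite {x \<in> S. w x = n})"

lemma weight_gf_nonneg: "0 \<le> fps_nth (weight_gf S w) n"
  by (simp add: weight_gf_def)

lemma finite_fibres_subset:
  assumes "finite_fibres T w" "S \<subseteq> T"
  shows "finite_fibres S w"
  unfolding finite_fibres_def
proof
  fix n
  show "finite {x \<in> S. w x = n}"
    by (rule finite_subset[of _ "{x \<in> T. w x = n}"]) (use assms in \<open>auto simp: finite_fibres_def\<close>)
qed

lemma weight_gf_Un:
  assumes "S \<inter> T = {}" "finite_fibres S w" "finite_fibres T w"
  shows "weight_gf (S \<union> T) w = weight_gf S w + weight_gf T w"
proof (rule fps_ext)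
  fix n
  have "{x \<in> S \<union> T. w x = n} = {x \<in> S. w x = n} \<union> {x \<in> T. w x = n}" by auto
  moreover have "card \<dots> = card {x \<in> S. w x = n} + card {x \<in> T. w x = n}"
    using assms by (intro card_Un_disjoint) (auto simp: finite_fibres_def)
  ultimately show "fps_nth (weight_gf (S \<union> T) w) n = fps_nth (weight_gf S w + weight_gf T w) n"
    by (simp add: weight_gf_def)
qed

lemma weight_gf_Times:
  assumes "finite_fibres S v" "finite_fibres T w"
  shows "weight_gf (S \<times> T) (\<lambda>(x, y). v x + w y) = weight_gf S v * weight_gf T w"
proof (rule fps_ext)
  fix n
  have eq: "{p \<in> S \<times> T. (case p of (x, y) \<Rightarrow> v x + w y) = n} =
      (\<Union>i\<in>{0..n}. {x \<in> S. v x = i} \<times> {y \<in> T. w y = n - i})" by auto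
  have "card {p \<in> S \<times> T. (case p of (x, y) \<Rightarrow> v x + w y) = n} =
      (\<Sum>i=0..n. card ({x \<in> S. v x = i} \<times> {y \<in> T. w y = n - i}))"
    unfolding eq
  proof (rule card_UN_disjoint)
    show "\<forall>i\<in>{0..n}. finite ({x \<in> S. v x = i} \<times> {y \<in> T. w y = n - i})"
      using assms by (auto simp: finite_fibres_def)
  qed auto
  thus "fps_nth (weight_gf (S \<times> T) (\<lambda>(x, y). v x + w y)) n = fps_nth (weight_gf S v * weight_gf T w) n"
    by (simp add: weight_gf_def fps_mult_nth card_cartesian_product)
qed

lemma weight_gf_bij:
  assumes "bij_betw h S T" "\<And>x. x \<in> S \<Longrightarrow> w (h x) = v x"
  shows "weight_gf T w = weight_gf S v"
proof (rule fps_ext)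
  fix n
  have "bij_betw h {x \<in> S. v x = n} {y \<in> T. w y = n}"
    using assms unfolding bij_betw_def by (auto simp: inj_on_def)
  thus "fps_nth (weight_gf T w) n = fps_nth (weight_gf S v) n"
    by (simp add: weight_gf_def bij_betw_same_card)
qed

lemma weight_gf_Suc: "weight_gf S (\<lambda>x. Suc (w x)) = fps_X * weight_gf S w"
proof (rule fps_ext)
  fix n
  show "fps_nth (weight_gf S (\<lambda>x. Suc (w x))) n = fps_nth (fps_X * weight_gf S w) n"
    by (cases n) (simp_all add: weight_gf_def)
qed

lemma weight_gf_singleton_0: "w a = 0 \<Longrightarrow> weight_gf {a} w = 1"
proof (rule fps_ext)
  fix n assume "w a = 0"
  hence "{x \<in> {a}. w x = n} = (if n = 0 then {a} else {})" by auto
  thus "fps_nth (weight_gf {a} w) n = fps_nth 1 n" by (simp add: weight_gf_def)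
qed

section \<open>Finiteness of the classes\<close>

abbreviation forest_size :: "ftree list \<Rightarrow> nat" where
  "forest_size ts \<equiv> (\<Sum>t\<leftarrow>ts. Suc (ftree_size t))"

lemma length_le_sum_list_pos: "0 \<notin> set \<phi> \<Longrightarrow> length \<phi> \<le> sum_list (\<phi> :: nat list)"
  by (induction \<phi>) auto

lemma finite_fibres_flowers: "finite_fibres {\<phi>. 0 \<notin> set \<phi>} sum_list"
proof -
  have "finite {\<phi> \<in> {\<phi>. 0 \<notin> set \<phi>}. sum_list \<phi> = n}" for n :: nat
  proof (rule finite_subset)
    show "{\<phi> \<in> {\<phi>. 0 \<notin> set \<phi>}. sum_list \<phi> = n} \<subseteq> {\<phi>. set \<phi> \<subseteq> {..n} \<and> length \<phi> \<le> n}"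
      using length_le_sum_list_pos member_le_sum_list by fastforce
    show "finite {\<phi>. set \<phi> \<subseteq> {..n} \<and> length \<phi> \<le> n}" by (rule finite_lists_length_le) simp
  qed
  thus ?thesis by (simp add: finite_fibres_def)
qed

lemma length_le_forest_size: "length ts \<le> forest_size ts"
  by (induction ts) auto

lemma ftree_size_less_forest_size: "t \<in> set ts \<Longrightarrow> ftree_size t < forest_size ts"
  using member_le_sum_list[of "Suc (ftree_size t)" "map (\<lambda>t. Suc (ftree_size t)) ts"] by auto

text \<open>One class that contains all \<T>- and \<R>-trees: any arity, any flower with positive
  petals. Every edge counts 1, so a tree of size at most n has at most n children at its root, each
  of size below n.\<close>

lemma finite_trees: "finite {t. T_tree UNIV {\<phi>. 0 \<notin> set \<phi>} t \<and> ftree_size t \<le> n}"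
proof (induction n rule: less_induct)
  case (less n)
  let ?\<Phi> = "{\<phi>::flower. 0 \<notin> set \<phi>}"
  let ?A = "\<Union>m<n. {t. T_tree UNIV ?\<Phi> t \<and> ftree_size t \<le> m}"
  let ?F = "\<Union>m\<le>n. {\<phi> \<in> ?\<Phi>. sum_list \<phi> = m}"
  have "finite ?A" using less by auto
  hence "finite {ts. set ts \<subseteq> ?A \<and> length ts \<le> n}" by (rule finite_lists_length_le)
  moreover have "finite ?F" using finite_fibres_flowers by (auto simp: finite_fibres_def)
  ultimately have "finite ((\<lambda>(\<phi>, ts). Node \<phi> ts) ` (?F \<times> {ts. set ts \<subseteq> ?A \<and> length ts \<le> n}))" by blast
  moreover have "{t. T_tree UNIV ?\<Phi> t \<and> ftree_size t \<le> n} \<subseteq>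
      (\<lambda>(\<phi>, ts). Node \<phi> ts) ` (?F \<times> {ts. set ts \<subseteq> ?A \<and> length ts \<le> n})"
  proof
    fix t assume t: "t \<in> {t. T_tree UNIV ?\<Phi> t \<and> ftree_size t \<le> n}"
    obtain \<phi> ts where Node: "t = Node \<phi> ts" by (cases t)
    have "forest_size ts \<le> n" using t Node by simp
    hence "length ts \<le> n" "\<And>t. t \<in> set ts \<Longrightarrow> ftree_size t < n"
      using length_le_forest_size[of ts] ftree_size_less_forest_size[of _ ts] by fastforce+
    moreover have "\<phi> \<in> ?F" "\<And>t. t \<in> set ts \<Longrightarrow> T_tree UNIV ?\<Phi> t" using t Node by auto
    ultimately have "(\<phi>, ts) \<in> ?F \<times> {ts. set ts \<subseteq> ?A \<and> length ts \<le> n}" by blast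
    thus "t \<in> (\<lambda>(\<phi>, ts). Node \<phi> ts) ` (?F \<times> {ts. set ts \<subseteq> ?A \<and> length ts \<le> n})"
      using Node by force
  qed
  ultimately show ?case by (rule finite_subset[rotated])
qed

lemma T_tree_positive: "0 \<notin> \<Union>(set ` \<Phi>) \<Longrightarrow> T_tree K \<Phi> t \<Longrightarrow> T_tree UNIV {\<phi>. 0 \<notin> set \<phi>} t"
  by (induction K \<Phi> t rule: T_tree.induct) auto

lemma R_tree_positive: "0 \<notin> \<Union>(set ` \<Phi>) \<Longrightarrow> R_tree K \<Phi> t \<Longrightarrow> T_tree UNIV {\<phi>. 0 \<notin> set \<phi>} t"
  by (induction K \<Phi> t rule: R_tree.induct) (auto split: if_splits)

lemma finite_fibres_trees:
  assumes "\<And>t. t \<in> S \<Longrightarrow> T_tree UNIV {\<phi>. 0 \<notin> set \<phi>} t"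
  shows "finite_fibres S ftree_size"
  unfolding finite_fibres_def
proof
  fix n
  show "finite {t \<in> S. ftree_size t = n}"
    by (rule finite_subset[OF _ finite_trees[of n]]) (use assms in auto)
qed

lemma finite_fibres_lists:
  assumes "finite_fibres A ftree_size"
  shows "finite_fibres (lists A) forest_size"
  unfolding finite_fibres_def
proof
  fix n
  let ?B = "\<Union>m<n. {t \<in> A. ftree_size t = m}"
  have "finite ?B" using assms by (auto simp: finite_fibres_def)
  hence "finite {ts. set ts \<subseteq> ?B \<and> length ts \<le> n}" by (rule finite_lists_length_le)
  moreover have "{ts \<in> lists A. forest_size ts = n} \<subseteq> {ts. set ts \<subseteq> ?B \<and> length ts \<le> n}"
    using length_le_forest_size ftree_size_less_forest_size by fastforce
  ultimately show "finite {ts \<in> lists A. forest_size ts = n}" by (rule finite_subset[rotated])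
qed

text \<open>The factor \<open>fps_X\<close> is the edge that leads to the first tree of the
  forest.\<close>

lemma weight_gf_Cons:
  assumes "finite_fibres A ftree_size" "B \<subseteq> lists A"
  shows "weight_gf ((\<lambda>(t, ts). t # ts) ` (A \<times> B)) forest_size =
    fps_X * weight_gf A ftree_size * weight_gf B forest_size"
proof -
  have "weight_gf ((\<lambda>(t, ts). t # ts) ` (A \<times> B)) forest_size =
      weight_gf (A \<times> B) (\<lambda>(t, ts). Suc (ftree_size t) + forest_size ts)"
    by (rule weight_gf_bij[where h = "\<lambda>(t, ts). t # ts"]) (auto simp: bij_betw_def inj_on_def)
  also have "\<dots> = weight_gf A (\<lambda>t. Suc (ftree_size t)) * weight_gf B forest_size"
  proof (rule weight_gf_Times)
    show "finite_fibres A (\<lambda>t. Suc (ftree_size t))" unfolding finite_fibres_def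
    proof
      fix n show "finite {t \<in> A. Suc (ftree_size t) = n}"
        using assms(1) by (cases n) (auto simp: finite_fibres_def)
    qed
    show "finite_fibres B forest_size"
      using finite_fibres_lists[OF assms(1)] assms(2) by (rule finite_fibres_subset)
  qed
  finally show ?thesis by (simp add: weight_gf_Suc)
qed

text \<open>\<open>C\<close> is the sum of \<open>w\<^sup>k\<close> over \<open>k \<in> K\<close>, in a form that avoids infinite sums.\<close>

definition children_series :: "nat set \<Rightarrow> 'a::comm_ring_1 \<Rightarrow> 'a \<Rightarrow> bool" where
  "children_series K w C \<longleftrightarrow>
     K = {1..} \<and> C * (1 - w) = w \<or> K = {2} \<and> C = w\<^sup>2 \<or> K = {1, 2} \<and> C = w + w\<^sup>2"

text \<open>Forests of k trees have the series w^k. A nonempty forest is a tree followed by any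
  forest, whence C = w (1 + C) in place of a geometric series.\<close>

lemma children_series_forests:
  assumes "finite_fibres A ftree_size" and K: "K = {1..} \<or> K = {2} \<or> K = {1, 2}"
  shows "children_series K (fps_X * weight_gf A ftree_size) (weight_gf {ts \<in> lists A. length ts \<in> K} forest_size)"
proof -
  let ?w = "fps_X * weight_gf A ftree_size"
  let ?L = "\<lambda>k. weight_gf {ts \<in> lists A. length ts = k} forest_size"
  note fin = finite_fibres_subset[OF finite_fibres_lists[OF assms(1)]]
  have "{ts \<in> lists A. length ts = 0} = {[]}" by auto
  hence L0: "?L 0 = 1" by (simp add: weight_gf_singleton_0)
  have Suc: "?L (Suc k) = ?w * ?L k" for k
  proof -
    have "{ts \<in> lists A. length ts = Suc k} = (\<lambda>(t, ts). t # ts) ` (A \<times> {ts \<in> lists A. length ts = k})"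
      by (force simp: length_Suc_conv)
    thus ?thesis by (simp only:) (subst weight_gf_Cons, auto simp: assms(1))
  qed
  have L1: "?L 1 = ?w" and L2: "?L 2 = ?w\<^sup>2"
    using Suc[of 0] Suc[of 1] L0 by (simp_all add: power2_eq_square numeral_2_eq_2)
  from K show ?thesis
  proof (elim disjE)
    assume K: "K = {1..}"
    let ?C = "{ts \<in> lists A. length ts \<in> K}"
    have "?C = (\<lambda>(t, ts). t # ts) ` (A \<times> lists A)"
    proof (intro equalityI subsetI)
      fix ts assume "ts \<in> ?C"
      thus "ts \<in> (\<lambda>(t, ts). t # ts) ` (A \<times> lists A)" by (cases ts) (auto simp: K)
    qed (auto simp: K)
    hence 1: "weight_gf ?C forest_size = ?w * weight_gf (lists A) forest_size"
      using weight_gf_Cons[OF assms(1), of "lists A"] by simp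
    have "lists A = {[]} \<union> ?C" by (auto simp: K Suc_le_eq)
    hence "weight_gf (lists A) forest_size = weight_gf {[]} forest_size + weight_gf ?C forest_size"
      using weight_gf_Un[of "{[]}" ?C forest_size] fin[of "{[]}"] fin[of ?C] by (auto simp: K)
    hence 2: "weight_gf (lists A) forest_size = 1 + weight_gf ?C forest_size"
      by (simp add: weight_gf_singleton_0)
    have "C * (1 - w) = w" if "C = w * (1 + C)" for C w :: "real fps"
    proof -
      have "C * (1 - w) = C - w * (1 + C) + w" by (simp add: algebra_simps)
      also have "C - w * (1 + C) = 0" using that by (metis right_minus_eq)
      finally show ?thesis by simp
    qed
    from this[OF 1[unfolded 2]] show ?thesis using K by (simp add: children_series_def)
  next
    assume "K = {2}"
    thus ?thesis using L2 by (simp add: children_series_def)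
  next
    assume K: "K = {1, 2}"
    have "{ts \<in> lists A. length ts \<in> K} = {ts \<in> lists A. length ts = 1} \<union> {ts \<in> lists A. length ts = 2}"
      by (auto simp: K)
    moreover have "weight_gf \<dots> forest_size = ?L 1 + ?L 2"
      by (intro weight_gf_Un fin) auto
    ultimately show ?thesis using K L1 L2 by (simp add: children_series_def)
  qed
qed

text \<open>Brings the functional equation of the bivariate series into the form that the
  combinatorial decomposition has, so that one algebraic argument serves both. The vanishing
  constant term of w makes composition with w multiplicative.\<close>

lemma children_series_compose:
  fixes w :: "'a::idom fps"
  assumes w: "fps_nth w 0 = 0" and K: "K = {1..} \<or> K = {2} \<or> K = {1, 2}"
  shows "children_series K w (degree_series K oo w)"
proof -
  have X: "fps_X oo w = w" using w by (rule fps_X_fps_compose_startby0)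
  have d2: "degree_series {2} = (fps_X\<^sup>2 :: 'a fps)"
    and d12: "degree_series {1, 2} = (fps_X + fps_X\<^sup>2 :: 'a fps)"
    by (auto simp: degree_series_def fps_eq_iff fps_X_power_nth fps_X_nth)
  have d: "degree_series {1..} * (1 - fps_X) = (fps_X :: 'a fps)"
  proof (rule fps_ext)
    fix n
    show "fps_nth (degree_series {1..} * (1 - fps_X)) n = fps_nth (fps_X :: 'a fps) n"
      by (cases n) (simp_all add: degree_series_def right_diff_distrib fps_X_nth)
  qed
  have sq: "fps_X\<^sup>2 oo w = w\<^sup>2" using w X by (simp add: power2_eq_square fps_compose_mult_distrib)
  show ?thesis
    using K
  proof (elim disjE)
    assume K: "K = {1..}"
    have "(degree_series K oo w) * (1 - w) = (degree_series K oo w) * ((1 - fps_X) oo w)"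
      by (simp add: fps_compose_sub_distrib X)
    also have "\<dots> = degree_series K * (1 - fps_X) oo w"
      using w by (simp add: fps_compose_mult_distrib)
    also have "\<dots> = w" by (simp only: K d X)
    finally show ?thesis using K by (simp add: children_series_def)
  next
    assume "K = {2}"
    thus ?thesis using sq by (simp add: children_series_def d2)
  next
    assume K: "K = {1, 2}"
    have "degree_series K oo w = w + w\<^sup>2"
      unfolding K d12 by (simp only: fps_compose_add_distrib X sq)
    thus ?thesis using K by (simp add: children_series_def)
  qed
qed

text \<open>\<open>Class_T\<close> is stated without the auxiliary S: T = F S and S = 1 + K(z T)
  give T = F (1 + K(z T)). A general commutative ring admits the counting series and the bivariate
  ones alike.\<close>

fun class_decomposition :: "tree_class \<Rightarrow> nat set \<Rightarrow> 'a::comm_ring_1 \<Rightarrow> 'a \<Rightarrow> 'a \<Rightarrow> bool" where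
  "class_decomposition Class_R K z F f \<longleftrightarrow> (\<exists>C. children_series K (z * f) C \<and> f = F + C)"
| "class_decomposition Class_S K z F f \<longleftrightarrow> (\<exists>C. children_series K (z * (F * f)) C \<and> f = 1 + C)"
| "class_decomposition Class_T K z F f \<longleftrightarrow> (\<exists>C. children_series K (z * f) C \<and> f = F * (1 + C))"

lemma class_equation_decomposition:
  fixes F f :: "'a::idom fps"
  assumes "class_equation cls K F f" and K: "K = {1..} \<or> K = {2} \<or> K = {1, 2}"
  shows "class_decomposition cls K fps_X F f"
proof -
  have X: "children_series K (fps_X * w) (degree_series K oo (fps_X * w))" for w :: "'a fps"
    by (rule children_series_compose) (use K in auto)
  show ?thesis
  proof (cases cls)
    case Class_R
    thus ?thesis using assms(1) X[of f] by auto
  next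
    case Class_S
    thus ?thesis using assms(1) X[of "F * f"] by (auto simp: mult.assoc)
  next
    case Class_T
    then obtain S where "S = 1 + (degree_series K oo (fps_X * (F * S)))" "f = F * S"
      using assms(1) by (auto simp: mult.assoc)
    thus ?thesis using Class_T X[of "F * S"] by auto
  qed
qed

lemma flower_gf_star:
  assumes "0 \<notin> N"
  shows "weight_gf (if star then flowers kind N - {[]} else flowers kind N) sum_list =
    (if star then flower_gf kind N - 1 else flower_gf kind N)"
proof (cases star)
  case True
  have Nil: "[] \<in> flowers kind N" by (cases kind) auto
  have pos: "flowers kind N \<subseteq> {\<phi>. 0 \<notin> set \<phi>}" using assms by (cases kind) auto
  have "flowers kind N = {[]} \<union> (flowers kind N - {[]})" using Nil by auto
  moreover have "weight_gf \<dots> sum_list = weight_gf {[]} sum_list + weight_gf (flowers kind N - {[]}) sum_list"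
    using Nil pos by (intro weight_gf_Un finite_fibres_subset[OF finite_fibres_flowers]) auto
  ultimately have "flower_gf kind N = 1 + weight_gf (flowers kind N - {[]}) sum_list"
    by (simp add: flower_gf_def weight_gf_singleton_0 flip: weight_gf_def)
  thus ?thesis using True by simp
qed (simp add: flower_gf_def weight_gf_def)

text \<open>Decomposition at the root: a \<T>-tree is a flower with a forest, an \<S>-tree a bare
  forest of \<T>-trees, an \<R>-tree a flowered leaf or a nonempty forest of \<R>-trees. Starring a
  class only changes the set \<open>\<Phi>\<close>.\<close>

lemma tree_gf_decomposition:
  assumes K: "K = {1..} \<or> K = {2} \<or> K = {1, 2}" and N: "0 \<notin> N"
    and F: "F = (if star then flower_gf kind N - 1 else flower_gf kind N)"
  shows "class_decomposition cls K fps_X F (tree_gf cls star K kind N)"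
proof -
  define \<Phi> where "\<Phi> = (if star then flowers kind N - {[]} else flowers kind N)"
  have pos: "\<Phi> \<subseteq> {\<phi>. 0 \<notin> set \<phi>}" using N by (cases kind) (auto simp: \<Phi>_def)
  hence pos': "0 \<notin> \<Union>(set ` \<Phi>)" by auto
  have fin\<Phi>: "finite_fibres \<Phi> sum_list" by (rule finite_fibres_subset[OF finite_fibres_flowers pos])
  have F: "F = weight_gf \<Phi> sum_list" unfolding F \<Phi>_def by (rule flower_gf_star[OF N, symmetric])
  have gf: "tree_gf cls star K kind N = weight_gf {t. class_tree cls K \<Phi> t} ftree_size"
    by (simp add: tree_gf_def objects_def weight_gf_def \<Phi>_def)
  \<comment> \<open>Otherwise the empty forest would count both as a leaf and as an admissible list
    of children.\<close>
  have K0: "0 \<notin> K" using K by auto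
  define \<T> where "\<T> = {t. T_tree K \<Phi> t}"
  define \<R> where "\<R> = {t. R_tree K \<Phi> t}"
  have fin: "finite_fibres \<T> ftree_size" "finite_fibres \<R> ftree_size"
    unfolding \<T>_def \<R>_def using T_tree_positive[OF pos'] R_tree_positive[OF pos']
    by (auto intro!: finite_fibres_trees)
  let ?C = "\<lambda>A. weight_gf {ts \<in> lists A. length ts \<in> K} forest_size"
  have L: "weight_gf {ts \<in> lists \<T>. ts = [] \<or> length ts \<in> K} forest_size = 1 + ?C \<T>"
  proof -
    have "{ts \<in> lists \<T>. ts = [] \<or> length ts \<in> K} = {[]} \<union> {ts \<in> lists \<T>. length ts \<in> K}" by auto
    moreover have "weight_gf \<dots> forest_size = weight_gf {[]} forest_size + ?C \<T>"
      using K0 by (intro weight_gf_Un finite_fibres_subset[OF finite_fibres_lists[OF fin(1)]]) auto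
    ultimately show ?thesis by (simp add: weight_gf_singleton_0)
  qed
  have T: "weight_gf \<T> ftree_size = F * (1 + ?C \<T>)"
  proof -
    have "weight_gf \<T> ftree_size = weight_gf (\<Phi> \<times> {ts \<in> lists \<T>. ts = [] \<or> length ts \<in> K})
        (\<lambda>(\<phi>, ts). sum_list \<phi> + forest_size ts)"
    proof (rule weight_gf_bij[where h = "\<lambda>(\<phi>, ts). Node \<phi> ts"])
      show "bij_betw (\<lambda>(\<phi>, ts). Node \<phi> ts) (\<Phi> \<times> {ts \<in> lists \<T>. ts = [] \<or> length ts \<in> K}) \<T>"
      proof (rule bij_betwI[where g = "\<lambda>t. case t of Node \<phi> ts \<Rightarrow> (\<phi>, ts)"])
        show "(\<lambda>t. case t of Node \<phi> ts \<Rightarrow> (\<phi>, ts)) \<in> \<T> \<rightarrow> \<Phi> \<times> {ts \<in> lists \<T>. ts = [] \<or> length ts \<in> K}"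
          by (auto simp: \<T>_def split: ftree.split)
      qed (auto simp: \<T>_def split: ftree.split)
    qed auto
    also have "\<dots> = F * (1 + ?C \<T>)"
      unfolding F L[symmetric]
      by (intro weight_gf_Times fin\<Phi> finite_fibres_subset[OF finite_fibres_lists[OF fin(1)]]) auto
    finally show ?thesis .
  qed
  show ?thesis
  proof (cases cls)
    case Class_T
    thus ?thesis using T children_series_forests[OF fin(1) K]
      unfolding Class_T class_decomposition.simps gf[unfolded Class_T] class_tree.simps \<T>_def by blast
  next
    case Class_S
    have "weight_gf {t. S_tree K \<Phi> t} ftree_size =
        weight_gf {ts \<in> lists \<T>. ts = [] \<or> length ts \<in> K} forest_size"
    proof (rule weight_gf_bij[where h = "Node []"])
      show "bij_betw (Node []) {ts \<in> lists \<T>. ts = [] \<or> length ts \<in> K} {t. S_tree K \<Phi> t}"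
      proof (rule bij_betwI[where g = "\<lambda>t. case t of Node \<phi> ts \<Rightarrow> ts"])
        show "(\<lambda>t. case t of Node \<phi> ts \<Rightarrow> ts) \<in> {t. S_tree K \<Phi> t} \<rightarrow>
            {ts \<in> lists \<T>. ts = [] \<or> length ts \<in> K}"
          by (auto simp: \<T>_def split: ftree.split)
      qed (auto simp: \<T>_def split: ftree.split)
    qed auto
    hence "weight_gf {t. S_tree K \<Phi> t} ftree_size = 1 + ?C \<T>" by (simp only: L)
    moreover have "children_series K (fps_X * (F * (1 + ?C \<T>))) (?C \<T>)"
      using children_series_forests[OF fin(1) K] by (simp only: T)
    ultimately show ?thesis
      unfolding Class_S class_decomposition.simps gf[unfolded Class_S] class_tree.simps
      by (intro exI[of _ "?C \<T>"]) (simp only:)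
  next
    case Class_R
    let ?L = "(\<lambda>\<phi>. Node \<phi> []) ` \<Phi>" and ?I = "Node [] ` {ts \<in> lists \<R>. length ts \<in> K}"
    have "\<R> = ?L \<union> ?I"
    proof (intro equalityI subsetI)
      fix t assume t: "t \<in> \<R>"
      show "t \<in> ?L \<union> ?I"
      proof (cases t)
        case (Node \<phi> ts)
        show ?thesis using t Node by (cases "ts = []") (auto simp: \<R>_def)
      qed
    next
      fix t assume "t \<in> ?L \<union> ?I"
      thus "t \<in> \<R>" using K0 by (auto simp: \<R>_def)
    qed
    moreover have "?L \<subseteq> \<R>" "?I \<subseteq> \<R>" using calculation by blast+
    hence "weight_gf (?L \<union> ?I) ftree_size = weight_gf ?L ftree_size + weight_gf ?I ftree_size"
      using K0 by (intro weight_gf_Un finite_fibres_subset[OF fin(2)]) auto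
    moreover have "weight_gf ?L ftree_size = F" unfolding F
      by (rule weight_gf_bij[where h = "\<lambda>\<phi>. Node \<phi> []"]) (auto simp: bij_betw_def inj_on_def)
    moreover have "weight_gf ?I ftree_size = ?C \<R>"
      by (rule weight_gf_bij[where h = "Node []"]) (auto simp: bij_betw_def inj_on_def)
    ultimately have "weight_gf \<R> ftree_size = F + ?C \<R>" by simp
    thus ?thesis using children_series_forests[OF fin(2) K]
      unfolding Class_R class_decomposition.simps gf[unfolded Class_R] class_tree.simps \<R>_def by blast
  qed
qed

section \<open>The quadratic equation\<close>

text \<open>The generating function \<open>f\<close> is a root of \<open>a f\<^sup>2 - b f + c\<close>, with \<open>z\<close> and \<open>y = F(z)\<close> as parameters.
  As for the radicand, every \<open>K\<close> other than \<open>{1..}\<close> and \<open>{2}\<close> is treated as \<open>{1, 2}\<close>.\<close>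

definition quad_a :: "nat set \<Rightarrow> tree_class \<Rightarrow> 'a::comm_ring_1 \<Rightarrow> 'a \<Rightarrow> 'a" where
  "quad_a K cls z y =
     (if K = {1..} then (case cls of Class_R \<Rightarrow> z | Class_S \<Rightarrow> z * y | Class_T \<Rightarrow> z)
      else (case cls of Class_R \<Rightarrow> z\<^sup>2 | Class_S \<Rightarrow> z\<^sup>2 * y\<^sup>2 | Class_T \<Rightarrow> z\<^sup>2 * y))"

definition quad_b :: "nat set \<Rightarrow> tree_class \<Rightarrow> 'a::comm_ring_1 \<Rightarrow> 'a \<Rightarrow> 'a" where
  "quad_b K cls z y =
     (if K = {1..} then (if cls = Class_R then 1 + z * y - z else 1)
      else if K = {2} then 1 else (if cls = Class_R then 1 - z else 1 - z * y))"

definition quad_c :: "tree_class \<Rightarrow> 'a::comm_ring_1 \<Rightarrow> 'a" where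
  "quad_c cls y = (if cls = Class_S then 1 else y)"

text \<open>The coefficients of \<open>f\<^sup>0\<close>, \<open>f\<^sup>1\<close>, \<open>f\<^sup>2\<close> in the derivative of \<open>a f\<^sup>2 - b f + c\<close> with
  respect to the flower series.\<close>

definition flower_diff :: "nat set \<Rightarrow> tree_class \<Rightarrow> nat \<Rightarrow> 'a::comm_ring_1 \<Rightarrow> 'a \<Rightarrow> 'a" where
  "flower_diff K cls i z y =
     (if i = 0 then (if cls = Class_S then 0 else 1)
      else if i = 1 then
        (if K = {1..} then (if cls = Class_R then - z else 0)
         else if K = {2} then 0 else (if cls = Class_R then 0 else z))
      else
        (case cls of Class_R \<Rightarrow> 0
         | Class_S \<Rightarrow> (if K = {1..} then z else 2 * z\<^sup>2 * y)
         | Class_T \<Rightarrow> (if K = {1..} then 0 else z\<^sup>2)))"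

lemma K_distinct: "{1..} \<noteq> {2::nat}" "{1..} \<noteq> {1, 2::nat}" "{2::nat} \<noteq> {1..}" "{1, 2::nat} \<noteq> {1..}"
  "{1, 2::nat} \<noteq> {2}" "{2::nat} \<noteq> {1, 2}"
proof -
  have "3 \<in> {1::nat..}" "3 \<notin> {2::nat}" "3 \<notin> {1, 2::nat}" "(1::nat) \<in> {1, 2}" "(1::nat) \<notin> {2}" by auto
  thus "{1..} \<noteq> {2::nat}" "{1..} \<noteq> {1, 2::nat}" "{2::nat} \<noteq> {1..}" "{1, 2::nat} \<noteq> {1..}"
    "{1, 2::nat} \<noteq> {2}" "{2::nat} \<noteq> {1, 2}" by metis+
qed

text \<open>For \<open>{1..}\<close> the rational K(w) = w / (1 - w) enters only through C = w (1 +
  C), which keeps everything polynomial; the rest is elimination of C.\<close>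

lemma class_decomposition_quadratic:
  fixes z F f :: "'a::comm_ring_1"
  assumes "class_decomposition cls K z F f" and K: "K = {1..} \<or> K = {2} \<or> K = {1, 2}"
  shows "quad_a K cls z F * f\<^sup>2 - quad_b K cls z F * f + quad_c cls F = 0"
proof -
  have geom: "C = w * (1 + C)" if "C * (1 - w) = w" for C w :: 'a
  proof -
    have "C = C * (1 - w) + w * C" by (simp add: algebra_simps)
    also have "\<dots> = w * (1 + C)" unfolding that by (simp add: algebra_simps)
    finally show ?thesis .
  qed
  show ?thesis
  proof (cases cls)
    case Class_R
    then obtain C where C: "children_series K (z * f) C" "f = F + C" using assms(1) by auto
    hence CfF: "C = f - F" by simp
    from K show ?thesis
    proof (elim disjE)
      assume K: "K = {1..}"
      have "C = z * f * (1 + C)" using C(1) K K_distinct by (intro geom) (simp add: children_series_def)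
      hence "f - F = z * f * (1 + (f - F))" by (simp only: CfF)
      thus ?thesis using K Class_R
        by (simp add: quad_a_def quad_b_def quad_c_def power2_eq_square algebra_simps)
    next
      assume K: "K = {2}"
      have "f - F = (z * f)\<^sup>2" using C(1) K K_distinct by (simp add: children_series_def CfF)
      hence "f = F + (z * f)\<^sup>2" by (simp add: algebra_simps)
      thus ?thesis using K Class_R K_distinct
        by (simp add: quad_a_def quad_b_def quad_c_def power2_eq_square algebra_simps)
    next
      assume K: "K = {1, 2}"
      have "f - F = z * f + (z * f)\<^sup>2" using C(1) K K_distinct by (simp add: children_series_def CfF)
      thus ?thesis using K Class_R K_distinct
        by (simp add: quad_a_def quad_b_def quad_c_def power2_eq_square algebra_simps)
    qed
  next
    case Class_S
    then obtain C where C: "children_series K (z * (F * f)) C" "f = 1 + C" using assms(1) by auto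
    hence CfF: "C = f - 1" by simp
    from K show ?thesis
    proof (elim disjE)
      assume K: "K = {1..}"
      have "C = z * (F * f) * (1 + C)" using C(1) K K_distinct by (intro geom) (simp add: children_series_def)
      hence "f - 1 = z * (F * f) * (1 + (f - 1))" by (simp only: CfF)
      thus ?thesis using K Class_S
        by (simp add: quad_a_def quad_b_def quad_c_def power2_eq_square algebra_simps)
    next
      assume K: "K = {2}"
      have "f - 1 = (z * (F * f))\<^sup>2" using C(1) K K_distinct by (simp add: children_series_def CfF)
      thus ?thesis using K Class_S K_distinct
        by (simp add: quad_a_def quad_b_def quad_c_def power2_eq_square algebra_simps)
    next
      assume K: "K = {1, 2}"
      have "f - 1 = z * (F * f) + (z * (F * f))\<^sup>2" using C(1) K K_distinct by (simp add: children_series_def CfF)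
      thus ?thesis using K Class_S K_distinct
        by (simp add: quad_a_def quad_b_def quad_c_def power2_eq_square algebra_simps)
    qed
  next
    case Class_T
    then obtain C where C: "children_series K (z * f) C" "f = F * (1 + C)" using assms(1) by auto
    \<comment> \<open>C stands for f / F - 1, but F need not be invertible: in the starred classes
      its constant term is 0. The product F C avoids the division.\<close>
    hence FC: "F * C = f - F" by (simp add: algebra_simps)
    from K show ?thesis
    proof (elim disjE)
      assume K: "K = {1..}"
      have "C = z * f * (1 + C)" using C(1) K K_distinct by (intro geom) (simp add: children_series_def)
      hence "F * C = z * f * (F * (1 + C))" by (metis mult.left_commute)
      hence "f - F = z * f * f" by (simp only: FC C(2)[symmetric])
      thus ?thesis using K Class_T
        by (simp add: quad_a_def quad_b_def quad_c_def power2_eq_square algebra_simps)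
    next
      assume K: "K = {2}"
      have "C = (z * f)\<^sup>2" using C(1) K K_distinct by (simp add: children_series_def)
      hence "f - F = F * (z * f)\<^sup>2" by (simp only: FC[symmetric])
      thus ?thesis using K Class_T K_distinct
        by (simp add: quad_a_def quad_b_def quad_c_def power2_eq_square algebra_simps)
    next
      assume K: "K = {1, 2}"
      have "C = z * f + (z * f)\<^sup>2" using C(1) K K_distinct by (simp add: children_series_def)
      hence "f - F = F * (z * f + (z * f)\<^sup>2)" by (simp only: FC[symmetric])
      thus ?thesis using K Class_T K_distinct
        by (simp add: quad_a_def quad_b_def quad_c_def power2_eq_square algebra_simps)
    qed
  qed
qed

section \<open>Values and derivatives at u = 1\<close>

lemma at_u1_simps [simp]:
  "at_u1 0 = 0" "at_u1 1 = 1" "at_u1 fps_X = fps_X" "at_u1 (numeral k) = numeral k"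
  "at_u1 (A + B) = at_u1 A + at_u1 B" "at_u1 (A - B) = at_u1 A - at_u1 B" "at_u1 (- A) = - at_u1 A"
  by (simp_all add: at_u1_def fps_eq_iff fps_X_nth numeral_fps_const)

lemma at_u1_mult [simp]: "at_u1 (A * B) = at_u1 A * at_u1 B"
  by (simp add: at_u1_def fps_eq_iff fps_mult_nth poly_sum)

lemma at_u1_power [simp]: "at_u1 (A ^ n) = at_u1 A ^ n"
  by (induction n) simp_all

lemma deriv_u1_simps [simp]:
  "deriv_u1 0 = 0" "deriv_u1 1 = 0" "deriv_u1 fps_X = 0"
  "deriv_u1 (A + B) = deriv_u1 A + deriv_u1 B" "deriv_u1 (A - B) = deriv_u1 A - deriv_u1 B"
  by (simp_all add: deriv_u1_def fps_eq_iff fps_X_nth pderiv_add pderiv_diff)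

lemma pderiv_sum: "pderiv (sum h S) = (\<Sum>x\<in>S. pderiv (h x))"
  by (induction S rule: infinite_finite_induct) (simp_all add: pderiv_add)

lemma deriv_u1_mult [simp]: "deriv_u1 (A * B) = deriv_u1 A * at_u1 B + at_u1 A * deriv_u1 B"
  by (simp add: deriv_u1_def at_u1_def fps_eq_iff fps_mult_nth poly_sum pderiv_sum pderiv_mult
      sum.distrib add.commute mult.commute[of "poly (pderiv _) 1"])

lemma deriv_u1_power2 [simp]: "deriv_u1 (A\<^sup>2) = 2 * at_u1 A * deriv_u1 A"
  by (simp add: power2_eq_square)

text \<open>Chain rule for the quadratic as a function of F and f: its partial derivative in f is 2
  a f - b = -h, and the one in F is the polynomial with coefficients
  \<open>flower_diff\<close>.\<close>

lemma quadratic_deriv_u1: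
  assumes "quad_a K cls fps_X F * f\<^sup>2 - quad_b K cls fps_X F * f + quad_c cls F = 0"
    and K: "K = {1..} \<or> K = {2} \<or> K = {1, 2}"
  defines "M \<equiv> \<lambda>i. flower_diff K cls i fps_X (at_u1 F) * deriv_u1 F"
  shows "(quad_b K cls fps_X (at_u1 F) - 2 * quad_a K cls fps_X (at_u1 F) * at_u1 f) * deriv_u1 f =
    M 0 + M 1 * at_u1 f + M 2 * (at_u1 f)\<^sup>2"
proof -
  have "deriv_u1 (quad_a K cls fps_X F * f\<^sup>2 - quad_b K cls fps_X F * f + quad_c cls F) = 0"
    unfolding assms(1) by simp
  thus ?thesis
    using K K_distinct unfolding M_def
    by (elim disjE; cases cls)
      (simp_all add: quad_a_def quad_b_def quad_c_def flower_diff_def power2_eq_square algebra_simps)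
qed

section \<open>Radii of convergence and evaluation\<close>

lemma fps_conv_radius_mult_less:
  "e < fps_conv_radius A \<Longrightarrow> e < fps_conv_radius B \<Longrightarrow> e < fps_conv_radius (A * B)"
  for A B :: "'a::{banach, real_normed_div_algebra, comm_ring_1} fps"
  using fps_conv_radius_mult[of A B] by (auto simp: min_def split: if_splits)

lemma fps_conv_radius_add_less:
  "e < fps_conv_radius A \<Longrightarrow> e < fps_conv_radius B \<Longrightarrow> e < fps_conv_radius (A + B)"
  for A B :: "'a::{banach, real_normed_div_algebra} fps"
  using fps_conv_radius_add[of A B] by (auto simp: min_def split: if_splits)

lemma fps_conv_radius_diff_less:
  "e < fps_conv_radius A \<Longrightarrow> e < fps_conv_radius B \<Longrightarrow> e < fps_conv_radius (A - B)"
  for A B :: "'a::{banach, real_normed_div_algebra} fps"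
  using fps_conv_radius_diff[of A B] by (auto simp: min_def split: if_splits)

lemma fps_conv_radius_power_less:
  "e < fps_conv_radius A \<Longrightarrow> e < fps_conv_radius (A ^ n)"
  for A :: "'a::{banach, real_normed_div_algebra, comm_ring_1} fps"
  using fps_conv_radius_power[of A n] by (rule less_le_trans[rotated])

lemmas fps_conv_radius_less = fps_conv_radius_mult_less fps_conv_radius_add_less
  fps_conv_radius_diff_less fps_conv_radius_power_less

lemma quad_conv_radius:
  fixes F :: "real fps"
  assumes "ereal x < fps_conv_radius F"
  shows "ereal x < fps_conv_radius (quad_a K cls fps_X F)"
    "ereal x < fps_conv_radius (quad_b K cls fps_X F)"
    "ereal x < fps_conv_radius (quad_c cls F)"
    "ereal x < fps_conv_radius (flower_diff K cls i fps_X F)"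
  using assms
  by (cases cls; simp add: quad_a_def quad_b_def quad_c_def flower_diff_def fps_conv_radius_less)+

lemma eval_quad:
  fixes F :: "real fps"
  assumes "ereal \<bar>x\<bar> < fps_conv_radius F"
  shows "eval_fps (quad_a K cls fps_X F) x = quad_a K cls x (eval_fps F x)"
    "eval_fps (quad_b K cls fps_X F) x = quad_b K cls x (eval_fps F x)"
    "eval_fps (quad_c cls F) x = quad_c cls (eval_fps F x)"
    "eval_fps (flower_diff K cls i fps_X F) x = flower_diff K cls i x (eval_fps F x)"
  using assms
  by (cases cls; simp add: quad_a_def quad_b_def quad_c_def flower_diff_def fps_conv_radius_less
      eval_fps_mult eval_fps_add eval_fps_diff eval_fps_power eval_fps_minus)+

lemma radicand_eq_discriminant:
  assumes "K = {1..} \<or> K = {2} \<or> K = {1, 2}"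
  shows "radicand K cls z y = (quad_b K cls z y)\<^sup>2 - 4 * quad_a K cls z y * quad_c cls y"
  using assms K_distinct
  by (elim disjE; cases cls)
    (simp_all add: radicand_def quad_a_def quad_b_def quad_c_def power2_eq_square algebra_simps)

text \<open>C = w / (1 - w): since w has no constant term, the recursion expresses each coefficient
  by earlier ones with nonnegative weights.\<close>

lemma fps_nonneg_geometric:
  fixes C w :: "real fps"
  assumes "C = w * (1 + C)" "fps_nth w 0 = 0" "\<And>n. 0 \<le> fps_nth w n"
  shows "0 \<le> fps_nth C n"
proof (induction n rule: less_induct)
  case (less n)
  have "fps_nth C n = fps_nth (w * (1 + C)) n" using assms(1) by simp
  also have "\<dots> = (\<Sum>i=0..n. fps_nth w i * fps_nth (1 + C) (n - i))" by (rule fps_mult_nth)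
  also have "\<dots> \<ge> 0"
  proof (rule sum_nonneg)
    fix i assume "i \<in> {0..n}"
    show "0 \<le> fps_nth w i * fps_nth (1 + C) (n - i)"
    proof (cases "i = 0")
      case False
      hence "0 \<le> fps_nth C (n - i)" if "n > 0" using that by (intro less) auto
      thus ?thesis using False \<open>i \<in> {0..n}\<close> assms(3)[of i]
        by (cases "n = 0") (auto intro!: mult_nonneg_nonneg)
    qed (use assms in simp)
  qed
  finally show ?case .
qed

lemma fps_mult_nonneg: "(\<And>n. 0 \<le> fps_nth A n) \<Longrightarrow> (\<And>n. 0 \<le> fps_nth B n) \<Longrightarrow> 0 \<le> fps_nth (A * B) n"
  for A B :: "real fps"
  by (simp add: fps_mult_nth sum_nonneg)

text \<open>1 - h = (1 - b) + 2 a f, and 1 - b is nonnegative except for \<R> with K =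
  \<open>{1..}\<close>, where it is z - z F. There one of the two summands z f compensates: f - F =
  z f / (1 - z f) has nonnegative coefficients.\<close>

lemma discriminant_root_nonneg:
  fixes F f :: "real fps"
  assumes quad: "quad_a K cls fps_X F * f\<^sup>2 - quad_b K cls fps_X F * f + quad_c cls F = 0"
    and K: "K = {1..} \<or> K = {2} \<or> K = {1, 2}"
    and F: "\<And>n. 0 \<le> fps_nth F n" and f: "\<And>n. 0 \<le> fps_nth f n"
  shows "0 \<le> fps_nth (1 - (quad_b K cls fps_X F - 2 * quad_a K cls fps_X F * f)) n"
proof -
  have X: "0 \<le> fps_nth (fps_X :: real fps) n" for n by (simp add: fps_X_nth)
  have a: "0 \<le> fps_nth (quad_a K cls fps_X F) n" for n
    by (cases cls) (auto simp: quad_a_def power2_eq_square intro!: fps_mult_nonneg X F)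
  hence af: "0 \<le> fps_nth (quad_a K cls fps_X F * f) n" for n by (intro fps_mult_nonneg f)
  show ?thesis
  proof (cases "K = {1..} \<and> cls = Class_R")
    case True
    have "f - F = fps_X * f * (1 + (f - F))"
      using quad True by (simp add: quad_a_def quad_b_def quad_c_def power2_eq_square algebra_simps)
    hence fF: "0 \<le> fps_nth (f - F) n" for n
      by (rule fps_nonneg_geometric) (auto intro: fps_mult_nonneg X f)
    have "1 - (quad_b K cls fps_X F - 2 * quad_a K cls fps_X F * f) =
        fps_X + fps_X * f + fps_X * (f - F)"
      using True by (simp add: quad_a_def quad_b_def algebra_simps)
    moreover have "0 \<le> fps_nth (fps_X * (f - F)) n" by (intro fps_mult_nonneg X fF)
    moreover have "0 \<le> fps_nth (fps_X * f) n" by (intro fps_mult_nonneg X f)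
    ultimately show ?thesis using X[of n] by (simp only: fps_add_nth)
  next
    case False
    have "0 \<le> fps_nth (1 - quad_b K cls fps_X F) n"
      using False K X[of n] fps_mult_nonneg[of fps_X F n] X F by (auto simp: quad_b_def)
    moreover have "1 - (quad_b K cls fps_X F - 2 * quad_a K cls fps_X F * f) =
        (1 - quad_b K cls fps_X F) + (quad_a K cls fps_X F * f + quad_a K cls fps_X F * f)"
      by (simp add: algebra_simps)
    ultimately show ?thesis using af[of n] by (simp only: fps_add_nth)
  qed
qed

section \<open>Values at the dominant singularity\<close>

lemma quad_a_nonzero:
  assumes "0 < z" "radicand K cls z y = 0"
  shows "quad_a K cls z y \<noteq> 0"
proof
  assume 0: "quad_a K cls z y = 0"
  hence "y = 0 \<and> cls \<noteq> Class_R" using assms(1) by (cases cls) (auto simp: quad_a_def split: if_splits)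
  \<comment> \<open>At y = 0 the radicand for \<S> and \<T> is 1.\<close>
  thus False using assms(2) by (auto simp: radicand_def split: if_splits)
qed

text \<open>The derivative of the quadratic with respect to the flower series, at its double root.\<close>

definition flower_diff_at_root :: "nat set \<Rightarrow> tree_class \<Rightarrow> real \<Rightarrow> real \<Rightarrow> real" where
  "flower_diff_at_root K cls z y =
     (let t = quad_b K cls z y / (2 * quad_a K cls z y)
      in flower_diff K cls 0 z y + flower_diff K cls 1 z y * t + flower_diff K cls 2 z y * t\<^sup>2)"

text \<open>The displayed values are one of many equivalent forms on the curve p = 0, so the
  radicand equation enters the simplification. Nonvanishing lets the limits become asymptotic
  equivalences.\<close>

lemma flower_diff_at_root_1:
  assumes "0 < z" "radicand {1..} cls z y = 0"
  shows "flower_diff_at_root {1..} cls z y =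
    (case cls of Class_R \<Rightarrow> (1 + z - z * y) / 2 | Class_S \<Rightarrow> (1 - 2 * z * y) / (2 * z * y\<^sup>2) | Class_T \<Rightarrow> 1)"
    and "flower_diff_at_root {1..} cls z y \<noteq> 0"
proof -
  show 1: "flower_diff_at_root {1..} cls z y =
    (case cls of Class_R \<Rightarrow> (1 + z - z * y) / 2 | Class_S \<Rightarrow> (1 - 2 * z * y) / (2 * z * y\<^sup>2) | Class_T \<Rightarrow> 1)"
  proof (cases cls)
    case Class_S
    hence p: "4 * (z * y) = 1" using assms by (simp add: radicand_def)
    hence y: "y = 1 / (4 * z)" using assms by (simp add: field_simps)
    show ?thesis using assms(1) Class_S
      by (simp add: flower_diff_at_root_def flower_diff_def quad_a_def quad_b_def y) (simp add: field_simps power2_eq_square)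
  qed (use assms in \<open>simp_all add: flower_diff_at_root_def flower_diff_def quad_a_def quad_b_def field_simps\<close>)
  show "flower_diff_at_root {1..} cls z y \<noteq> 0"
  proof (cases cls)
    case Class_R
    \<comment> \<open>If z y were 1 + z, the radicand would be -4 z.\<close>
    have "1 + z - z * y \<noteq> 0"
    proof
      assume "1 + z - z * y = 0"
      hence e: "z * y = 1 + z" by simp
      have "z\<^sup>2 * y\<^sup>2 - 2 * (z + z\<^sup>2) * y + (1 - z)\<^sup>2 = (z * y)\<^sup>2 - 2 * (1 + z) * (z * y) + (1 - z)\<^sup>2"
        by (simp add: power2_eq_square algebra_simps)
      also have "\<dots> = - 4 * z" unfolding e by (simp add: power2_eq_square algebra_simps)
      finally show False using assms Class_R by (simp add: radicand_def)
    qed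
    thus ?thesis unfolding 1 using Class_R by simp
  next
    case Class_S
    hence p: "4 * (z * y) = 1" using assms by (simp add: radicand_def)
    moreover have "y \<noteq> 0" using p by auto
    ultimately show ?thesis unfolding 1 using Class_S assms(1) by simp
  next
    case Class_T
    thus ?thesis unfolding 1 by simp
  qed
qed

lemma flower_diff_at_root_2:
  assumes "0 < z" "radicand {2} cls z y = 0"
  shows "flower_diff_at_root {2} cls z y =
    (case cls of Class_R \<Rightarrow> 1 | Class_S \<Rightarrow> (1 - 2 * z\<^sup>2 * y\<^sup>2) / (z\<^sup>2 * y ^ 3) | Class_T \<Rightarrow> 1 / (2 * z\<^sup>2 * y\<^sup>2))"
    and "flower_diff_at_root {2} cls z y \<noteq> 0"
proof -
  have p: "4 * (z\<^sup>2 * y\<^sup>2) = 1" if "cls \<noteq> Class_R" using assms that K_distinct by (simp add: radicand_def)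
  hence y: "y \<noteq> 0" if "cls \<noteq> Class_R" using that by fastforce
  note defs = flower_diff_at_root_def flower_diff_def quad_a_def quad_b_def
  show 1: "flower_diff_at_root {2} cls z y =
    (case cls of Class_R \<Rightarrow> 1 | Class_S \<Rightarrow> (1 - 2 * z\<^sup>2 * y\<^sup>2) / (z\<^sup>2 * y ^ 3) | Class_T \<Rightarrow> 1 / (2 * z\<^sup>2 * y\<^sup>2))"
  proof (cases cls)
    case Class_S
    have "flower_diff_at_root {2} cls z y = 2 * z\<^sup>2 * y * (1 / (2 * (z\<^sup>2 * y\<^sup>2)))\<^sup>2"
      using Class_S K_distinct by (simp add: defs)
    also have "\<dots> = 1 / (2 * z\<^sup>2 * y ^ 3)"
      using assms(1) y Class_S by (simp add: field_simps power2_eq_square power3_eq_cube)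
    \<comment> \<open>By \<open>p\<close>, both 2 z^2 y^2 and 1 - 2 z^2 y^2 equal 1/2.\<close>
    also have "\<dots> = (1 - 2 * (z\<^sup>2 * y\<^sup>2)) / (z\<^sup>2 * y ^ 3)"
      using p Class_S assms(1) y by (simp add: field_simps)
    finally show ?thesis using Class_S by (simp add: mult.assoc)
  next
    case Class_T
    have "flower_diff_at_root {2} cls z y = 1 + z\<^sup>2 * (1 / (2 * (z\<^sup>2 * y)))\<^sup>2"
      using Class_T K_distinct by (simp add: defs)
    also have "\<dots> = 1 + 1 / (4 * (z\<^sup>2 * y\<^sup>2))"
      using assms(1) y Class_T by (simp add: field_simps power2_eq_square)
    also have "\<dots> = 2" using p Class_T by simp
    also have "\<dots> = 1 / (2 * (z\<^sup>2 * y\<^sup>2))"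
    proof -
      have "2 * (z\<^sup>2 * y\<^sup>2) = 1 / 2" using p Class_T by simp
      thus ?thesis by (simp only:) simp
    qed
    finally show ?thesis using Class_T by (simp add: mult.assoc)
  qed (use K_distinct in \<open>simp add: defs\<close>)
  show "flower_diff_at_root {2} cls z y \<noteq> 0"
    unfolding 1 using p y assms(1) by (cases cls) auto
qed

lemma flower_diff_at_root_12:
  assumes "0 < z" "radicand {1, 2} cls z y = 0"
  shows "flower_diff_at_root {1, 2} cls z y =
    (case cls of Class_R \<Rightarrow> 1 | Class_S \<Rightarrow> (2 - 3 * z * y - 3 * z\<^sup>2 * y\<^sup>2) / (2 * z\<^sup>2 * y ^ 3)
     | Class_T \<Rightarrow> (1 - z * y) / (2 * z\<^sup>2 * y\<^sup>2))"
    and "flower_diff_at_root {1, 2} cls z y \<noteq> 0"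
proof -
  have p: "1 - 2 * (z * y) - 3 * (z * y)\<^sup>2 = 0" if "cls \<noteq> Class_R"
    using assms that K_distinct by (simp add: radicand_def power_mult_distrib mult.assoc)
  hence y: "y \<noteq> 0" if "cls \<noteq> Class_R" using that by fastforce
  note defs = flower_diff_at_root_def flower_diff_def quad_a_def quad_b_def
  define x where "x = z * y"
  have zx: "z\<^sup>2 * y\<^sup>2 = x\<^sup>2" by (simp add: x_def power_mult_distrib)
  \<comment> \<open>At x = 1 the radicand 1 - 2 x - 3 x^2 would be -4.\<close>
  have x: "x \<noteq> 0" "1 - x \<noteq> 0" if "cls \<noteq> Class_R"
    using p[OF that] y[OF that] assms(1) by (auto simp: x_def)
  have S: "flower_diff_at_root {1, 2} cls z y = (1 - x) / (2 * z\<^sup>2 * y ^ 3)" if "cls = Class_S"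
  proof -
    have "flower_diff_at_root {1, 2} cls z y = z * ((1 - x) / (2 * x\<^sup>2)) + 2 * z\<^sup>2 * y * ((1 - x) / (2 * x\<^sup>2))\<^sup>2"
      using that K_distinct by (simp add: defs zx flip: x_def)
    also have "\<dots> = (1 - x) / (2 * z\<^sup>2 * y ^ 3)"
      using assms(1) y that by (simp add: x_def field_simps power2_eq_square power3_eq_cube)
    finally show ?thesis .
  qed
  have T: "flower_diff_at_root {1, 2} cls z y = (1 - x) / (2 * x\<^sup>2)" if "cls = Class_T"
  proof -
    have "flower_diff_at_root {1, 2} cls z y = 1 + z * ((1 - x) / (2 * (z\<^sup>2 * y))) + z\<^sup>2 * ((1 - x) / (2 * (z\<^sup>2 * y)))\<^sup>2"
      using that K_distinct by (simp add: defs flip: x_def)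
    also have "\<dots> = 1 + (1 - x) / (2 * x) + (1 - x)\<^sup>2 / (4 * x\<^sup>2)"
      using assms(1) y that by (simp add: x_def field_simps power2_eq_square)
    also have "\<dots> = (4 * x\<^sup>2 + 2 * x * (1 - x) + (1 - x)\<^sup>2) / (4 * x\<^sup>2)"
      using x that by (simp add: field_simps power2_eq_square)
    \<comment> \<open>Reduction modulo the radicand, which leaves 2 (1 - x).\<close>
    also have "4 * x\<^sup>2 + 2 * x * (1 - x) + (1 - x)\<^sup>2 = 2 * (1 - x) - (1 - 2 * x - 3 * x\<^sup>2)"
      by (simp add: power2_eq_square algebra_simps)
    also have "1 - 2 * x - 3 * x\<^sup>2 = 0" using p that by (simp add: x_def)
    finally show ?thesis using x that by (simp add: field_simps)
  qed
  show 1: "flower_diff_at_root {1, 2} cls z y =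
    (case cls of Class_R \<Rightarrow> 1 | Class_S \<Rightarrow> (2 - 3 * z * y - 3 * z\<^sup>2 * y\<^sup>2) / (2 * z\<^sup>2 * y ^ 3)
     | Class_T \<Rightarrow> (1 - z * y) / (2 * z\<^sup>2 * y\<^sup>2))"
  proof (cases cls)
    case Class_S
    \<comment> \<open>The displayed numerator exceeds 1 - x by exactly the radicand.\<close>
    have "2 - 3 * z * y - 3 * z\<^sup>2 * y\<^sup>2 = (1 - x) + (1 - 2 * x - 3 * x\<^sup>2)"
      by (simp add: x_def power_mult_distrib algebra_simps)
    also have "1 - 2 * x - 3 * x\<^sup>2 = 0" using p Class_S by (simp add: x_def)
    finally show ?thesis using S Class_S by simp
  next
    case Class_T
    thus ?thesis using T zx by (simp add: mult.assoc flip: x_def)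
  qed (use K_distinct in \<open>simp add: defs\<close>)
  show "flower_diff_at_root {1, 2} cls z y \<noteq> 0"
  proof (cases cls)
    case Class_R
    thus ?thesis unfolding 1 by simp
  next
    case Class_S
    thus ?thesis using S x y assms(1) by simp
  next
    case Class_T
    thus ?thesis using T x by simp
  qed
qed

text \<open>Meant for \<open>w\<close> the power n^(3/2) or n^(1/2) and \<open>t\<close> the scale
  \<theta> or \<theta>', whose product with \<open>w\<close> is constant from n = 1 on. The constant
  k must be nonzero, as equivalence to the zero sequence means eventual vanishing.\<close>

lemma asymp_equiv_from_limit:
  fixes v t w :: "nat \<Rightarrow> real"
  assumes "(\<lambda>n. v n * \<zeta> ^ n * w n) \<longlonglongrightarrow> k * T" "\<And>n. 0 < n \<Longrightarrow> t n * w n = T"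
    and "k \<noteq> 0" "T \<noteq> 0" "0 < \<zeta>"
  shows "v \<sim>[at_top] (\<lambda>n. k * t n / \<zeta> ^ n)"
proof (rule asymp_equivI')
  have "(\<lambda>n. v n * \<zeta> ^ n * w n / (k * T)) \<longlonglongrightarrow> k * T / (k * T)"
    by (intro tendsto_divide assms(1) tendsto_const) (use assms in auto)
  also have "k * T / (k * T) = 1" using assms by simp
  finally show "(\<lambda>n. v n / (k * t n / \<zeta> ^ n)) \<longlonglongrightarrow> 1"
  proof (rule Lim_transform_eventually)
    show "\<forall>\<^sub>F n in sequentially. v n * \<zeta> ^ n * w n / (k * T) = v n / (k * t n / \<zeta> ^ n)"
      using eventually_gt_at_top[of 0]
    proof eventually_elim
      case (elim n)
      have T: "T = t n * w n" using elim by (rule assms(2)[symmetric])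
      hence "w n \<noteq> 0" "t n \<noteq> 0" using assms(4) by auto
      thus ?case using assms(3,5) unfolding T by (simp add: field_simps)
    qed
  qed
qed

section \<open>Asymptotics\<close>

text \<open>An asymptotic equivalence to the zero sequence asserts eventual vanishing, hence the
  proviso on \<open>Fu\<zeta>\<close>: either the leading coefficient of \<Omega> is nonzero, or
  \<open>Fu\<close> and with it \<Omega> is 0.\<close>

theorem theorem1:
  fixes K N :: "nat set" and kind :: flower_kind and cls :: tree_class and star :: bool
    and F f :: "real fps" and p :: "real \<Rightarrow> real" and \<zeta> F\<zeta> p' r \<phi> :: real
    and g :: "complex \<Rightarrow> complex" and \<theta> \<theta>' :: "nat \<Rightarrow> real"
    and \<kappa> :: "ftree \<Rightarrow> nat" and B :: "real poly fps"
    and Fu \<Omega> :: "real fps" and Fu\<zeta> :: real and E :: "nat \<Rightarrow> real"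
  assumes K: "K = {1..} \<or> K = {2} \<or> K = {1, 2}"
    and N: "N \<noteq> {}" "0 \<notin> N"
    and F: "F = (if star then flower_gf kind N - 1 else flower_gf kind N)"
    and f: "f = tree_gf cls star K kind N"
    and p: "p = (\<lambda>z. radicand K cls z (eval_fps F z))"
    and root: "0 < \<zeta>" "ereal \<zeta> < fps_conv_radius F" "p \<zeta> = 0"
    and smallest: "\<And>x. 0 < x \<Longrightarrow> x < \<zeta> \<Longrightarrow> p x \<noteq> 0"
    and dominant: "fps_conv_radius f = ereal \<zeta>"
    and delta: "1 < r" "0 < \<phi>" "\<phi> < pi / 2"
    and continuation: "g holomorphic_on ((\<lambda>z. complex_of_real \<zeta> * z) ` delta_domain r \<phi>)"
      "g has_fps_expansion Abs_fps (\<lambda>n. complex_of_real (fps_nth f n))"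
    and F\<zeta>: "F\<zeta> = eval_fps F \<zeta>"
    and p': "p' = deriv p \<zeta>"
    and simple: "p' \<noteq> 0"
    and \<theta>: "\<theta> = (\<lambda>n. sqrt (- \<zeta> * p') / (2 * sqrt (pi * real n ^ 3)))"
    and \<theta>': "\<theta>' = (\<lambda>n. 1 / sqrt (- \<zeta> * p' * pi * real n))"
    and Fu: "Fu = deriv_u1 B"
    and Fu\<zeta>: "Fu\<zeta> = eval_fps Fu \<zeta>"
    and \<Omega>: "\<Omega> = deriv_u1 (tree_bgf cls star K kind N \<kappa>)"
    and E: "E = (\<lambda>n. mean_on (objects cls star K kind N n) \<kappa>)"
  shows
   "((K = {1..} \<longrightarrow>
        (cls = Class_R \<longrightarrow> fps_nth f \<sim>[at_top] (\<lambda>n. 1 / (2 * \<zeta>) * \<theta> n / \<zeta> ^ n)) \<and>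
        (cls = Class_S \<longrightarrow> fps_nth f \<sim>[at_top] (\<lambda>n. 1 / (2 * \<zeta> * F\<zeta>) * \<theta> n / \<zeta> ^ n)) \<and>
        (cls = Class_T \<longrightarrow> fps_nth f \<sim>[at_top] (\<lambda>n. 1 / (2 * \<zeta>) * \<theta> n / \<zeta> ^ n))) \<and>
     (K = {2} \<or> K = {1, 2} \<longrightarrow>
        (cls = Class_R \<longrightarrow> fps_nth f \<sim>[at_top] (\<lambda>n. 1 / (2 * \<zeta>^2) * \<theta> n / \<zeta> ^ n)) \<and>
        (cls = Class_S \<longrightarrow> fps_nth f \<sim>[at_top] (\<lambda>n. 1 / (2 * \<zeta>^2 * F\<zeta>^2) * \<theta> n / \<zeta> ^ n)) \<and>
        (cls = Class_T \<longrightarrow> fps_nth f \<sim>[at_top] (\<lambda>n. 1 / (2 * \<zeta>^2 * F\<zeta>) * \<theta> n / \<zeta> ^ n)))) \<and>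
    (flower_parameter cls star K kind N \<kappa> B \<and>
     ereal \<zeta> < fps_conv_radius Fu \<and> (Fu\<zeta> \<noteq> 0 \<or> Fu = 0) \<longrightarrow>
      (K = {1..} \<longrightarrow>
        (cls = Class_R \<longrightarrow>
           fps_nth \<Omega> \<sim>[at_top] (\<lambda>n. (1 + \<zeta> - \<zeta> * F\<zeta>) * Fu\<zeta> / 2 * \<theta>' n / \<zeta> ^ n) \<and>
           E \<sim>[at_top] (\<lambda>n. 2 * (1 + \<zeta> - \<zeta> * F\<zeta>) * Fu\<zeta> / (- p') * real n)) \<and>
        (cls = Class_S \<longrightarrow>
           fps_nth \<Omega> \<sim>[at_top] (\<lambda>n. (1 - 2 * \<zeta> * F\<zeta>) * Fu\<zeta> / (2 * \<zeta> * F\<zeta>^2) * \<theta>' n / \<zeta> ^ n) \<and>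
           E \<sim>[at_top] (\<lambda>n. 2 * (1 - 2 * \<zeta> * F\<zeta>) * Fu\<zeta> / (- \<zeta> * F\<zeta> * p') * real n)) \<and>
        (cls = Class_T \<longrightarrow>
           fps_nth \<Omega> \<sim>[at_top] (\<lambda>n. Fu\<zeta> * \<theta>' n / \<zeta> ^ n) \<and>
           E \<sim>[at_top] (\<lambda>n. 4 * Fu\<zeta> / (- p') * real n))) \<and>
      (K = {2} \<longrightarrow>
        (cls = Class_R \<longrightarrow>
           fps_nth \<Omega> \<sim>[at_top] (\<lambda>n. Fu\<zeta> * \<theta>' n / \<zeta> ^ n) \<and>
           E \<sim>[at_top] (\<lambda>n. 4 * \<zeta> * Fu\<zeta> / (- p') * real n)) \<and>
        (cls = Class_S \<longrightarrow>
           fps_nth \<Omega> \<sim>[at_top] (\<lambda>n. (1 - 2 * \<zeta>^2 * F\<zeta>^2) * Fu\<zeta> / (\<zeta>^2 * F\<zeta>^3) * \<theta>' n / \<zeta> ^ n) \<and>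
           E \<sim>[at_top] (\<lambda>n. 4 * (1 - 2 * \<zeta>^2 * F\<zeta>^2) * Fu\<zeta> / (- \<zeta> * F\<zeta> * p') * real n)) \<and>
        (cls = Class_T \<longrightarrow>
           fps_nth \<Omega> \<sim>[at_top] (\<lambda>n. Fu\<zeta> / (2 * \<zeta>^2 * F\<zeta>^2) * \<theta>' n / \<zeta> ^ n) \<and>
           E \<sim>[at_top] (\<lambda>n. 2 * Fu\<zeta> / (- \<zeta> * F\<zeta> * p') * real n))) \<and>
      (K = {1, 2} \<longrightarrow>
        (cls = Class_R \<longrightarrow>
           fps_nth \<Omega> \<sim>[at_top] (\<lambda>n. Fu\<zeta> * \<theta>' n / \<zeta> ^ n) \<and>
           E \<sim>[at_top] (\<lambda>n. 4 * \<zeta>^2 * Fu\<zeta> / (- \<zeta> * p') * real n)) \<and>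
        (cls = Class_S \<longrightarrow>
           fps_nth \<Omega> \<sim>[at_top] (\<lambda>n. (2 - 3 * \<zeta> * F\<zeta> - 3 * \<zeta>^2 * F\<zeta>^2) * Fu\<zeta> / (2 * \<zeta>^2 * F\<zeta>^3) * \<theta>' n / \<zeta> ^ n) \<and>
           E \<sim>[at_top] (\<lambda>n. 2 * (2 - 3 * \<zeta> * F\<zeta> - 3 * \<zeta>^2 * F\<zeta>^2) * Fu\<zeta> / (- \<zeta> * F\<zeta> * p') * real n)) \<and>
        (cls = Class_T \<longrightarrow>
           fps_nth \<Omega> \<sim>[at_top] (\<lambda>n. (1 - \<zeta> * F\<zeta>) * Fu\<zeta> / (2 * \<zeta>^2 * F\<zeta>^2) * \<theta>' n / \<zeta> ^ n) \<and>
           E \<sim>[at_top] (\<lambda>n. 2 * (1 - \<zeta> * F\<zeta>) * Fu\<zeta> / (- \<zeta> * F\<zeta> * p') * real n))))"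
proof -
  define a b c where "a = quad_a K cls fps_X F" and "b = quad_b K cls fps_X F" and "c = quad_c cls F"
  define P where "P = b\<^sup>2 - 4 * a * c"
  have quad: "a * f\<^sup>2 - b * f + c = 0"
    unfolding a_def b_def c_def f F
    by (rule class_decomposition_quadratic[OF tree_gf_decomposition[OF K N(2) refl] K])
  have square: "(b - 2 * a * f)\<^sup>2 = P"
  proof -
    have "(b - 2 * a * f)\<^sup>2 = b\<^sup>2 - 4 * a * c + 4 * a * (a * f\<^sup>2 - b * f + c)"
      by (simp add: power2_eq_square algebra_simps)
    thus ?thesis by (simp add: quad P_def)
  qed
  have radius: "ereal \<zeta> < fps_conv_radius a" "ereal \<zeta> < fps_conv_radius b" "ereal \<zeta> < fps_conv_radius c"
    unfolding a_def b_def c_def by (intro quad_conv_radius root(2))+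
  have P_eval: "eval_fps P x = p x" and P_radius: "ereal \<bar>x\<bar> < fps_conv_radius P"
    if "ereal \<bar>x\<bar> < fps_conv_radius F" for x
  proof -
    note r = quad_conv_radius(1,2)[OF that, of K cls] quad_conv_radius(3)[OF that, of cls]
    show "eval_fps P x = p x"
      unfolding P_def a_def b_def c_def p radicand_eq_discriminant[OF K]
      using that r
      by (simp add: eval_fps_diff eval_fps_mult eval_fps_power eval_quad fps_conv_radius_less)
    show "ereal \<bar>x\<bar> < fps_conv_radius P"
      unfolding P_def a_def b_def c_def using r by (simp add: fps_conv_radius_less)
  qed
  have \<zeta>F: "ereal \<bar>\<zeta>\<bar> < fps_conv_radius F" using root by simp
  have rad0: "radicand K cls \<zeta> F\<zeta> = 0" using root(3) by (simp add: p F\<zeta>)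
  define \<alpha> where "\<alpha> = quad_a K cls \<zeta> F\<zeta>"
  have \<alpha>: "eval_fps a \<zeta> = \<alpha>" "\<alpha> \<noteq> 0"
    unfolding a_def \<alpha>_def using eval_quad(1)[OF \<zeta>F] quad_a_nonzero[OF root(1) rad0] by (simp_all add: F\<zeta>)
  have D_eval: "eval_fps (2 * a) \<zeta> = 2 * \<alpha>" using radius(1) root(1) \<alpha>(1) by (simp add: eval_fps_mult)
  have F_nonneg: "0 \<le> fps_nth F n" for n
    unfolding F flower_gf_star[OF N(2), symmetric] by (rule weight_gf_nonneg)
  have f_nonneg: "0 \<le> fps_nth f n" for n by (simp add: f tree_gf_def)
  \<comment> \<open>\<zeta> lies inside the disc of convergence of F, so p and the sum of P agree
    near \<zeta> and not only at it.\<close>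
  have p'_eval: "eval_fps (fps_deriv P) \<zeta> = p'"
  proof -
    have "(eval_fps P has_field_derivative eval_fps (fps_deriv P) \<zeta>) (at \<zeta>)"
      using P_radius[OF \<zeta>F] by (intro has_field_derivative_eval_fps) simp
    moreover have "eventually (\<lambda>x. x \<in> eball 0 (fps_conv_radius F)) (nhds \<zeta>)"
      using \<zeta>F by (intro eventually_nhds_in_open) auto
    hence "eventually (\<lambda>x. eval_fps P x = p x) (nhds \<zeta>)"
      by eventually_elim (simp add: P_eval)
    ultimately have "(p has_field_derivative eval_fps (fps_deriv P) \<zeta>) (at \<zeta>)"
      by (subst (asm) DERIV_cong_ev[OF refl _ refl])
    thus ?thesis unfolding p' by (rule DERIV_imp_deriv[symmetric])
  qed
  interpret real_sqrt_singularity b "2 * a" P f g \<zeta> r \<phi>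
  proof
    show "ereal \<zeta> < fps_conv_radius (2 * a)" using radius by (simp add: fps_conv_radius_less)
    show "ereal \<zeta> < fps_conv_radius P" using P_radius[OF \<zeta>F] root(1) by simp
    show "fps_nth (b - 2 * a * f) 0 = 1"
      by (cases cls) (simp_all add: a_def b_def quad_a_def quad_b_def)
    show "0 \<le> fps_nth (1 - (b - 2 * a * f)) n" for n
      unfolding a_def b_def
      by (rule discriminant_root_nonneg[OF quad[unfolded a_def b_def c_def] K F_nonneg f_nonneg])
    show "eval_fps (2 * a) \<zeta> \<noteq> 0" using D_eval \<alpha>(2) by simp
    show "eval_fps P \<zeta> = 0" using P_eval[OF \<zeta>F] root(3) by simp
    show "eval_fps (fps_deriv P) \<zeta> \<noteq> 0" using p'_eval simple by simp
    show "eval_fps P x \<noteq> 0" if "0 < x" "x < \<zeta>" for x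
    proof -
      have "ereal \<bar>x\<bar> < fps_conv_radius F" using that root(2) by (auto intro: less_trans[of "ereal x" "ereal \<zeta>"])
      thus ?thesis using P_eval smallest[OF that] by simp
    qed
  qed (use delta continuation root radius square dominant in simp_all)
  have p'_neg: "p' < 0" using P_deriv_neg p'_eval by simp
  have q: "q = sqrt (- \<zeta> * p')" by (simp add: q_def p'_eval)
  have q_pos: "0 < q" using p'_neg root(1) by (simp add: q mult_pos_neg)
  have q2: "q\<^sup>2 = - \<zeta> * p'" using p'_neg root(1) by (simp add: q mult_nonneg_nonpos)
  have \<theta>_eq: "\<theta> n * real n powr (3/2) = q / (2 * sqrt pi)" if "0 < n" for n
  proof -
    have "real n powr (3/2) = (real n powr 3) powr (1/2)" by (subst powr_powr) simp
    also have "\<dots> = sqrt (real n ^ 3)" using that by (simp add: powr_half_sqrt)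
    finally have "sqrt (real n ^ 3) = real n powr (3/2)" ..
    thus ?thesis using that by (simp add: \<theta> q real_sqrt_mult)
  qed
  have \<theta>'_eq: "\<theta>' n * real n powr (1/2) = 1 / (q * sqrt pi)" if "0 < n" for n
  proof -
    have "sqrt (- \<zeta> * p' * pi * real n) = q * sqrt pi * sqrt (real n)"
      by (simp only: real_sqrt_mult q)
    hence "\<theta>' n = 1 / (q * sqrt pi * sqrt (real n))" by (simp only: \<theta>')
    thus ?thesis using that by (simp add: powr_half_sqrt)
  qed
  \<comment> \<open>\<open>k\<close> stays a variable tied to its value by an equation, so that each
    displayed coefficient is unified as it stands and compared with that value afterwards.\<close>
  have f_asymp: "fps_nth f \<sim>[at_top] (\<lambda>n. k * \<theta> n / \<zeta> ^ n)" if k: "k = 1 / (2 * \<alpha>)" for k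
  proof (rule asymp_equiv_from_limit[OF _ \<theta>_eq])
    show "(\<lambda>n. fps_nth f n * \<zeta> ^ n * real n powr (3/2)) \<longlonglongrightarrow> k * (q / (2 * sqrt pi))"
      using f_limit unfolding D_eval k by (simp add: mult_ac)
  qed (use k \<alpha> q_pos root in auto)
  define \<delta> where "\<delta> = flower_diff_at_root K cls \<zeta> F\<zeta>"
  have \<delta>_0: "\<delta> \<noteq> 0"
    using K flower_diff_at_root_1[OF root(1)] flower_diff_at_root_2[OF root(1)]
      flower_diff_at_root_12[OF root(1)] rad0 unfolding \<delta>_def by blast
  have main: "fps_nth \<Omega> \<sim>[at_top] (\<lambda>n. \<delta> * Fu\<zeta> * \<theta>' n / \<zeta> ^ n) \<and>
      E \<sim>[at_top] (\<lambda>n. 4 * \<alpha> * \<delta> * Fu\<zeta> / (- \<zeta> * p') * real n)"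
    if par: "flower_parameter cls star K kind N \<kappa> B \<and>
      ereal \<zeta> < fps_conv_radius Fu \<and> (Fu\<zeta> \<noteq> 0 \<or> Fu = 0)"
  proof -
    define Bf where "Bf = (if star then B - 1 else B)"
    let ?T = "tree_bgf cls star K kind N \<kappa>"
    have BF: "at_u1 Bf = F" "deriv_u1 Bf = Fu"
      using par by (auto simp: Bf_def F Fu flower_parameter_def)
    have Tf: "at_u1 ?T = f"
      by (simp add: at_u1_def tree_bgf_def f tree_gf_def poly_sum poly_monom fps_eq_iff)
    have "class_equation cls K Bf ?T" using par by (simp add: flower_parameter_def Bf_def)
    \<comment> \<open>The quadratic holds equally over series whose coefficients are polynomials in
      u, and is differentiated there.\<close>
    from quadratic_deriv_u1[OF class_decomposition_quadratic[OF class_equation_decomposition[OF this K] K] K]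
    have "(b - 2 * a * f) * \<Omega> = flower_diff K cls 0 fps_X F * Fu +
        flower_diff K cls 1 fps_X F * Fu * f + flower_diff K cls 2 fps_X F * Fu * f\<^sup>2"
      by (simp only: BF Tf a_def b_def \<Omega>)
    note W = this
    have En: "E n = fps_nth \<Omega> n / fps_nth f n" for n
    proof -
      have "fps_nth \<Omega> n = (\<Sum>t\<in>objects cls star K kind N n. real (\<kappa> t))"
        by (simp add: \<Omega> deriv_u1_def tree_bgf_def pderiv_sum pderiv_monom poly_sum poly_monom)
      thus ?thesis by (simp add: E mean_on_def f tree_gf_def)
    qed
    have Om: "fps_nth \<Omega> \<sim>[at_top] (\<lambda>n. \<delta> * Fu\<zeta> * \<theta>' n / \<zeta> ^ n)"
    proof (cases "Fu = 0")
      case True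
      \<comment> \<open>The constant term of h is 1, so h can be cancelled from h \<Omega> =
        0.\<close>
      have "b - 2 * a * f \<noteq> 0"
      proof
        assume "b - 2 * a * f = 0"
        thus False using zero by simp
      qed
      hence "\<Omega> = 0" using W True by simp
      moreover have "Fu\<zeta> = 0" using True Fu\<zeta> by simp
      ultimately show ?thesis by simp
    next
      case False
      hence Fu0: "Fu\<zeta> \<noteq> 0" using par by simp
      have rM: "ereal \<zeta> < fps_conv_radius (flower_diff K cls i fps_X F * Fu)" for i
        using par by (intro fps_conv_radius_mult_less quad_conv_radius root(2)) simp
      have eM: "eval_fps (flower_diff K cls i fps_X F * Fu) \<zeta> = flower_diff K cls i \<zeta> F\<zeta> * Fu\<zeta>" for i
        using par root(1) quad_conv_radius(4)[OF root(2), of K cls i] eval_quad(4)[OF \<zeta>F, of K cls i]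
        by (simp add: eval_fps_mult F\<zeta> Fu\<zeta>)
      have eb: "eval_fps b \<zeta> = quad_b K cls \<zeta> F\<zeta>"
        unfolding b_def F\<zeta> by (rule eval_quad(2)[OF \<zeta>F])
      from quotient_limit[OF rM rM rM W]
      have lim: "(\<lambda>n. fps_nth \<Omega> n * \<zeta> ^ n * real n powr (1/2)) \<longlonglongrightarrow>
          (flower_diff K cls 0 \<zeta> F\<zeta> * Fu\<zeta> + flower_diff K cls 1 \<zeta> F\<zeta> * Fu\<zeta> * (quad_b K cls \<zeta> F\<zeta> / (2 * \<alpha>)) +
           flower_diff K cls 2 \<zeta> F\<zeta> * Fu\<zeta> * (quad_b K cls \<zeta> F\<zeta> / (2 * \<alpha>))\<^sup>2) / (q * sqrt pi)"
        by (simp only: eM eb D_eval)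
      have "flower_diff K cls 0 \<zeta> F\<zeta> * Fu\<zeta> + flower_diff K cls 1 \<zeta> F\<zeta> * Fu\<zeta> * (quad_b K cls \<zeta> F\<zeta> / (2 * \<alpha>)) +
           flower_diff K cls 2 \<zeta> F\<zeta> * Fu\<zeta> * (quad_b K cls \<zeta> F\<zeta> / (2 * \<alpha>))\<^sup>2 = \<delta> * Fu\<zeta>"
        by (simp only: \<delta>_def flower_diff_at_root_def Let_def \<alpha>_def)
          (simp only: distrib_right distrib_left mult_ac)
      with lim have "(\<lambda>n. fps_nth \<Omega> n * \<zeta> ^ n * real n powr (1/2)) \<longlonglongrightarrow> \<delta> * Fu\<zeta> * (1 / (q * sqrt pi))"
        by simp
      from asymp_equiv_from_limit[OF this \<theta>'_eq] show ?thesis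
        using \<delta>_0 Fu0 q_pos root(1) by simp
    qed
    \<comment> \<open>The 4 in the mean is the 2 of 1 / (2 \<alpha>) times the 2 of \<theta>' /
      \<theta> = 2 n / q^2, where q^2 = -\<zeta> p'.\<close>
    have "(\<lambda>n. fps_nth \<Omega> n / fps_nth f n) \<sim>[at_top]
        (\<lambda>n. (\<delta> * Fu\<zeta> * \<theta>' n / \<zeta> ^ n) / (1 / (2 * \<alpha>) * \<theta> n / \<zeta> ^ n))"
      by (intro asymp_equiv_divide Om f_asymp refl)
    moreover have "eventually (\<lambda>n. (\<delta> * Fu\<zeta> * \<theta>' n / \<zeta> ^ n) / (1 / (2 * \<alpha>) * \<theta> n / \<zeta> ^ n) =
        4 * \<alpha> * \<delta> * Fu\<zeta> / (- \<zeta> * p') * real n) at_top"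
      using eventually_gt_at_top[of 0]
    proof eventually_elim
      case (elim n)
      define s where "s = real n powr (1/2)"
      have s: "s > 0" using elim by (simp add: s_def)
      have s3: "real n powr (3/2) = real n * s"
        using elim powr_add[of "real n" 1 "1/2"] by (simp add: s_def)
      have "\<theta>' n = \<theta>' n * s / s" using s by simp
      also have "\<theta>' n * s = 1 / (q * sqrt pi)" using \<theta>'_eq[OF elim] by (simp only: s_def)
      finally have 1: "\<theta>' n = 1 / (q * sqrt pi) / s" .
      have "\<theta> n = \<theta> n * (real n * s) / (real n * s)" using s elim by simp
      also have "\<theta> n * (real n * s) = q / (2 * sqrt pi)" using \<theta>_eq[OF elim] by (simp only: s3)
      finally have 2: "\<theta> n = q / (2 * sqrt pi) / (real n * s)" .
      have "\<theta>' n / \<theta> n = 2 * real n / q\<^sup>2"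
        unfolding 1 2 using s elim q_pos by (simp add: field_simps power2_eq_square)
      moreover have "(\<delta> * Fu\<zeta> * \<theta>' n / \<zeta> ^ n) / (1 / (2 * \<alpha>) * \<theta> n / \<zeta> ^ n) = 2 * \<alpha> * \<delta> * Fu\<zeta> * (\<theta>' n / \<theta> n)"
        using root(1) by simp
      ultimately show ?case by (simp add: q2)
    qed
    ultimately have "(\<lambda>n. fps_nth \<Omega> n / fps_nth f n) \<sim>[at_top] (\<lambda>n. 4 * \<alpha> * \<delta> * Fu\<zeta> / (- \<zeta> * p') * real n)"
      by (rule asymp_equiv_trans[OF _ asymp_equiv_refl_ev])
    moreover have "E = (\<lambda>n. fps_nth \<Omega> n / fps_nth f n)" using En by (intro ext)
    ultimately show ?thesis using Om by simp
  qed
  have \<Omega>_asymp: "fps_nth \<Omega> \<sim>[at_top] (\<lambda>n. k * \<theta>' n / \<zeta> ^ n)"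
    if "flower_parameter cls star K kind N \<kappa> B \<and>
      ereal \<zeta> < fps_conv_radius Fu \<and> (Fu\<zeta> \<noteq> 0 \<or> Fu = 0)" "k = \<delta> * Fu\<zeta>" for k
    using conjunct1[OF main[OF that(1)]] unfolding that(2) .
  have E_asymp: "E \<sim>[at_top] (\<lambda>n. k * real n)"
    if "flower_parameter cls star K kind N \<kappa> B \<and>
      ereal \<zeta> < fps_conv_radius Fu \<and> (Fu\<zeta> \<noteq> 0 \<or> Fu = 0)"
      "k = 4 * \<alpha> * \<delta> * Fu\<zeta> / (- \<zeta> * p')" for k
    using conjunct2[OF main[OF that(1)]] unfolding that(2) .
  have F0: "F\<zeta> \<noteq> 0" if "cls \<noteq> Class_R"
    using rad0 that by (auto simp: radicand_def split: if_splits)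
  from K consider "K = {1..}" | "K = {2}" | "K = {1, 2}" by blast
  thus ?thesis
  proof cases
    case 1
    have ne: "K \<noteq> {2}" "K \<noteq> {1, 2}" using 1 K_distinct by simp_all
    have \<alpha>_eq: "\<alpha> = (case cls of Class_R \<Rightarrow> \<zeta> | Class_S \<Rightarrow> \<zeta> * F\<zeta> | Class_T \<Rightarrow> \<zeta>)"
      by (simp add: \<alpha>_def quad_a_def 1)
    have \<delta>_eq: "\<delta> = (case cls of Class_R \<Rightarrow> (1 + \<zeta> - \<zeta> * F\<zeta>) / 2
        | Class_S \<Rightarrow> (1 - 2 * \<zeta> * F\<zeta>) / (2 * \<zeta> * F\<zeta>\<^sup>2) | Class_T \<Rightarrow> 1)"
      unfolding \<delta>_def 1 by (rule flower_diff_at_root_1(1)[OF root(1) rad0[unfolded 1]])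
    show ?thesis
      \<comment> \<open>Goals about the other two K contradict \<open>ne\<close>; the remaining ones
        match \<open>f_asymp\<close>, \<open>\<Omega>_asymp\<close> or \<open>E_asymp\<close> and
        leave an identity between coefficients.\<close>
      by (intro conjI impI; (rule notE[OF ne(1)], assumption)?; (rule notE[OF ne(2)], assumption)?;
          (elim disjE; (rule notE[OF ne(1)], assumption | rule notE[OF ne(2)], assumption))?;
          (rule f_asymp | rule \<Omega>_asymp, assumption | rule E_asymp, assumption)?;
          (use root(1) F0 simple in \<open>simp add: \<alpha>_eq \<delta>_eq field_simps power2_eq_square power3_eq_cube\<close>)?)
  next
    case 2
    have ne: "K \<noteq> {1..}" "K \<noteq> {1, 2}" using 2 K_distinct by simp_all
    have \<alpha>_eq: "\<alpha> = (case cls of Class_R \<Rightarrow> \<zeta>\<^sup>2 | Class_S \<Rightarrow> \<zeta>\<^sup>2 * F\<zeta>\<^sup>2 | Class_T \<Rightarrow> \<zeta>\<^sup>2 * F\<zeta>)"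
      unfolding \<alpha>_def quad_a_def using ne by (simp only: if_False)
    have \<delta>_eq: "\<delta> = (case cls of Class_R \<Rightarrow> 1
        | Class_S \<Rightarrow> (1 - 2 * \<zeta>\<^sup>2 * F\<zeta>\<^sup>2) / (\<zeta>\<^sup>2 * F\<zeta> ^ 3) | Class_T \<Rightarrow> 1 / (2 * \<zeta>\<^sup>2 * F\<zeta>\<^sup>2))"
      unfolding \<delta>_def 2 by (rule flower_diff_at_root_2(1)[OF root(1) rad0[unfolded 2]])
    show ?thesis
      by (intro conjI impI; (rule notE[OF ne(1)], assumption)?; (rule notE[OF ne(2)], assumption)?;
          (rule f_asymp | rule \<Omega>_asymp, assumption | rule E_asymp, assumption)?;
          (use root(1) F0 simple in \<open>simp add: \<alpha>_eq \<delta>_eq field_simps power2_eq_square power3_eq_cube\<close>)?)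
  next
    case 3
    have ne: "K \<noteq> {1..}" "K \<noteq> {2}" using 3 K_distinct by simp_all
    have \<alpha>_eq: "\<alpha> = (case cls of Class_R \<Rightarrow> \<zeta>\<^sup>2 | Class_S \<Rightarrow> \<zeta>\<^sup>2 * F\<zeta>\<^sup>2 | Class_T \<Rightarrow> \<zeta>\<^sup>2 * F\<zeta>)"
      unfolding \<alpha>_def quad_a_def using ne by (simp only: if_False)
    have \<delta>_eq: "\<delta> = (case cls of Class_R \<Rightarrow> 1
        | Class_S \<Rightarrow> (2 - 3 * \<zeta> * F\<zeta> - 3 * \<zeta>\<^sup>2 * F\<zeta>\<^sup>2) / (2 * \<zeta>\<^sup>2 * F\<zeta> ^ 3)
        | Class_T \<Rightarrow> (1 - \<zeta> * F\<zeta>) / (2 * \<zeta>\<^sup>2 * F\<zeta>\<^sup>2))"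
      unfolding \<delta>_def 3 by (rule flower_diff_at_root_12(1)[OF root(1) rad0[unfolded 3]])
    show ?thesis
      by (intro conjI impI; (rule notE[OF ne(1)], assumption)?; (rule notE[OF ne(2)], assumption)?;
          (rule f_asymp | rule \<Omega>_asymp, assumption | rule E_asymp, assumption)?;
          (use root(1) F0 simple in \<open>simp add: \<alpha>_eq \<delta>_eq field_simps power2_eq_square power3_eq_cube\<close>)?)
  qed
qed

end
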